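(* Let $Q$ be a unital simple $C^*$-algebra and $\alpha$ an action of a finite group $G$ on $Q$ with the Rohlin property. Let $H$ be a subgroup of $G$ which is not normal in $G$, and let $P\subset A$ be the inclusion of fixed point algebras $Q^G\subset Q^H$. Then the depth of $A\supset P$ is not two. In particular, $P$ is not the fixed point algebra $A^\beta$ for any action $\beta$ of a finite group on $A$ with the Rohlin property.
   Context: For a unital $C^*$-algebra $A$, $A^\infty=\ell^\infty(\mathbb{N},A)/c_0(A)$, $A$ is identified with the classes of constant sequences, and $A_\infty=A^\infty\cap A'$. An action $\alpha$ of a finite group $G$ on $A$ has the Rohlin property if there is a partition of unity $\{e_g\}_{g\in G}\subset A_\infty$ consisting of projections with $(\alpha_g)_\infty(e_h)=e_{gh}$ for all $g,h\in G$, where $(\alpha_g)_\infty$ is induced termwise. $Q^G$ and $Q^H$ are the fixed point algebras of $\alpha$ and of its restriction to $H$. A conditional expectation $F:A\to P$ has a finite index if there is a finite set $\{(u_i,v_i)\}\subset A\times A$ with $a=\sum_i u_iF(v_ia)=\sum_iF(au_i)v_i$ for all $a\in A$; then $\mathrm{Index}\,F=\sum_iu_iv_i$. The basic construction $C^*\langle A,e_P\rangle$ is the $C^*$-algebra $\{\sum_i x_ie_Py_i:x_i,y_i\in A\}$ of operators on the Hilbert $P$-module $A$ with inner product $F(x^*y)$, where $A$ acts by left multiplication and $e_P$ acts as $F$; the dual conditional expectation onto $A$ is given by $\hat F(xe_Py)=(\mathrm{Index}\,F)^{-1}xy$ and is again of finite index. Depth two: for the finite index conditional expectation $F:A\to P$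 given by $F(x)=\frac{1}{|G|}\sum_{g\in G}\alpha_g(x)$, let $A_1=C^*\langle A,e_P\rangle$ and $A_2=C^*\langle A_1,e_A\rangle$ be the first two iterated basic constructions (the second taken with respect to $\hat F:A_1\to A$). The inclusion has depth two if $P'\cap A_2$ is the linear span of $(P'\cap A_1)\,e_A\,(P'\cap A_1)$. *)

theory Defs
  imports "HOL-Analysis.Analysis" "HOL-Algebra.QuotRing" "HOL-Algebra.Module"
begin

section \<open>Unital C*-algebras\<close>

text \<open>The norm is submultiplicative and complete, and \<open>norm 1 = 1\<close> by the superclasses; in
  particular the algebra is nonzero. Subalgebras of the type are given by their carrier sets.\<close>

class cstar_algebra = real_normed_algebra_1 + complete_space +
  fixes scaleC :: "complex \<Rightarrow> 'a \<Rightarrow> 'a"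
    and star :: "'a \<Rightarrow> 'a"
  assumes scaleC_add_right: "scaleC a (x + y) = scaleC a x + scaleC a y"
    and scaleC_add_left: "scaleC (a + b) x = scaleC a x + scaleC b x"
    and scaleC_scaleC: "scaleC a (scaleC b x) = scaleC (a * b) x"
    and scaleR_scaleC: "scaleR r x = scaleC (complex_of_real r) x"
    and mult_scaleC_left: "scaleC a x * y = scaleC a (x * y)"
    and mult_scaleC_right: "x * scaleC a y = scaleC a (x * y)"
    and norm_scaleC: "norm (scaleC a x) = cmod a * norm x"
    and star_star: "star (star x) = x"
    and star_add: "star (x + y) = star x + star y"
    and star_scaleC: "star (scaleC a x) = scaleC (cnj a) (star x)"
    and star_mult: "star (x * y) = star y * star x"
    and cstar_identity: "norm (star x * x) = (norm x)\<^sup>2"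

definition closed_ideal :: "'a::cstar_algebra set \<Rightarrow> 'a set \<Rightarrow> bool" where
  "closed_ideal A I \<longleftrightarrow>
     I \<subseteq> A \<and> closed I \<and> 0 \<in> I \<and>
     (\<forall>x\<in>I. \<forall>y\<in>I. x + y \<in> I) \<and> (\<forall>c. \<forall>x\<in>I. scaleC c x \<in> I) \<and>
     (\<forall>a\<in>A. \<forall>x\<in>I. a * x \<in> I \<and> x * a \<in> I)"

definition simple_cstar :: "'a::cstar_algebra set \<Rightarrow> bool" where
  "simple_cstar A \<longleftrightarrow> (\<forall>I. closed_ideal A I \<longrightarrow> I = {0} \<or> I = A)"


section \<open>Group actions and the Rohlin property\<close>

definition star_automorphism :: "'a::cstar_algebra set \<Rightarrow> ('a \<Rightarrow> 'a) \<Rightarrow> bool" where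
  "star_automorphism A f \<longleftrightarrow>
     bij_betw f A A \<and>
     (\<forall>x\<in>A. \<forall>y\<in>A. f (x + y) = f x + f y \<and> f (x * y) = f x * f y) \<and>
     (\<forall>c. \<forall>x\<in>A. f (scaleC c x) = scaleC c (f x)) \<and>
     (\<forall>x\<in>A. f (star x) = star (f x))"

definition cstar_action ::
  "'a::cstar_algebra set \<Rightarrow> ('g, 'm) monoid_scheme \<Rightarrow> ('g \<Rightarrow> 'a \<Rightarrow> 'a) \<Rightarrow> bool" where
  "cstar_action A G \<alpha> \<longleftrightarrow>
     (\<forall>g\<in>carrier G. star_automorphism A (\<alpha> g)) \<and>
     (\<forall>x\<in>A. \<alpha> \<one>\<^bsub>G\<^esub> x = x) \<and>
     (\<forall>g\<in>carrier G. \<forall>h\<in>carrier G. \<forall>x\<in>A. \<alpha> (g \<otimes>\<^bsub>G\<^esub> h) x = \<alpha> g (\<alpha> h x))"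

definition fixed_points :: "'a set \<Rightarrow> 'g set \<Rightarrow> ('g \<Rightarrow> 'a \<Rightarrow> 'a) \<Rightarrow> 'a set" where
  "fixed_points A S \<alpha> = {x \<in> A. \<forall>g\<in>S. \<alpha> g x = x}"

definition ell_infinity :: "'a::cstar_algebra set \<Rightarrow> (nat \<Rightarrow> 'a) ring" where
  "ell_infinity A =
     \<lparr>carrier = {x. range x \<subseteq> A \<and> Bseq x},
      mult = (\<lambda>x y n. x n * y n), one = (\<lambda>n. 1),
      zero = (\<lambda>n. 0), add = (\<lambda>x y n. x n + y n)\<rparr>"

definition null_seqs :: "'a::cstar_algebra set \<Rightarrow> (nat \<Rightarrow> 'a) set" where
  "null_seqs A = {x \<in> carrier (ell_infinity A). x \<longlonglongrightarrow> 0}"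

definition seq_algebra :: "'a::cstar_algebra set \<Rightarrow> (nat \<Rightarrow> 'a) set ring" where
  "seq_algebra A = ell_infinity A Quot null_seqs A"

definition const_class :: "'a::cstar_algebra set \<Rightarrow> 'a \<Rightarrow> (nat \<Rightarrow> 'a) set" where
  "const_class A a = null_seqs A +>\<^bsub>ell_infinity A\<^esub> (\<lambda>n. a)"

text \<open>The map induced termwise on cosets modulo \<open>null_seqs A\<close>: for a \<open>*\<close>-automorphism of \<open>A\<close>
  and for \<open>star\<close> the image of a coset is again a coset.\<close>

definition termwise :: "('a \<Rightarrow> 'a) \<Rightarrow> (nat \<Rightarrow> 'a) set \<Rightarrow> (nat \<Rightarrow> 'a) set" where
  "termwise f X = (\<lambda>x n. f (x n)) ` X"

definition central_seqs :: "'a::cstar_algebra set \<Rightarrow> (nat \<Rightarrow> 'a) set set" where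
  "central_seqs A =
     {X \<in> carrier (seq_algebra A).
        \<forall>a\<in>A. X \<otimes>\<^bsub>seq_algebra A\<^esub> const_class A a = const_class A a \<otimes>\<^bsub>seq_algebra A\<^esub> X}"

definition rohlin_property ::
  "'a::cstar_algebra set \<Rightarrow> ('g, 'm) monoid_scheme \<Rightarrow> ('g \<Rightarrow> 'a \<Rightarrow> 'a) \<Rightarrow> bool" where
  "rohlin_property A G \<alpha> \<longleftrightarrow>
     (\<exists>e. (\<forall>g\<in>carrier G.
              e g \<in> central_seqs A \<and>
              e g \<otimes>\<^bsub>seq_algebra A\<^esub> e g = e g \<and> termwise star (e g) = e g) \<and>
          (\<Oplus>\<^bsub>seq_algebra A\<^esub>g\<in>carrier G. e g) = \<one>\<^bsub>seq_algebra A\<^esub> \<and>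
          (\<forall>g\<in>carrier G. \<forall>h\<in>carrier G. termwise (\<alpha> g) (e h) = e (g \<otimes>\<^bsub>G\<^esub> h)))"


section \<open>Index, basic construction and depth two\<close>

text \<open>The construction has to be iterated, so it is phrased for complex algebras \<open>R\<close> given as
  records. A subalgebra of a C*-algebra enters through \<open>algebra_of\<close>.\<close>

definition algebra_of :: "'a::cstar_algebra set \<Rightarrow> (complex, 'a) module" where
  "algebra_of A =
     \<lparr>carrier = A, mult = (*), one = 1, zero = 0, add = (+), smult = scaleC\<rparr>"

definition linear_span :: "(complex, 'a) module \<Rightarrow> 'a set \<Rightarrow> 'a set" where
  "linear_span R X =
     {\<Oplus>\<^bsub>R\<^esub>i\<in>{..<n}. c i \<odot>\<^bsub>R\<^esub> x i | (n::nat) c x. x \<in> {..<n} \<rightarrow> X}"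

definition relative_commutant :: "(complex, 'a) module \<Rightarrow> 'a set \<Rightarrow> 'a set" where
  "relative_commutant R S = {x \<in> carrier R. \<forall>s\<in>S. s \<otimes>\<^bsub>R\<^esub> x = x \<otimes>\<^bsub>R\<^esub> s}"

definition quasi_basis ::
  "(complex, 'a) module \<Rightarrow> ('a \<Rightarrow> 'a) \<Rightarrow> nat \<Rightarrow> (nat \<Rightarrow> 'a) \<Rightarrow> (nat \<Rightarrow> 'a) \<Rightarrow> bool" where
  "quasi_basis R F n u v \<longleftrightarrow>
     u \<in> {..<n} \<rightarrow> carrier R \<and> v \<in> {..<n} \<rightarrow> carrier R \<and>
     (\<forall>a\<in>carrier R.
        a = (\<Oplus>\<^bsub>R\<^esub>i\<in>{..<n}. u i \<otimes>\<^bsub>R\<^esub> F (v i \<otimes>\<^bsub>R\<^esub> a)) \<and>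
        a = (\<Oplus>\<^bsub>R\<^esub>i\<in>{..<n}. F (a \<otimes>\<^bsub>R\<^esub> u i) \<otimes>\<^bsub>R\<^esub> v i))"

text \<open>The value does not depend on the quasi-basis.\<close>

definition expectation_index :: "(complex, 'a) module \<Rightarrow> ('a \<Rightarrow> 'a) \<Rightarrow> 'a" where
  "expectation_index R F =
     (THE z. \<exists>n u v. quasi_basis R F n u v \<and> z = (\<Oplus>\<^bsub>R\<^esub>i\<in>{..<n}. u i \<otimes>\<^bsub>R\<^esub> v i))"

text \<open>Operators on the right \<open>P\<close>-module \<open>R\<close>, with pointwise linear structure and composition
  as product; they are extensional, i.e. \<open>undefined\<close> outside \<open>carrier R\<close>.\<close>

definition module_operators ::
  "(complex, 'a) module \<Rightarrow> 'a set \<Rightarrow> (complex, 'a \<Rightarrow> 'a) module" where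
  "module_operators R P =
     \<lparr>carrier = {T \<in> carrier R \<rightarrow>\<^sub>E carrier R.
        (\<forall>x\<in>carrier R. \<forall>y\<in>carrier R. T (x \<oplus>\<^bsub>R\<^esub> y) = T x \<oplus>\<^bsub>R\<^esub> T y) \<and>
        (\<forall>c. \<forall>x\<in>carrier R. T (c \<odot>\<^bsub>R\<^esub> x) = c \<odot>\<^bsub>R\<^esub> T x) \<and>
        (\<forall>x\<in>carrier R. \<forall>p\<in>P. T (x \<otimes>\<^bsub>R\<^esub> p) = T x \<otimes>\<^bsub>R\<^esub> p)},
      mult = compose (carrier R),
      one = (\<lambda>x\<in>carrier R. x),
      zero = (\<lambda>x\<in>carrier R. \<zero>\<^bsub>R\<^esub>),
      add = (\<lambda>S T. \<lambda>x\<in>carrier R. S x \<oplus>\<^bsub>R\<^esub> T x),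
      smult = (\<lambda>c T. \<lambda>x\<in>carrier R. c \<odot>\<^bsub>R\<^esub> T x)\<rparr>"

definition left_mult :: "(complex, 'a) module \<Rightarrow> 'a \<Rightarrow> 'a \<Rightarrow> 'a" where
  "left_mult R a = (\<lambda>x\<in>carrier R. a \<otimes>\<^bsub>R\<^esub> x)"

definition jones_projection :: "(complex, 'a) module \<Rightarrow> ('a \<Rightarrow> 'a) \<Rightarrow> 'a \<Rightarrow> 'a" where
  "jones_projection R F = (\<lambda>x\<in>carrier R. F x)"

text \<open>The operator \<open>x e\<^sub>P y\<close>.\<close>

definition jones_product :: "(complex, 'a) module \<Rightarrow> ('a \<Rightarrow> 'a) \<Rightarrow> 'a \<Rightarrow> 'a \<Rightarrow> 'a \<Rightarrow> 'a" where
  "jones_product R F x y =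
     compose (carrier R) (left_mult R x)
       (compose (carrier R) (jones_projection R F) (left_mult R y))"

definition jones_sum ::
  "(complex, 'a) module \<Rightarrow> 'a set \<Rightarrow> ('a \<Rightarrow> 'a) \<Rightarrow> nat \<Rightarrow> (nat \<Rightarrow> 'a) \<Rightarrow> (nat \<Rightarrow> 'a) \<Rightarrow> 'a \<Rightarrow> 'a" where
  "jones_sum R P F n x y =
     (\<Oplus>\<^bsub>module_operators R P\<^esub>i\<in>{..<n}. jones_product R F (x i) (y i))"

text \<open>For an expectation of finite index the finite sums of the operators \<open>x e\<^sub>P y\<close> already form
  the C*-algebra generated by \<open>A\<close> and \<open>e\<^sub>P\<close>. The \<open>P\<close>-valued inner product \<open>F (x* y)\<close> determines
  its adjoint and norm, which are not recorded because index and depth depend only on the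
  underlying complex algebra.\<close>

definition basic_construction ::
  "(complex, 'a) module \<Rightarrow> 'a set \<Rightarrow> ('a \<Rightarrow> 'a) \<Rightarrow> (complex, 'a \<Rightarrow> 'a) module" where
  "basic_construction R P F =
     (module_operators R P)
       \<lparr>carrier := {jones_sum R P F n x y | n x y.
                      x \<in> {..<n} \<rightarrow> carrier R \<and> y \<in> {..<n} \<rightarrow> carrier R}\<rparr>"

text \<open>The linear extension of \<open>x e\<^sub>P y \<mapsto> (Index F)\<^sup>-\<^sup>1 x y\<close>; the value does not depend on the
  representation of \<open>T\<close>.\<close>

definition dual_expectation ::
  "(complex, 'a) module \<Rightarrow> 'a set \<Rightarrow> ('a \<Rightarrow> 'a) \<Rightarrow> ('a \<Rightarrow> 'a) \<Rightarrow> 'a" where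
  "dual_expectation R P F T =
     (THE z. \<exists>n x y.
        x \<in> {..<n} \<rightarrow> carrier R \<and> y \<in> {..<n} \<rightarrow> carrier R \<and>
        T = jones_sum R P F n x y \<and>
        z = inv\<^bsub>R\<^esub> (expectation_index R F) \<otimes>\<^bsub>R\<^esub> (\<Oplus>\<^bsub>R\<^esub>i\<in>{..<n}. x i \<otimes>\<^bsub>R\<^esub> y i))"

text \<open>Each algebra is embedded in the next one by left multiplication; under this embedding
  \<open>E\<close> is the dual expectation, viewed as a map from \<open>A1\<close> to itself.\<close>

definition depth_two :: "(complex, 'a) module \<Rightarrow> 'a set \<Rightarrow> ('a \<Rightarrow> 'a) \<Rightarrow> bool" where
  "depth_two A P F \<longleftrightarrow>
     (let A1 = basic_construction A P F;
          E = (\<lambda>T. left_mult A (dual_expectation A P F T));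
          A2 = basic_construction A1 (left_mult A ` carrier A) E;
          C1 = relative_commutant A1 (left_mult A ` P);
          C2 = relative_commutant A2 (left_mult A1 ` left_mult A ` P)
      in C2 = linear_span A2 {jones_product A1 E x y | x y. x \<in> C1 \<and> y \<in> C1})"

definition group_average ::
  "('g, 'm) monoid_scheme \<Rightarrow> ('g \<Rightarrow> 'a \<Rightarrow> 'a) \<Rightarrow> 'a \<Rightarrow> 'a::cstar_algebra" where
  "group_average G \<alpha> x = scaleC (1 / of_nat (card (carrier G))) (\<Sum>g\<in>carrier G. \<alpha> g x)"

end

theory Submission
  imports Defs
begin

text \<open>The Rohlin property makes every \<open>\<alpha>\<^sub>g\<close>, \<open>g \<noteq> 1\<close>, outer, and simplicity makes the centre of \<open>Q\<close>
  scalar. Hence \<open>Q \<supset> Q\<^sup>G\<close> is a Galois extension: there are \<open>x\<^sub>i, y\<^sub>i\<close> with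
  \<open>\<Sum>\<^sub>i x\<^sub>i \<alpha>\<^sub>g(y\<^sub>i) = \<delta>\<^bsub>g,1\<^esub>\<close>. Averaging over \<open>H\<close> gives such coordinates for \<open>A\<close>, with
  \<open>\<delta>\<^bsub>g,1\<^esub>\<close> replaced by \<open>[g \<in> H] / |H|\<close>; they form a quasi-basis of \<open>F\<close>, determine the basic
  constructions explicitly, and show that \<open>P' \<inter> Q\<close> is scalar.
  Under depth two the unit of \<open>A\<^sub>2\<close> is a combination of operators \<open>X e\<^sub>A Y\<close> with
  \<open>X, Y \<in> P' \<inter> A\<^sub>1\<close>, and extracting the \<open>\<alpha>\<^sub>g\<close>-coefficient shows \<open>\<alpha>\<^sub>g(A) = A\<close> for all \<open>g\<close>; since \<open>H\<close> is
  the set of all \<open>g\<close> fixing \<open>A\<close> pointwise, \<open>H\<close> is normal. For the second part, every homomorphism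
  \<open>A \<rightarrow> A\<close> fixing \<open>P\<close> is the restriction of some \<open>\<alpha>\<^sub>g\<close>, so \<open>P = A\<^sup>\<beta>\<close> again forces all \<open>\<alpha>\<^sub>g\<close> to
  preserve \<open>A\<close>.\<close>

section \<open>Self-adjoint elements and the centre of a simple C*-algebra\<close>

\<comment> \<open>The obstacle is that G does not act on A when H is not normal: each \<alpha>_g
  only maps A into Q. So A_1 is no crossed product of A; its operators are sums of maps a |-> c_k
  \<alpha>_k(a) whose coefficients c_k lie in Q, and commutation with P says something about them
  only because P' is computed in all of Q. The coordinates enter mostly through one identity in the
  tensor square of A over P, the one behind \<open>balanced_transfer\<close>. Fed with \<alpha>_g, a
  module operator or a homomorphism, it produces elements that intertwine two maps; outerness or
  scalarity of P' then decides what they are. Index and dual expectation are given by definite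
  descriptions, and the coordinates also supply closed formulas for them. Spectrum and functional
  calculus are replaced by norm estimates for powers: for a self-adjoint w of norm one, 1 + w or 1 -
  w has norm 2, which stands for the fact that 1 or -1 is a spectral value.\<close>
subclass (in cstar_algebra) banach ..

section \<open>Scalars, involution and norms of powers\<close>

lemma scaleC_zero_right [simp]: "scaleC c (0::'a::cstar_algebra) = 0"
  using norm_scaleC[of c "0::'a"] by simp

lemma scaleC_one [simp]: "scaleC 1 (x::'a::cstar_algebra) = x"
  using scaleR_scaleC[of 1 x] by simp

lemma scaleC_conv_mult: "scaleC c (x::'a::cstar_algebra) = scaleC c 1 * x"
  by (simp add: mult_scaleC_left)

lemma scaleC_of_real: "scaleC (of_real r) (x::'a::cstar_algebra) = r *\<^sub>R x"
  by (simp add: scaleR_scaleC)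

lemma scaleC_zero_left [simp]: "scaleC 0 (x::'a::cstar_algebra) = 0"
  using scaleC_of_real[of 0 x] by simp

lemma scaleC_sum_right: "scaleC c (\<Sum>i\<in>I. f i) = (\<Sum>i\<in>I. scaleC c (f i :: 'a::cstar_algebra))"
proof (induction I rule: infinite_finite_induct)
  case (insert i I)
  then show ?case by (simp add: scaleC_add_right)
qed auto

lemma scaleC_sum_left:
  "scaleC (\<Sum>i\<in>I. f i) (x::'a::cstar_algebra) = (\<Sum>i\<in>I. scaleC (f i) x)"
  by (induction I rule: infinite_finite_induct) (simp_all add: scaleC_add_left)

lemma scaleC_power: "(scaleC c (x::'a::cstar_algebra)) ^ n = scaleC (c ^ n) (x ^ n)"
  by (induction n) (simp_all add: mult_scaleC_left mult_scaleC_right scaleC_scaleC mult_ac)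

lemma star_zero [simp]: "star (0::'a::cstar_algebra) = 0"
  using star_add[of "0::'a" 0] by simp

lemma star_one [simp]: "star (1::'a::cstar_algebra) = 1"
proof -
  have "star (1::'a) = star 1 * star (star 1)" by (simp add: star_star)
  also have "\<dots> = star (star 1 * 1)" by (simp only: star_mult)
  finally show ?thesis by (simp add: star_star)
qed

lemma star_minus: "star (- x :: 'a::cstar_algebra) = - star x"
  using star_add[of x "- x"] by (simp add: eq_neg_iff_add_eq_0 add.commute)

lemma star_diff: "star (x - y :: 'a::cstar_algebra) = star x - star y"
  using star_add[of x "- y"] by (simp add: star_minus)

lemma star_scaleR: "star (r *\<^sub>R x :: 'a::cstar_algebra) = r *\<^sub>R star x"
  by (simp add: scaleR_scaleC star_scaleC)

lemma star_power: "star (x ^ n :: 'a::cstar_algebra) = star x ^ n"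
  by (induction n) (simp_all add: star_mult power_commutes)

lemma selfadjoint_norm_square:
  assumes "star (x::'a::cstar_algebra) = x"
  shows "norm (x\<^sup>2) = (norm x)\<^sup>2"
  using cstar_identity[of x] assms by (simp add: power2_eq_square)

text \<open>The C*-identity, iterated. Exact norms are available along powers of 2, which is why the
  exponents in the estimates below have the form \<open>2 ^ k\<close>.\<close>

lemma selfadjoint_norm_power2:
  assumes "star (x::'a::cstar_algebra) = x"
  shows "norm (x ^ 2 ^ k) = norm x ^ 2 ^ k"
proof (induction k)
  case (Suc k)
  have dbl: "y ^ 2 ^ Suc k = (y ^ 2 ^ k)\<^sup>2" for y :: "'b::monoid_mult"
    by (simp only: power_Suc power_mult[symmetric] mult.commute)
  show ?case
    using selfadjoint_norm_square[of "x ^ 2 ^ k"] Suc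
    by (simp only: dbl star_power assms)
qed simp

lemma one_plus_power:
  "(1 + u :: 'a::ring_1) ^ n = (\<Sum>j\<le>n. of_nat (n choose j) * u ^ j)"
proof (induction n)
  case (Suc n)
  have "(1 + u) ^ Suc n = (\<Sum>j\<le>n. of_nat (n choose j) * u ^ j) + (\<Sum>j\<le>n. of_nat (n choose j) * u ^ Suc j)"
    using Suc by (simp add: power_Suc2 distrib_left sum_distrib_right mult.assoc power_commutes
        del: power_Suc)
  also have "(\<Sum>j\<le>n. of_nat (n choose j) * u ^ j) = (\<Sum>j\<le>Suc n. of_nat (n choose j) * u ^ j)"
    by (simp add: binomial_eq_0)
  also have "\<dots> = 1 + (\<Sum>j\<le>n. of_nat (n choose Suc j) * u ^ Suc j)"
    by (subst sum.atMost_Suc_shift) simp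
  also have "\<dots> + (\<Sum>j\<le>n. of_nat (n choose j) * u ^ Suc j)
      = 1 + (\<Sum>j\<le>n. of_nat (Suc n choose Suc j) * u ^ Suc j)"
    by (simp add: sum.distrib[symmetric] distrib_right add_ac)
  also have "\<dots> = (\<Sum>j\<le>Suc n. of_nat (Suc n choose j) * u ^ j)"
    by (subst sum.atMost_Suc_shift) simp
  finally show ?case .
qed simp

text \<open>Orthogonality of the characters of the cyclic group of order n; the bound on i leaves 0
  as the only multiple of n.\<close>

lemma roots_of_unity_sum:
  fixes i :: int and n :: nat
  assumes "0 < n" and "\<bar>i\<bar> < int n"
  shows "(\<Sum>l::nat<n. cis (2 * pi * i * l / n)) = (if i = 0 then of_nat n else 0)"
proof (cases "i = 0")
  case False
  define z where "z = cis (2 * pi * i / n)"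
  have pw: "cis (2 * pi * i * l / n) = z ^ l" for l :: nat
  proof -
    have "2 * pi * i * l / n = real l * (2 * pi * i / n)" by simp
    then show ?thesis by (simp only: z_def Complex.DeMoivre)
  qed
  have zn: "z ^ n = 1"
    unfolding z_def Complex.DeMoivre using assms(1) cis_multiple_2pi[of "of_int i"] by simp
  have "z \<noteq> 1"
  proof
    assume "z = 1"
    then have "cos (2 * pi * i / n) = 1" unfolding z_def by (simp add: complex_eq_iff)
    then obtain k :: int where "2 * pi * i / n = k * (2 * pi)"
      unfolding cos_one_2pi_int by auto
    then have "real_of_int i = real_of_int (k * int n)" using assms(1) by (simp add: field_simps)
    then have "i = k * int n" by linarith
    with False assms show False by (auto simp: abs_mult)
  qed
  then show ?thesis
    using False zn by (simp only: pw sum_gp_strict) simp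
qed auto

text \<open>With c the real part of the unit scalar, the C*-square of \<open>1 + scaleC w' w\<close>
  is 1 + 2cw + w^2. This is the convex combination of (1 + w)^2 and (1 - w)^2 with weights (1 + c)/2
  and (1 - c)/2, so the signs 1 and -1 control the whole circle.\<close>

lemma selfadjoint_norm_one_plus_unit:
  fixes w :: "'a::cstar_algebra"
  assumes sa: "star w = w" and w: "cmod w' = 1"
    and k: "norm (1 + w) \<le> \<kappa>" "norm (1 - w) \<le> \<kappa>"
  shows "norm (1 + scaleC w' w) \<le> \<kappa>"
proof -
  define c where "c = Re w'"
  have c: "\<bar>c\<bar> \<le> 1" unfolding c_def using abs_Re_le_cmod[of w'] w by simp
  have k0: "0 \<le> \<kappa>" using k(1) norm_ge_zero[of "1 + w"] by linarith
  have cnjw: "cnj w' * w' = 1"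
    using complex_norm_square[of w'] w by (simp add: mult.commute)
  have scw: "scaleC w' w + scaleC (cnj w') w = (2 * c) *\<^sub>R w"
    unfolding scaleC_add_left[symmetric] complex_add_cnj c_def by (rule scaleC_of_real)
  have "star (1 + scaleC w' w) * (1 + scaleC w' w) = 1 + (scaleC w' w + scaleC (cnj w') w) + w * w"
    by (simp add: star_add star_scaleC sa distrib_left distrib_right mult_scaleC_left
        mult_scaleC_right scaleC_add_right scaleC_scaleC cnjw cnjw[unfolded mult.commute[of "cnj w'"]])
  also have "\<dots> = ((1 + c) / 2) *\<^sub>R (1 + w)\<^sup>2 + ((1 - c) / 2) *\<^sub>R (1 - w)\<^sup>2"
  proof -
    have half: "(1 / 2) *\<^sub>R (y + y) = y" for y :: 'a
      by (simp add: scaleR_2[symmetric])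
    have "((1 + c) / 2) *\<^sub>R (1 + w)\<^sup>2 + ((1 - c) / 2) *\<^sub>R (1 - w)\<^sup>2
        = (1 / 2) *\<^sub>R ((1 + w)\<^sup>2 + (1 - w)\<^sup>2 + c *\<^sub>R ((1 + w)\<^sup>2 - (1 - w)\<^sup>2))"
    proof -
      have "(1 + c) / 2 = 1 / 2 + c / 2" "(1 - c) / 2 = 1 / 2 - c / 2" by (simp_all add: field_simps)
      then show ?thesis
        by (simp only: scaleR_add_left scaleR_diff_left scaleR_add_right scaleR_diff_right) simp
    qed
    also have "(1 + w)\<^sup>2 + (1 - w)\<^sup>2 = (1 + w * w) + (1 + w * w)"
      by (simp add: power2_eq_square algebra_simps)
    also have "(1 + w)\<^sup>2 - (1 - w)\<^sup>2 = 2 *\<^sub>R w + 2 *\<^sub>R w"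
      by (simp add: power2_eq_square algebra_simps scaleR_2)
    also have "(1 / 2) *\<^sub>R ((1 + w * w) + (1 + w * w) + c *\<^sub>R (2 *\<^sub>R w + 2 *\<^sub>R w))
        = (1 / 2) *\<^sub>R ((1 + (2 * c) *\<^sub>R w + w * w) + (1 + (2 * c) *\<^sub>R w + w * w))"
      by (simp add: scaleR_add_right add_ac mult.commute)
    also have "\<dots> = 1 + (2 * c) *\<^sub>R w + w * w" by (rule half)
    finally show ?thesis unfolding scw by simp
  qed
  finally have "(norm (1 + scaleC w' w))\<^sup>2 =
      norm (((1 + c) / 2) *\<^sub>R (1 + w)\<^sup>2 + ((1 - c) / 2) *\<^sub>R (1 - w)\<^sup>2)"
    by (simp add: cstar_identity[symmetric])
  also have "\<dots> \<le> norm (((1 + c) / 2) *\<^sub>R (1 + w)\<^sup>2) + norm (((1 - c) / 2) *\<^sub>R (1 - w)\<^sup>2)"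
    by (rule norm_triangle_ineq)
  also have "\<dots> = ((1 + c) / 2) * norm ((1 + w)\<^sup>2) + ((1 - c) / 2) * norm ((1 - w)\<^sup>2)"
    using c by (simp add: abs_le_iff)
  also have "\<dots> \<le> ((1 + c) / 2) * \<kappa>\<^sup>2 + ((1 - c) / 2) * \<kappa>\<^sup>2"
  proof (intro add_mono mult_left_mono)
    show "norm ((1 + w)\<^sup>2) \<le> \<kappa>\<^sup>2" "norm ((1 - w)\<^sup>2) \<le> \<kappa>\<^sup>2"
      using k by (meson norm_power_ineq order_trans power_mono norm_ge_zero)+
  qed (use c in \<open>auto simp: abs_le_iff\<close>)
  also have "\<dots> = \<kappa>\<^sup>2" by (simp add: field_simps)
  finally show ?thesis using k0 by (rule power2_le_imp_le)
qed

text \<open>Averaging \<open>(1 + \<omega>w)\<^sup>n\<close> over the roots of unity \<open>\<omega>\<close> of order \<open>n + 1\<close> isolates the term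
  of degree \<open>j\<close>.\<close>

lemma norm_binomial_term_le:
  fixes w :: "'a::cstar_algebra"
  assumes k: "\<And>\<omega>. cmod \<omega> = 1 \<Longrightarrow> norm (1 + scaleC \<omega> w) \<le> \<kappa>" and j: "j \<le> n"
  shows "real (n choose j) * norm (w ^ j) \<le> \<kappa> ^ n"
proof -
  \<comment> \<open>Both i and j lie in 0..n, so |i - j| < n + 1 and only i = j survives the
    averaging.\<close>
  define N where "N = Suc n"
  define z where "z i l = cis (2 * pi * real_of_int i * real l / real N)" for i :: int and l :: nat
  have zsum: "(\<Sum>l<N. z i l) = (if i = 0 then of_nat N else 0)" if "\<bar>i\<bar> < int N" for i
    unfolding z_def using roots_of_unity_sum[of N i] that by (simp add: N_def)
  have zz: "z (- int j) l * (z 1 l) ^ i = z (int i - int j) l" for l i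
    unfolding z_def Complex.DeMoivre cis_mult by (rule arg_cong[where f = cis]) (simp add: left_diff_distrib right_diff_distrib diff_divide_distrib mult_ac)
  have cz: "cmod (z i l) = 1" for i l by (simp add: z_def)
  have "(\<Sum>l<N. scaleC (z (- int j) l) ((1 + scaleC (z 1 l) w) ^ n))
      = (\<Sum>l<N. \<Sum>i\<le>n. scaleC (z (int i - int j) l) (of_nat (n choose i) * w ^ i))"
    by (simp add: one_plus_power scaleC_sum_right scaleC_power mult_scaleC_right scaleC_scaleC zz)
  also have "\<dots> = (\<Sum>i\<le>n. scaleC (\<Sum>l<N. z (int i - int j) l) (of_nat (n choose i) * w ^ i))"
    by (subst sum.swap) (simp add: scaleC_sum_left)
  also have "\<dots> = (\<Sum>i\<le>n. if i = j then scaleC (of_nat N) (of_nat (n choose i) * w ^ i) else 0)"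
  proof (rule sum.cong)
    fix i assume "i \<in> {..n}"
    then have "\<bar>int i - int j\<bar> < int N" using j by (auto simp: N_def)
    then show "scaleC (\<Sum>l<N. z (int i - int j) l) (of_nat (n choose i) * w ^ i) =
        (if i = j then scaleC (of_nat N) (of_nat (n choose i) * w ^ i) else 0)"
      by (simp add: zsum)
  qed simp
  also have "\<dots> = scaleC (of_nat N) (of_nat (n choose j) * w ^ j)" using j by simp
  finally have eq: "(\<Sum>l<N. scaleC (z (- int j) l) ((1 + scaleC (z 1 l) w) ^ n)) = \<dots>" .
  have "real N * (real (n choose j) * norm (w ^ j)) = norm (scaleC (of_nat N) (of_nat (n choose j) * w ^ j))"
  proof -
    have "of_nat (n choose j) * w ^ j = real (n choose j) *\<^sub>R w ^ j"
      by (simp add: scaleR_conv_of_real)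
    then show ?thesis by (simp add: norm_scaleC)
  qed
  also have "\<dots> \<le> (\<Sum>l<N. norm (scaleC (z (- int j) l) ((1 + scaleC (z 1 l) w) ^ n)))"
    unfolding eq[symmetric] by (rule norm_sum)
  also have "\<dots> \<le> (\<Sum>l<N. \<kappa> ^ n)"
  proof (rule sum_mono)
    fix l
    have "norm ((1 + scaleC (z 1 l) w) ^ n) \<le> norm (1 + scaleC (z 1 l) w) ^ n"
      by (rule norm_power_ineq)
    also have "\<dots> \<le> \<kappa> ^ n" by (intro power_mono k cz norm_ge_zero)
    finally show "norm (scaleC (z (- int j) l) ((1 + scaleC (z 1 l) w) ^ n)) \<le> \<kappa> ^ n"
      by (simp add: norm_scaleC cz)
  qed
  finally show ?thesis by (simp add: N_def)
qed

text \<open>If both norms were below 2, the middle term of (1 + w)^(2j) would be too large: the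
  central binomial coefficient is at least 4^j / (2j), the norm of w^j is 1 for j a power of 2, and
  4^j / (2j) outgrows \<kappa>^(2j) for every \<kappa> < 2.\<close>

lemma selfadjoint_norm_attained:
  fixes w :: "'a::cstar_algebra"
  assumes sa: "star w = w" and w: "norm w = 1"
  shows "norm (1 + w) = 2 \<or> norm (1 - w) = 2"
proof (rule ccontr)
  assume neg: "\<not> ?thesis"
  \<comment> \<open>The entry 1 keeps \<kappa> positive for the divisions below.\<close>
  define \<kappa> where "\<kappa> = max 1 (max (norm (1 + w)) (norm (1 - w)))"
  have "norm (1 + w) \<le> 2" "norm (1 - w) \<le> 2"
    using norm_triangle_ineq[of 1 w] norm_triangle_ineq4[of 1 w] w by auto
  with neg have k2: "\<kappa> < 2" and k1: "1 \<le> \<kappa>" by (auto simp: \<kappa>_def)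
  have bound: "(4 / \<kappa>\<^sup>2) ^ j \<le> 2 * real j" if j: "j = 2 ^ k" for j k
  proof -
    have "norm (w ^ j) = 1" using selfadjoint_norm_power2[OF sa, of k] w j by simp
    then have "real (2 * j choose j) \<le> \<kappa> ^ (2 * j)"
      using norm_binomial_term_le[of w \<kappa> j "2 * j"] selfadjoint_norm_one_plus_unit[OF sa, of _ \<kappa>]
      by (simp add: \<kappa>_def)
    moreover have "4 ^ j / (2 * real j) \<le> real (2 * j choose j)"
      using central_binomial_lower_bound[of j] j by simp
    ultimately have "4 ^ j / (2 * real j) \<le> (\<kappa>\<^sup>2) ^ j" by (simp add: power_mult)
    moreover have "0 < real j" using j by simp
    ultimately show ?thesis using k1 by (simp add: field_simps power_divide)
  qed
  define q where "q = 4 / \<kappa>\<^sup>2"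
  have "\<kappa>\<^sup>2 < 2\<^sup>2" using k1 k2 by (intro power_strict_mono) auto
  then have q: "1 < q" using k1 by (simp add: q_def field_simps)
  have "filterlim (\<lambda>k::nat. (2::nat) ^ k) at_top at_top"
    by (rule filterlim_subseq) (simp add: strict_mono_def)
  moreover have "(\<lambda>n. real n * (1 / q) ^ n) \<longlonglongrightarrow> 0"
    using q by (intro powser_times_n_limit_0) auto
  ultimately have "(\<lambda>k. real (2 ^ k) * (1 / q) ^ (2 ^ k)) \<longlonglongrightarrow> 0"
    by (rule filterlim_compose[rotated])
  then have "eventually (\<lambda>k. real (2 ^ k) * (1 / q) ^ (2 ^ k) < 1 / 2) sequentially"
    by (rule order_tendstoD) simp
  then obtain k where k: "real (2 ^ k) * (1 / q) ^ (2 ^ k) < 1 / 2"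
    using eventually_happens' sequentially_bot by blast
  have "real (2 ^ k) < q ^ 2 ^ k / 2"
    using k q by (simp add: power_divide field_simps)
  with bound[of "2 ^ k" k] show False by (simp add: q_def)
qed

text \<open>Simplicity speaks of closed ideals, but a dense ideal meets the open unit ball around 1,
  which consists of invertible elements. Hence ideals given by algebraic conditions can be used
  directly.\<close>

lemma simple_cstar_ideal:
  fixes J :: "'a::cstar_algebra set"
  assumes simple: "simple_cstar (UNIV :: 'a set)"
    and add: "\<And>x y. x \<in> J \<Longrightarrow> y \<in> J \<Longrightarrow> x + y \<in> J"
    and left: "\<And>a x. x \<in> J \<Longrightarrow> a * x \<in> J" and right: "\<And>a x. x \<in> J \<Longrightarrow> x * a \<in> J"
    and x: "x \<in> J" "x \<noteq> 0"
  shows "1 \<in> J"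
proof -
  have cl_left: "a * y \<in> closure J" if y: "y \<in> closure J" for a y
  proof -
    obtain s where s: "\<And>n. s n \<in> J" "s \<longlonglongrightarrow> y" using y unfolding closure_sequential by blast
    then show ?thesis unfolding closure_sequential
      by (intro exI[of _ "\<lambda>n. a * s n"]) (auto intro!: left tendsto_intros)
  qed
  have cl_right: "y * a \<in> closure J" if y: "y \<in> closure J" for a y
  proof -
    obtain s where s: "\<And>n. s n \<in> J" "s \<longlonglongrightarrow> y" using y unfolding closure_sequential by blast
    then show ?thesis unfolding closure_sequential
      by (intro exI[of _ "\<lambda>n. s n * a"]) (auto intro!: right tendsto_intros)
  qed
  have cl_add: "y + z \<in> closure J" if "y \<in> closure J" "z \<in> closure J" for y z
  proof -
    obtain s t where s: "\<And>n. s n \<in> J" "s \<longlonglongrightarrow> y" "\<And>n. t n \<in> J" "t \<longlonglongrightarrow> z"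
      using \<open>y \<in> closure J\<close> \<open>z \<in> closure J\<close> unfolding closure_sequential by metis
    then show ?thesis unfolding closure_sequential
      by (intro exI[of _ "\<lambda>n. s n + t n"]) (auto intro!: add tendsto_intros)
  qed
  have "0 \<in> closure J" using left[OF x(1), of 0] closure_subset by auto
  \<comment> \<open>Closure under scalars comes from left multiplication by
    \<open>scaleC c 1\<close>.\<close>
  then have "closed_ideal UNIV (closure J)"
    unfolding closed_ideal_def
    using cl_add cl_left cl_right scaleC_conv_mult by (metis UNIV_I closed_closure subset_UNIV)
  moreover have "closure J \<noteq> {0}" using x closure_subset by blast
  ultimately have "closure J = UNIV" using simple unfolding simple_cstar_def by blast
  then have "1 \<in> closure J" by simp
  then obtain s where s: "\<And>n. s n \<in> J" "s \<longlonglongrightarrow> 1" unfolding closure_sequential by blast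
  then obtain n where n: "dist (s n) 1 < 1"
    unfolding lim_sequentially by (meson order_refl zero_less_one)
  \<comment> \<open>The Neumann series of u is a right inverse of \<open>s n\<close>.\<close>
  define u where "u = 1 - s n"
  have "norm u < 1" using n by (simp add: u_def dist_norm norm_minus_commute)
  then have su: "(\<lambda>n. u ^ n) sums suminf (\<lambda>n. u ^ n)"
    by (intro summable_sums complete_algebra_summable_geometric)
  have "(\<lambda>i. s n * u ^ i) sums (s n * suminf (\<lambda>n. u ^ n))"
    by (rule sums_mult[OF su])
  moreover have "(\<lambda>i. s n * u ^ i) = (\<lambda>i. u ^ i - u ^ Suc i)"
    by (auto simp: u_def algebra_simps)
  moreover have "(\<lambda>i. u ^ i - u ^ Suc i) sums (u ^ 0 - 0)"
  proof (rule telescope_sums')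
    show "(\<lambda>n. u ^ n) \<longlonglongrightarrow> 0" using su sums_summable summable_LIMSEQ_zero by blast
  qed
  ultimately have "s n * suminf (\<lambda>n. u ^ n) = 1" by (simp add: sums_unique2)
  with right[OF s(1)] show ?thesis by metis
qed

text \<open>For central self-adjoint w of norm 1 with 1 + w of norm 2, the multiples of 1 - w form
  an ideal. Were it nonzero, 1 - w would be invertible and the sums of the powers of w would stay
  bounded; the norm 2^m of (1 + w)^m makes them grow like m. So w = 1, and the general case follows
  by rescaling and by splitting into real and imaginary parts.\<close>

lemma simple_cstar_center:
  fixes z :: "'a::cstar_algebra"
  assumes simple: "simple_cstar (UNIV :: 'a set)" and z: "\<And>x. z * x = x * z"
  obtains c where "z = scaleC c 1"
proof -
  have unital: "w = 1" if c: "\<And>x. w * x = x * w" and sa: "star w = w" and n: "norm w = 1"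
    and att: "norm (1 + w) = 2" for w :: 'a
  proof (rule ccontr)
    assume "w \<noteq> 1"
    define J where "J = range (\<lambda>b. (1 - w) * b)"
    have "1 \<in> J"
    proof (rule simple_cstar_ideal[OF simple])
      show "1 - w \<in> J" unfolding J_def by (metis mult.right_neutral rangeI)
      show "1 - w \<noteq> 0" using \<open>w \<noteq> 1\<close> by simp
    next
      fix a x assume "x \<in> J"
      then obtain b where b: "x = (1 - w) * b" by (auto simp: J_def)
      have "a * x = (1 - w) * (a * b)" by (simp add: b algebra_simps c)
      then show "a * x \<in> J" by (simp add: J_def)
      show "x * a \<in> J" by (simp add: b J_def mult.assoc)
    next
      fix x y assume "x \<in> J" "y \<in> J"
      then show "x + y \<in> J" unfolding J_def by (auto simp: distrib_left[symmetric])
    qed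
    then obtain b where b: "(1 - w) * b = 1" by (metis J_def imageE)
    have bound: "real m + 1 \<le> 2 * norm b" if m: "m = 2 ^ k" for m k
    proof -
      have wj: "norm (w ^ j) \<le> 1" for j using norm_power_ineq[of w j] n by simp
      have "star (1 + w) = 1 + w" by (simp add: star_add sa)
      then have "2 ^ m = norm ((1 + w) ^ m)" using selfadjoint_norm_power2[of "1 + w" k] att m by simp
      \<comment> \<open>One copy of each power is split off. The remaining coefficients are
        nonnegative and add up to 2^m - (m + 1), so the split-off sum must have norm at least m +
        1.\<close>
      also have "(1 + w) ^ m = (\<Sum>j\<le>m. w ^ j) + (\<Sum>j\<le>m. real ((m choose j) - 1) *\<^sub>R w ^ j)"
        unfolding one_plus_power sum.distrib[symmetric]
      proof (rule sum.cong)
        fix j assume "j \<in> {..m}"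
        then have "1 \<le> m choose j" by (simp add: Suc_le_eq)
        then have "real (m choose j) = 1 + real ((m choose j) - 1)" by simp
        then have "real (m choose j) *\<^sub>R w ^ j = w ^ j + real ((m choose j) - 1) *\<^sub>R w ^ j"
          by (metis scaleR_add_left scaleR_one)
        then show "of_nat (m choose j) * w ^ j = w ^ j + real ((m choose j) - 1) *\<^sub>R w ^ j"
          by (simp add: scaleR_conv_of_real)
      qed simp
      also have "norm \<dots> \<le> norm (\<Sum>j\<le>m. w ^ j) + (\<Sum>j\<le>m. real ((m choose j) - 1))"
        by (intro order_trans[OF norm_triangle_ineq] add_left_mono sum_norm_le)
           (use wj in \<open>simp add: mult_left_le\<close>)
      also have "(\<Sum>j\<le>m. real ((m choose j) - 1)) = (\<Sum>j\<le>m. real (m choose j) - 1)"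
        by (rule sum.cong) (auto simp: of_nat_diff Suc_le_eq)
      also have "\<dots> = 2 ^ m - (real m + 1)"
        using choose_row_sum[of m] by (simp add: sum_subtractf flip: of_nat_sum)
      finally have "real m + 1 \<le> norm (\<Sum>j\<le>m. w ^ j)" by simp
      also have "(\<Sum>j\<le>m. w ^ j) = (\<Sum>j\<le>m. w ^ j) * ((1 - w) * b)" by (simp add: b)
      also have "\<dots> = (1 - w ^ Suc m) * b"
      proof -
        have "(\<Sum>j\<le>m. w ^ j) * (1 - w) = (\<Sum>j\<le>m. w ^ j - w ^ Suc j)"
          unfolding sum_distrib_right by (simp add: right_diff_distrib power_commutes)
        also have "\<dots> = 1 - w ^ Suc m" by (subst sum_telescope) simp
        finally show ?thesis by (simp add: mult.assoc[symmetric])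
      qed
      also have "norm \<dots> \<le> (1 + 1) * norm b"
        using wj[of "Suc m"] norm_triangle_ineq4[of 1 "w ^ Suc m"]
        by (intro order_trans[OF norm_mult_ineq] mult_right_mono) auto
      finally show ?thesis by simp
    qed
    obtain k where "2 * norm b < 2 ^ k" using real_arch_pow[of 2] by auto
    with bound[of "2 ^ k" k] show False by simp
  qed
  have sa: "\<exists>r. w = scaleC r 1" if c: "\<And>x. w * x = x * w" and sa: "star w = w" for w :: 'a
  proof (cases "w = 0")
    case True
    then show ?thesis using scaleC_of_real[of 0 "1::'a"] by (intro exI[of _ 0]) simp
  next
    case False
    define v where "v = (1 / norm w) *\<^sub>R w"
    have v: "v * x = x * v" "star v = v" "norm v = 1" for x
      using False by (simp_all add: v_def c sa star_scaleR)
    have "v = 1 \<or> - v = 1"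
      using selfadjoint_norm_attained[OF v(2,3)] unital[OF v] unital[of "- v"] v
      by (auto simp: star_minus)
    then have "v = 1 \<or> v = - 1" by (metis add.inverse_inverse)
    moreover have "w = norm w *\<^sub>R v" using False by (simp add: v_def)
    ultimately have "w = norm w *\<^sub>R 1 \<or> w = (- norm w) *\<^sub>R 1" by (metis scaleR_minus_left scaleR_minus_right)
    then show ?thesis by (metis scaleC_of_real)
  qed
  have zs: "star z * x = x * star z" for x
    by (metis star_mult star_star z)
  obtain r where r: "z + star z = scaleC r 1"
    using sa[of "z + star z"] z zs by (auto simp: distrib_left distrib_right star_add star_star add.commute)
  \<comment> \<open>The imaginary part, up to a real factor; together with z + z* it determines
    z.\<close>
  have "star (scaleC \<i> (z - star z)) = scaleC \<i> (z - star z)"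
  proof -
    have "- star z + z = z - star z" by simp
    moreover have "scaleC (- \<i>) (star z - z) = scaleC \<i> (z - star z)"
      using scaleC_scaleC[of \<i> "- 1" "star z - z"] scaleC_of_real[of "- 1" "star z - z"] by simp
    ultimately show ?thesis by (simp add: star_scaleC star_diff star_star)
  qed
  then obtain s where s: "scaleC \<i> (z - star z) = scaleC s 1"
    using sa[of "scaleC \<i> (z - star z)"] z zs
    by (auto simp: left_diff_distrib right_diff_distrib mult_scaleC_left mult_scaleC_right)
  have "z - star z = scaleC (- \<i>) (scaleC \<i> (z - star z))" by (simp add: scaleC_scaleC)
  then have d: "z - star z = scaleC (- \<i> * s) 1" by (simp add: s scaleC_scaleC)
  have "z + z = scaleC (r + (- \<i> * s)) 1"
    unfolding scaleC_add_left r[symmetric] d[symmetric] by simp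
  then have "scaleC (1 / 2) (z + z) = scaleC ((r - \<i> * s) / 2) 1" by (simp add: scaleC_scaleC)
  moreover have "scaleC (1 / 2) (z + z) = z"
    using scaleC_of_real[of "1 / 2" "z + z"] by simp
  ultimately have "z = scaleC ((r - \<i> * s) / 2) 1" by simp
  then show thesis by (rule that)
qed


section \<open>Outerness from the Rohlin property\<close>

lemma tendsto_zero_mult_Bseq:
  fixes x y :: "nat \<Rightarrow> 'a::real_normed_algebra"
  assumes "x \<longlonglongrightarrow> 0" and "Bseq y"
  shows "(\<lambda>n. x n * y n) \<longlonglongrightarrow> 0" and "(\<lambda>n. y n * x n) \<longlonglongrightarrow> 0"
  using bounded_bilinear.Zfun_prod_Bfun[OF bounded_bilinear_mult, of x sequentially y]
    bounded_bilinear.Bfun_prod_Zfun[OF bounded_bilinear_mult, of y sequentially x] assms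
  by (auto simp: tendsto_Zfun_iff)

lemma Bseq_mult_algebra:
  fixes x y :: "nat \<Rightarrow> 'a::real_normed_algebra"
  assumes "Bseq x" and "Bseq y"
  shows "Bseq (\<lambda>n. x n * y n)"
proof -
  obtain K L where K: "\<And>n. norm (x n) \<le> K" and L: "\<And>n. norm (y n) \<le> L"
    using assms by (meson BseqE)
  have "norm (x n * y n) \<le> K * L" for n
    using norm_mult_ineq[of "x n" "y n"] mult_mono[OF K L, of n n] norm_ge_zero[of "x n"] K[of n]
    by (smt (verit) norm_ge_zero)
  then show ?thesis by (rule BseqI')
qed

lemma Bseq_plus:
  fixes x y :: "nat \<Rightarrow> 'a::real_normed_vector"
  assumes "Bseq x" and "Bseq y"
  shows "Bseq (\<lambda>n. x n + y n)"
proof -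
  obtain K L where K: "\<And>n. norm (x n) \<le> K" and L: "\<And>n. norm (y n) \<le> L"
    using assms by (meson BseqE)
  have "norm (x n + y n) \<le> K + L" for n
    using norm_triangle_ineq[of "x n" "y n"] K[of n] L[of n] by linarith
  then show ?thesis by (rule BseqI')
qed

lemma ring_ell_infinity: "ring (ell_infinity (UNIV :: 'a::cstar_algebra set))"
proof (rule ringI)
  show "abelian_group (ell_infinity (UNIV :: 'a set))"
  proof (rule abelian_groupI)
    fix x assume "x \<in> carrier (ell_infinity (UNIV :: 'a set))"
    then show "\<exists>y\<in>carrier (ell_infinity UNIV). y \<oplus>\<^bsub>ell_infinity UNIV\<^esub> x = \<zero>\<^bsub>ell_infinity UNIV\<^esub>"
      by (intro bexI[of _ "\<lambda>n. - x n"]) (auto simp: ell_infinity_def Bseq_minus_iff)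
  qed (auto simp: ell_infinity_def add_ac intro: Bseq_plus)
  show "monoid (ell_infinity (UNIV :: 'a set))"
    by (rule monoidI) (auto simp: ell_infinity_def mult.assoc intro: Bseq_mult_algebra)
qed (auto simp: ell_infinity_def algebra_simps)

lemma a_inv_ell_infinity:
  assumes "x \<in> carrier (ell_infinity (UNIV :: 'a::cstar_algebra set))"
  shows "\<ominus>\<^bsub>ell_infinity UNIV\<^esub> x = (\<lambda>n. - x n)"
proof -
  interpret ring "ell_infinity (UNIV :: 'a set)" by (rule ring_ell_infinity)
  show ?thesis
    using assms by (intro minus_equality) (auto simp: ell_infinity_def Bseq_minus_iff)
qed

lemma ideal_null_seqs: "ideal (null_seqs UNIV) (ell_infinity (UNIV :: 'a::cstar_algebra set))"
proof -
  interpret ring "ell_infinity (UNIV :: 'a set)" by (rule ring_ell_infinity)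
  show ?thesis
  proof (rule idealI)
    show "subgroup (null_seqs UNIV) (add_monoid (ell_infinity (UNIV :: 'a set)))"
    proof (rule subgroup.intro)
      fix x assume x: "x \<in> null_seqs (UNIV :: 'a set)"
      then have "inv\<^bsub>add_monoid (ell_infinity UNIV)\<^esub> x = (\<lambda>n. - x n)"
        using a_inv_ell_infinity[of x] by (simp add: a_inv_def null_seqs_def)
      then show "inv\<^bsub>add_monoid (ell_infinity UNIV)\<^esub> x \<in> null_seqs UNIV"
        using x tendsto_minus[of x 0] by (simp add: null_seqs_def ell_infinity_def Bseq_minus_iff)
    qed (auto simp: null_seqs_def ell_infinity_def intro: Bseq_plus tendsto_add_zero)
  qed (auto simp: null_seqs_def ell_infinity_def
      intro: Bseq_mult_algebra tendsto_zero_mult_Bseq ring_ell_infinity[unfolded ell_infinity_def, simplified])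
qed

lemma carrier_seq_algebra:
  "carrier (seq_algebra A) = {null_seqs A +>\<^bsub>ell_infinity A\<^esub> z | z. z \<in> carrier (ell_infinity A)}"
  by (auto simp: seq_algebra_def FactRing_def A_RCOSETS_def')

lemma coset_representative:
  assumes "X \<in> carrier (seq_algebra (UNIV :: 'a::cstar_algebra set))"
  obtains x where "x \<in> X"
proof -
  interpret ideal "null_seqs UNIV" "ell_infinity (UNIV :: 'a set)" by (rule ideal_null_seqs)
  obtain z where "z \<in> carrier (ell_infinity UNIV)" "X = null_seqs UNIV +>\<^bsub>ell_infinity UNIV\<^esub> z"
    using assms by (auto simp: carrier_seq_algebra)
  then show thesis using that a_rcos_self by blast
qed

lemma coset_members:
  assumes X: "X \<in> carrier (seq_algebra (UNIV :: 'a::cstar_algebra set))" and "x \<in> X"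
  shows "Bseq x" and "y \<in> X \<Longrightarrow> (\<lambda>n. x n - y n) \<longlonglongrightarrow> 0"
proof -
  obtain z where z: "z \<in> carrier (ell_infinity (UNIV :: 'a set))"
    and X: "X = null_seqs UNIV +>\<^bsub>ell_infinity UNIV\<^esub> z"
    using X by (auto simp: carrier_seq_algebra)
  have mem: "\<exists>m. m \<longlonglongrightarrow> 0 \<and> Bseq m \<and> y = (\<lambda>n. m n + z n)" if "y \<in> X" for y
    using that by (auto simp: X a_r_coset_def r_coset_def null_seqs_def ell_infinity_def)
  then obtain m where m: "m \<longlonglongrightarrow> 0" "Bseq m" "x = (\<lambda>n. m n + z n)" using \<open>x \<in> X\<close> by blast
  then show "Bseq x" using z by (auto simp: ell_infinity_def intro: Bseq_plus)
  show "(\<lambda>n. x n - y n) \<longlonglongrightarrow> 0" if y: "y \<in> X"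
  proof -
    obtain k where k: "k \<longlonglongrightarrow> 0" "y = (\<lambda>n. k n + z n)" using mem[OF y] by blast
    show ?thesis using tendsto_diff[OF m(1) k(1)] by (simp add: m(3) k(2))
  qed
qed

text \<open>Membership is enough here: by \<open>coset_members\<close> two members of a coset differ
  by a null sequence, so an equation in the quotient becomes a limit relation between
  representatives.\<close>

lemma mult_mem_coset_mult:
  assumes "x \<in> X" and "y \<in> Y"
  shows "(\<lambda>n. x n * y n) \<in> X \<otimes>\<^bsub>seq_algebra (UNIV :: 'a::cstar_algebra set)\<^esub> Y"
proof -
  have "(\<lambda>n. 0) \<in> null_seqs (UNIV :: 'a set)" by (auto simp: null_seqs_def ell_infinity_def)
  then have "(\<lambda>n. x n * y n) \<in> null_seqs UNIV +>\<^bsub>ell_infinity UNIV\<^esub> (\<lambda>n. x n * y n)"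
    by (force simp: a_r_coset_def r_coset_def ell_infinity_def)
  then have "(\<lambda>n. x n * y n) \<in> null_seqs UNIV +>\<^bsub>ell_infinity UNIV\<^esub> (x \<otimes>\<^bsub>ell_infinity UNIV\<^esub> y)"
    by (simp add: ell_infinity_def)
  with assms show ?thesis by (auto simp: seq_algebra_def FactRing_def rcoset_mult_def)
qed

lemma add_mem_coset_add:
  assumes "x \<in> X" and "y \<in> Y"
  shows "(\<lambda>n. x n + y n) \<in> X \<oplus>\<^bsub>seq_algebra (UNIV :: 'a::cstar_algebra set)\<^esub> Y"
proof -
  have "x \<oplus>\<^bsub>ell_infinity UNIV\<^esub> y \<in> X <+>\<^bsub>ell_infinity UNIV\<^esub> Y"
    using assms unfolding set_add_def set_mult_def by auto
  then show ?thesis by (simp add: seq_algebra_def FactRing_def ell_infinity_def)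
qed

lemma const_mem_const_class: "(\<lambda>n. a) \<in> const_class (UNIV :: 'a::cstar_algebra set) a"
proof -
  interpret ideal "null_seqs UNIV" "ell_infinity (UNIV :: 'a set)" by (rule ideal_null_seqs)
  show ?thesis unfolding const_class_def
    by (rule a_rcos_self) (auto simp: ell_infinity_def)
qed

lemma const_class_closed: "const_class UNIV a \<in> carrier (seq_algebra (UNIV :: 'a::cstar_algebra set))"
  by (auto simp: carrier_seq_algebra const_class_def)
     (rule exI[of _ "\<lambda>n. a"], auto simp: ell_infinity_def)

lemma sum_mem_coset_finsum:
  assumes "finite B" and X: "\<And>g. g \<in> B \<Longrightarrow> X g \<in> carrier (seq_algebra (UNIV :: 'a::cstar_algebra set))"
    and x: "\<And>g. g \<in> B \<Longrightarrow> x g \<in> X g"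
  shows "(\<lambda>n. \<Sum>g\<in>B. x g n) \<in> (\<Oplus>\<^bsub>seq_algebra UNIV\<^esub>g\<in>B. X g)"
proof -
  interpret ideal "null_seqs UNIV" "ell_infinity (UNIV :: 'a set)" by (rule ideal_null_seqs)
  interpret Q: ring "seq_algebra (UNIV :: 'a set)"
    unfolding seq_algebra_def by (rule quotient_is_ring)
  show ?thesis using assms
  proof (induction B rule: finite_induct)
    case empty
    have "(\<lambda>n. 0) \<in> \<zero>\<^bsub>seq_algebra (UNIV :: 'a set)\<^esub>"
      by (auto simp: seq_algebra_def FactRing_def null_seqs_def ell_infinity_def)
    then show ?case by (simp add: Q.finsum_empty)
  next
    case (insert g B)
    then have "(\<Oplus>\<^bsub>seq_algebra UNIV\<^esub>h\<in>insert g B. X h)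
        = X g \<oplus>\<^bsub>seq_algebra UNIV\<^esub> (\<Oplus>\<^bsub>seq_algebra UNIV\<^esub>h\<in>B. X h)"
      by (intro Q.finsum_insert) auto
    then show ?case
      using add_mem_coset_add[of "x g" "X g" "\<lambda>n. \<Sum>g\<in>B. x g n"] insert by simp
  qed
qed

text \<open>Arbitrary representatives of the Rohlin projections; every relation is used only
  asymptotically, so none has to be lifted to an exact one.\<close>

lemma rohlin_sequences:
  fixes \<alpha> :: "'g \<Rightarrow> 'a::cstar_algebra \<Rightarrow> 'a"
  assumes "group G" and fin: "finite (carrier G)" and "rohlin_property UNIV G \<alpha>"
  obtains E :: "'g \<Rightarrow> nat \<Rightarrow> 'a" where
    "\<And>g. g \<in> carrier G \<Longrightarrow> Bseq (E g)"
    "\<And>g. g \<in> carrier G \<Longrightarrow> (\<lambda>n. E g n * E g n - E g n) \<longlonglongrightarrow> 0"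
    "\<And>g. g \<in> carrier G \<Longrightarrow> (\<lambda>n. star (E g n) - E g n) \<longlonglongrightarrow> 0"
    "\<And>g a. g \<in> carrier G \<Longrightarrow> (\<lambda>n. E g n * a - a * E g n) \<longlonglongrightarrow> 0"
    "(\<lambda>n. \<Sum>g\<in>carrier G. E g n) \<longlonglongrightarrow> 1"
    "\<And>g h. g \<in> carrier G \<Longrightarrow> h \<in> carrier G \<Longrightarrow> (\<lambda>n. \<alpha> g (E h n) - E (g \<otimes>\<^bsub>G\<^esub> h) n) \<longlonglongrightarrow> 0"
proof -
  let ?Q = "seq_algebra (UNIV :: 'a set)"
  interpret ideal "null_seqs UNIV" "ell_infinity (UNIV :: 'a set)" by (rule ideal_null_seqs)
  interpret Q: ring ?Q unfolding seq_algebra_def by (rule quotient_is_ring)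
  obtain e where e: "\<And>g. g \<in> carrier G \<Longrightarrow> e g \<in> central_seqs UNIV"
      "\<And>g. g \<in> carrier G \<Longrightarrow> e g \<otimes>\<^bsub>?Q\<^esub> e g = e g"
      "\<And>g. g \<in> carrier G \<Longrightarrow> termwise star (e g) = e g"
      "(\<Oplus>\<^bsub>?Q\<^esub>g\<in>carrier G. e g) = \<one>\<^bsub>?Q\<^esub>"
      "\<And>g h. g \<in> carrier G \<Longrightarrow> h \<in> carrier G \<Longrightarrow> termwise (\<alpha> g) (e h) = e (g \<otimes>\<^bsub>G\<^esub> h)"
    using assms(3) unfolding rohlin_property_def by blast
  have car: "e g \<in> carrier ?Q" if "g \<in> carrier G" for g
    using e(1)[OF that] by (simp add: central_seqs_def)
  have "\<forall>g. \<exists>x. g \<in> carrier G \<longrightarrow> x \<in> e g" using coset_representative car by metis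
  then obtain E where E: "\<And>g. g \<in> carrier G \<Longrightarrow> E g \<in> e g" by metis
  show thesis
  proof (rule that[of E])
    fix g assume g: "g \<in> carrier G"
    show "Bseq (E g)" using coset_members(1) car g E by blast
    have "(\<lambda>n. E g n * E g n) \<in> e g" using mult_mem_coset_mult[OF E E, OF g g] e(2)[OF g] by simp
    then show "(\<lambda>n. E g n * E g n - E g n) \<longlonglongrightarrow> 0"
      using coset_members(2)[OF car[OF g] _ E[OF g]] by blast
    have "(\<lambda>n. star (E g n)) \<in> e g" using e(3)[OF g] E[OF g] unfolding termwise_def by blast
    then show "(\<lambda>n. star (E g n) - E g n) \<longlonglongrightarrow> 0"
      using coset_members(2)[OF car[OF g] _ E[OF g]] by blast
    fix a
    have "(\<lambda>n. E g n * a) \<in> e g \<otimes>\<^bsub>?Q\<^esub> const_class UNIV a"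
      "(\<lambda>n. a * E g n) \<in> const_class UNIV a \<otimes>\<^bsub>?Q\<^esub> e g"
      using mult_mem_coset_mult[OF E const_mem_const_class] mult_mem_coset_mult[OF const_mem_const_class E] g
      by blast+
    moreover have "e g \<otimes>\<^bsub>?Q\<^esub> const_class UNIV a = const_class UNIV a \<otimes>\<^bsub>?Q\<^esub> e g"
      using e(1)[OF g] by (simp add: central_seqs_def)
    moreover have "e g \<otimes>\<^bsub>?Q\<^esub> const_class UNIV a \<in> carrier ?Q"
      using car[OF g] const_class_closed by blast
    ultimately show "(\<lambda>n. E g n * a - a * E g n) \<longlonglongrightarrow> 0"
      using coset_members(2) by metis
  next
    have "(\<lambda>n. \<Sum>g\<in>carrier G. E g n) \<in> \<one>\<^bsub>?Q\<^esub>"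
      using sum_mem_coset_finsum[OF fin, of e E] car E e(4) by simp
    moreover have "(\<lambda>n. 1) \<in> \<one>\<^bsub>?Q\<^esub>"
      using const_mem_const_class[of 1]
      by (simp add: seq_algebra_def FactRing_def const_class_def ell_infinity_def)
    ultimately have "(\<lambda>n. (\<Sum>g\<in>carrier G. E g n) - 1) \<longlonglongrightarrow> 0"
      using coset_members(2)[OF Q.one_closed] by blast
    then show "(\<lambda>n. \<Sum>g\<in>carrier G. E g n) \<longlonglongrightarrow> 1" by (simp add: LIM_zero_iff)
  next
    fix g h assume g: "g \<in> carrier G" and h: "h \<in> carrier G"
    have gh: "g \<otimes>\<^bsub>G\<^esub> h \<in> carrier G"
      using assms(1) g h by (simp add: group.is_monoid monoid.m_closed)
    have "(\<lambda>n. \<alpha> g (E h n)) \<in> e (g \<otimes>\<^bsub>G\<^esub> h)"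
      using e(5)[OF g h] E[OF h] unfolding termwise_def by blast
    then show "(\<lambda>n. \<alpha> g (E h n) - E (g \<otimes>\<^bsub>G\<^esub> h) n) \<longlonglongrightarrow> 0"
      using coset_members(2)[OF car[OF gh] _ E[OF gh]] by blast
  qed
qed


section \<open>Intertwiners against Rohlin projections\<close>

lemma cstar_action_simps:
  assumes "cstar_action UNIV G \<alpha>" and "g \<in> carrier G"
  shows "\<alpha> g (x + y) = \<alpha> g x + \<alpha> g y" "\<alpha> g (x * y) = \<alpha> g x * \<alpha> g y"
    "\<alpha> g (scaleC c x) = scaleC c (\<alpha> g x)" "\<alpha> g (star x) = star (\<alpha> g x)" "bij (\<alpha> g)"
    "h \<in> carrier G \<Longrightarrow> \<alpha> (g \<otimes>\<^bsub>G\<^esub> h) x = \<alpha> g (\<alpha> h x)" "\<alpha> \<one>\<^bsub>G\<^esub> x = x"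
  using assms unfolding cstar_action_def star_automorphism_def by auto

text \<open>A nonzero \<open>c\<close> with \<open>c x = \<alpha>\<^sub>g(x) c\<close> generates the ideal \<open>Q c = c Q\<close>, so it is invertible and
  \<open>\<alpha>\<^sub>g\<close> is inner. Then the Rohlin projections satisfy \<open>e\<^sub>h = e\<^bsub>gh\<^esub>\<close>, and comparing the norms of both
  sides of \<open>\<Sum>\<^sub>k (1 - 2 e\<^sub>k) = |G| - 4 + 4 e\<^sub>h\<close>, the sum over \<open>k \<noteq> h, gh\<close>, forces \<open>e\<^sub>h = 0\<close>.\<close>

lemma rohlin_outer:
  fixes \<alpha> :: "'g \<Rightarrow> 'a::cstar_algebra \<Rightarrow> 'a"
  assumes simple: "simple_cstar (UNIV :: 'a set)" and grp: "group G" and fin: "finite (carrier G)"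
    and act: "cstar_action UNIV G \<alpha>" and roh: "rohlin_property UNIV G \<alpha>"
    and g: "g \<in> carrier G" "g \<noteq> \<one>\<^bsub>G\<^esub>" and c: "\<And>x. c * x = \<alpha> g x * c"
  shows "c = 0"
proof (rule ccontr)
  assume c0: "c \<noteq> 0"
  interpret group G by (rule grp)
  define J where "J = range (\<lambda>b. c * b)"
  \<comment> \<open>Left factors move across c, so the right ideal c Q is two-sided.\<close>
  have lc: "a * c = c * inv_into UNIV (\<alpha> g) a" for a
    using c[of "inv_into UNIV (\<alpha> g) a"] cstar_action_simps(5)[OF act g(1)]
    by (simp add: bij_is_surj surj_f_inv_f)
  have "1 \<in> J"
  proof (rule simple_cstar_ideal[OF simple])
    show "c \<in> J" using rangeI[of "\<lambda>b. c * b" 1] by (simp add: J_def)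
    show "c \<noteq> 0" by (rule c0)
  next
    fix a x assume "x \<in> J"
    then obtain b where b: "x = c * b" by (auto simp: J_def)
    have "a * x = c * (inv_into UNIV (\<alpha> g) a * b)" by (simp add: b lc mult.assoc[symmetric])
    then show "a * x \<in> J" by (simp add: J_def)
    show "x * a \<in> J" by (simp add: b J_def mult.assoc)
  next
    fix x y assume "x \<in> J" "y \<in> J"
    then show "x + y \<in> J" unfolding J_def by (auto simp: distrib_left[symmetric])
  qed
  then obtain b where "1 = c * b" unfolding J_def by blast
  then have b: "c * b = 1" by simp
  obtain E where E: "\<And>g. g \<in> carrier G \<Longrightarrow> Bseq (E g)"
    "\<And>g. g \<in> carrier G \<Longrightarrow> (\<lambda>n. E g n * E g n - E g n) \<longlonglongrightarrow> 0"
    "\<And>g. g \<in> carrier G \<Longrightarrow> (\<lambda>n. star (E g n) - E g n) \<longlonglongrightarrow> 0"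
    "\<And>g a. g \<in> carrier G \<Longrightarrow> (\<lambda>n. E g n * a - a * E g n) \<longlonglongrightarrow> 0"
    "(\<lambda>n. \<Sum>g\<in>carrier G. E g n) \<longlonglongrightarrow> 1"
    "\<And>g h. g \<in> carrier G \<Longrightarrow> h \<in> carrier G \<Longrightarrow> (\<lambda>n. \<alpha> g (E h n) - E (g \<otimes>\<^bsub>G\<^esub> h) n) \<longlonglongrightarrow> 0"
    by (rule rohlin_sequences[OF grp fin roh]) (rule that)
  have "E h \<longlonglongrightarrow> 0" if h: "h \<in> carrier G" for h
  proof -
    define p where "p = E h"
    define p' where "p' = E (g \<otimes>\<^bsub>G\<^esub> h)"
    define K where "K = carrier G - {h, g \<otimes>\<^bsub>G\<^esub> h}"
    have gh: "g \<otimes>\<^bsub>G\<^esub> h \<in> carrier G" "g \<otimes>\<^bsub>G\<^esub> h \<noteq> h" using g h by simp_all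
    have cardK: "card (carrier G) = card K + 2"
      using card_Diff_subset[of "{h, g \<otimes>\<^bsub>G\<^esub> h}" "carrier G"] card_mono[of "carrier G" "{h, g \<otimes>\<^bsub>G\<^esub> h}"] gh h fin
      by (simp add: K_def)
    \<comment> \<open>Centrality gives p c ~ c p = \<alpha>_g(p) c, and equivariance gives
      \<alpha>_g(p) c ~ p' c; the right inverse b then cancels c.\<close>
    have "(\<lambda>n. ((p n * c - c * p n) + (\<alpha> g (p n) - p' n) * c) * b) \<longlonglongrightarrow> (0 + 0 * c) * b"
      unfolding p_def p'_def by (intro tendsto_intros E h g)
    moreover have "((p n * c - c * p n) + (\<alpha> g (p n) - p' n) * c) * b = p n - p' n" for n
    proof -
      have "(p n * c - c * p n) + (\<alpha> g (p n) - p' n) * c = (p n - p' n) * c"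
        by (simp add: c[of "p n"] algebra_simps)
      then show ?thesis by (simp add: mult.assoc b)
    qed
    ultimately have pp': "(\<lambda>n. p n - p' n) \<longlonglongrightarrow> 0" by simp
    \<comment> \<open>Asymptotically 1 - 2e is a self-adjoint unitary.\<close>
    have normal: "(\<lambda>n. norm (1 - 2 *\<^sub>R E k n)) \<longlonglongrightarrow> 1" if k: "k \<in> carrier G" for k
    proof -
      have "(\<lambda>n. (star (E k n) - E k n) * E k n) \<longlonglongrightarrow> 0"
        using tendsto_zero_mult_Bseq(1)[OF E(3) E(1), OF k k] .
      then have "(\<lambda>n. 1 - 2 *\<^sub>R (star (E k n) - E k n) + 4 *\<^sub>R ((star (E k n) - E k n) * E k n)
          + 4 *\<^sub>R (E k n * E k n - E k n)) \<longlonglongrightarrow> 1 - 2 *\<^sub>R 0 + 4 *\<^sub>R 0 + 4 *\<^sub>R 0"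
        by (intro tendsto_intros E k)
      moreover have "1 - 2 *\<^sub>R (star e - e) + 4 *\<^sub>R ((star e - e) * e) + 4 *\<^sub>R (e * e - e)
          = star (1 - 2 *\<^sub>R e) * (1 - 2 *\<^sub>R e)" for e :: 'a
      proof -
        have "4 *\<^sub>R e = 2 *\<^sub>R e + 2 *\<^sub>R e" by (simp flip: scaleR_add_left)
        then show ?thesis by (simp add: star_diff star_scaleR algebra_simps)
      qed
      ultimately have "(\<lambda>n. star (1 - 2 *\<^sub>R E k n) * (1 - 2 *\<^sub>R E k n)) \<longlonglongrightarrow> 1" by simp
      then have "(\<lambda>n. (norm (1 - 2 *\<^sub>R E k n))\<^sup>2) \<longlonglongrightarrow> norm (1::'a)"
        unfolding cstar_identity[symmetric] by (rule tendsto_norm)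
      then have "(\<lambda>n. sqrt ((norm (1 - 2 *\<^sub>R E k n))\<^sup>2)) \<longlonglongrightarrow> sqrt 1"
        by (intro tendsto_intros) simp
      then show ?thesis by simp
    qed
    define D where "D n = (\<Sum>k\<in>K. 1 - 2 *\<^sub>R E k n)" for n
    define S where "S n = (\<Sum>k\<in>carrier G. E k n)" for n
    have D: "D n = of_nat (card K) - 2 *\<^sub>R (S n - p n - p' n)" for n
    proof -
      have "S n = p n + (p' n + (\<Sum>k\<in>K. E k n))"
        unfolding S_def K_def p_def p'_def using fin h gh
        by (subst sum.remove[of _ h], simp_all, subst sum.remove[of _ "g \<otimes>\<^bsub>G\<^esub> h"])
           (simp_all add: Diff_insert2[symmetric])
      then show ?thesis by (simp add: D_def sum_subtractf scaleR_sum_right[symmetric])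
    qed
    \<comment> \<open>From S ~ 1, p' ~ p and p p ~ p one gets D p ~ (|K| + 2) p.\<close>
    have "(\<lambda>n. (- (2 *\<^sub>R (S n - 1)) - 2 *\<^sub>R (p n - p' n)) * p n + 4 *\<^sub>R (p n * p n - p n)) \<longlonglongrightarrow> 0 + 4 *\<^sub>R 0"
    proof (intro tendsto_add tendsto_scaleR tendsto_const tendsto_zero_mult_Bseq)
      show "(\<lambda>n. - (2 *\<^sub>R (S n - 1)) - 2 *\<^sub>R (p n - p' n)) \<longlonglongrightarrow> 0"
        using tendsto_diff[OF tendsto_minus[OF tendsto_scaleR[OF tendsto_const[of 2] LIM_zero[OF E(5)]]]
            tendsto_scaleR[OF tendsto_const[of 2] pp']] by (simp add: S_def)
    qed (use E h in \<open>auto simp: p_def\<close>)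
    moreover have "(- (2 *\<^sub>R (S n - 1)) - 2 *\<^sub>R (p n - p' n)) * p n + 4 *\<^sub>R (p n * p n - p n)
        = D n * p n - (real (card K) + 2) *\<^sub>R p n" for n
    proof -
      have "of_nat (card K) * p n = real (card K) *\<^sub>R p n" by (simp add: scaleR_conv_of_real)
      moreover have "4 *\<^sub>R p n = 2 *\<^sub>R p n + 2 *\<^sub>R p n" "4 *\<^sub>R (p n * p n) = 2 *\<^sub>R (p n * p n) + 2 *\<^sub>R (p n * p n)"
        by (simp_all flip: scaleR_add_left)
      ultimately show ?thesis by (simp add: D algebra_simps)
    qed
    ultimately have lim: "(\<lambda>n. D n * p n - (real (card K) + 2) *\<^sub>R p n) \<longlonglongrightarrow> 0" by simp
    have "(\<lambda>n. (\<Sum>k\<in>K. norm (1 - 2 *\<^sub>R E k n)) - real (card K)) \<longlonglongrightarrow> 0"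
    proof -
      have "(\<lambda>n. \<Sum>k\<in>K. norm (1 - 2 *\<^sub>R E k n)) \<longlonglongrightarrow> (\<Sum>k\<in>K. 1)"
        by (intro tendsto_sum normal) (simp add: K_def)
      then show ?thesis using LIM_zero by fastforce
    qed
    moreover have "Bseq (\<lambda>n. norm (p n))" using E(1)[OF h] by (simp add: p_def Bseq_def)
    ultimately have "(\<lambda>n. ((\<Sum>k\<in>K. norm (1 - 2 *\<^sub>R E k n)) - real (card K)) * norm (p n)) \<longlonglongrightarrow> 0"
      by (rule tendsto_zero_mult_Bseq)
    from tendsto_add[OF this tendsto_norm_zero[OF lim]]
    have small: "(\<lambda>n. ((\<Sum>k\<in>K. norm (1 - 2 *\<^sub>R E k n)) - real (card K)) * norm (p n)
        + norm (D n * p n - (real (card K) + 2) *\<^sub>R p n)) \<longlonglongrightarrow> 0" by simp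
    \<comment> \<open>The norm of D is at most a sum of norms tending to |K|, whereas D multiplies p
      by nearly |K| + 2; the gap of 2 forces p to vanish.\<close>
    have "2 * norm (p n) \<le> ((\<Sum>k\<in>K. norm (1 - 2 *\<^sub>R E k n)) - real (card K)) * norm (p n)
        + norm (D n * p n - (real (card K) + 2) *\<^sub>R p n)" for n
    proof -
      have "(real (card K) + 2) * norm (p n) = norm ((real (card K) + 2) *\<^sub>R p n)" by simp
      also have "\<dots> \<le> norm (D n * p n) + norm (D n * p n - (real (card K) + 2) *\<^sub>R p n)"
        using norm_triangle_ineq4[of "D n * p n" "D n * p n - (real (card K) + 2) *\<^sub>R p n"] by simp
      also have "norm (D n * p n) \<le> (\<Sum>k\<in>K. norm (1 - 2 *\<^sub>R E k n)) * norm (p n)"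
        unfolding D_def by (intro order_trans[OF norm_mult_ineq] mult_right_mono norm_sum) simp
      finally show ?thesis by (simp add: algebra_simps)
    qed
    then have "(\<lambda>n. 2 * norm (p n)) \<longlonglongrightarrow> 0"
      by (intro tendsto_sandwich[OF _ _ tendsto_const small]) auto
    then have "(\<lambda>n. norm (p n)) \<longlonglongrightarrow> 0" using tendsto_mult_left_iff[of 2 "\<lambda>n. norm (p n)" 0] by simp
    then show ?thesis unfolding p_def by (rule tendsto_norm_zero_cancel)
  qed
  then have "(\<lambda>n. \<Sum>g\<in>carrier G. E g n) \<longlonglongrightarrow> (\<Sum>g\<in>carrier G. 0)"
    by (intro tendsto_sum)
  then have "(\<lambda>n. \<Sum>g\<in>carrier G. E g n) \<longlonglongrightarrow> 0" by simp
  from LIMSEQ_unique[OF E(5) this] show False by simp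
qed


section \<open>Galois coordinates\<close>

text \<open>Outerness is assumed in its intertwiner form: no nonzero element carries the identity to
  \<alpha>_g. This is the form in which every later argument meets it.\<close>

locale outer_action = group G for G :: "('g, 'm) monoid_scheme" (structure) +
  fixes \<alpha> :: "'g \<Rightarrow> 'q::cstar_algebra \<Rightarrow> 'q"
  assumes fin: "finite (carrier G)"
    and act: "cstar_action UNIV G \<alpha>"
    and simple: "simple_cstar (UNIV :: 'q set)"
    and outer: "\<lbrakk>g \<in> carrier G; g \<noteq> \<one>; \<And>x. c * x = \<alpha> g x * c\<rbrakk> \<Longrightarrow> c = 0"
begin

abbreviation "Fix S \<equiv> fixed_points (UNIV :: 'q set) S \<alpha>"

abbreviation tr :: "'g set \<Rightarrow> 'q \<Rightarrow> 'q" where "tr S q \<equiv> (\<Sum>g\<in>S. \<alpha> g q)"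

lemmas act_add = cstar_action_simps(1)[OF act]
  and act_mult = cstar_action_simps(2)[OF act]
  and act_scaleC = cstar_action_simps(3)[OF act]
  and act_bij = cstar_action_simps(5)[OF act]
  and act_comp = cstar_action_simps(6)[OF act, symmetric]

lemma act_unit [simp]: "\<alpha> \<one> x = x"
  using cstar_action_simps(7)[OF act one_closed] .

lemma act_zero [simp]: "g \<in> carrier G \<Longrightarrow> \<alpha> g 0 = 0"
  using act_add[of g 0 0] by simp

lemma act_one [simp]: "g \<in> carrier G \<Longrightarrow> \<alpha> g 1 = 1"
  using act_mult[of g 1 "\<alpha> (inv g) 1"] by (simp add: act_comp)

lemma act_scaleR: "g \<in> carrier G \<Longrightarrow> \<alpha> g (r *\<^sub>R x) = r *\<^sub>R \<alpha> g x"
  by (simp add: scaleR_scaleC act_scaleC)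

lemma act_sum: "g \<in> carrier G \<Longrightarrow> \<alpha> g (\<Sum>i\<in>I. f i) = (\<Sum>i\<in>I. \<alpha> g (f i))"
  by (induction I rule: infinite_finite_induct) (simp_all add: act_add)

lemma fixD: "\<lbrakk>x \<in> Fix S; g \<in> S\<rbrakk> \<Longrightarrow> \<alpha> g x = x"
  by (simp add: fixed_points_def)

lemma fixI: "(\<And>g. g \<in> S \<Longrightarrow> \<alpha> g x = x) \<Longrightarrow> x \<in> Fix S"
  by (simp add: fixed_points_def)

lemma fix_closed:
  assumes "S \<subseteq> carrier G"
  shows "0 \<in> Fix S" "1 \<in> Fix S"
    "\<lbrakk>x \<in> Fix S; y \<in> Fix S\<rbrakk> \<Longrightarrow> x + y \<in> Fix S" "\<lbrakk>x \<in> Fix S; y \<in> Fix S\<rbrakk> \<Longrightarrow> x * y \<in> Fix S"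
    "x \<in> Fix S \<Longrightarrow> scaleC c x \<in> Fix S" "x \<in> Fix S \<Longrightarrow> r *\<^sub>R x \<in> Fix S"
  using assms by (auto simp: fixed_points_def act_add act_mult act_scaleC act_scaleR subset_iff)

lemma fix_sum: "\<lbrakk>S \<subseteq> carrier G; \<And>i. i \<in> I \<Longrightarrow> f i \<in> Fix S\<rbrakk> \<Longrightarrow> (\<Sum>i\<in>I. f i) \<in> Fix S"
  by (induction I rule: infinite_finite_induct) (auto intro: fix_closed)

lemma fix_mono: "S \<subseteq> T \<Longrightarrow> Fix T \<subseteq> Fix S"
  by (auto simp: fixed_points_def)

lemma tr_fix:
  assumes "subgroup S G"
  shows "tr S q \<in> Fix S"
proof (rule fixI)
  fix g assume g: "g \<in> S"
  have S: "S \<subseteq> carrier G" using assms by (rule subgroup.subset)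
  have "\<alpha> g (tr S q) = (\<Sum>h\<in>S. \<alpha> (g \<otimes> h) q)"
    using g S by (simp add: act_sum act_comp subset_iff)
  also have "\<dots> = (\<Sum>h\<in>S. \<alpha> h q)"
  proof (rule sum.reindex_bij_betw)
    show "bij_betw (\<lambda>h. g \<otimes> h) S S"
      using g S assms subgroup.m_closed[OF assms] subgroup.m_inv_closed[OF assms]
      by (intro bij_betw_byWitness[where f' = "\<lambda>h. inv g \<otimes> h"])
         (auto simp: subset_iff m_assoc[symmetric])
  qed
  finally show "\<alpha> g (tr S q) = tr S q" .
qed

text \<open>The functions \<open>g \<mapsto> \<Sum>\<^sub>i x\<^sub>i \<alpha>\<^sub>g(y\<^sub>i)\<close>; their values outside \<open>carrier G\<close> are irrelevant.\<close>

inductive_set galois_functions :: "('g \<Rightarrow> 'q) set" where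
  zero_function: "(\<lambda>g. 0) \<in> galois_functions"
| add_term: "f \<in> galois_functions \<Longrightarrow> (\<lambda>g. x * \<alpha> g y + f g) \<in> galois_functions"
| agree: "\<lbrakk>f \<in> galois_functions; \<And>g. g \<in> carrier G \<Longrightarrow> f' g = f g\<rbrakk> \<Longrightarrow> f' \<in> galois_functions"

lemma galois_functions_add:
  "\<lbrakk>f \<in> galois_functions; f' \<in> galois_functions\<rbrakk> \<Longrightarrow> (\<lambda>g. f g + f' g) \<in> galois_functions"
proof (induction f rule: galois_functions.induct)
  case (add_term f x y)
  show ?case
    by (rule galois_functions.agree[OF galois_functions.add_term[OF add_term.IH[OF add_term.prems], of x y]])
       (simp add: add.assoc)
next
  case (agree f f'')
  show ?case by (rule galois_functions.agree[OF agree.IH[OF agree.prems]]) (simp add: agree.hyps)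
qed simp

lemma galois_functions_lmult:
  "f \<in> galois_functions \<Longrightarrow> (\<lambda>g. q * f g) \<in> galois_functions"
proof (induction f rule: galois_functions.induct)
  case (add_term f x y)
  show ?case
    by (rule galois_functions.agree[OF galois_functions.add_term[OF add_term.IH, of "q * x" y]])
       (simp add: distrib_left mult.assoc)
next
  case (agree f f')
  show ?case by (rule galois_functions.agree[OF agree.IH]) (simp add: agree.hyps)
qed (simp add: galois_functions.zero_function)

text \<open>Right multiplication of each y_i by q appears as multiplication by \<alpha>_g(q). This
  twisted right action is untwisted at the unit, which makes values at the unit two-sided and yields
  an intertwining relation elsewhere.\<close>

lemma galois_functions_rmult:
  "f \<in> galois_functions \<Longrightarrow> (\<lambda>g. f g * \<alpha> g q) \<in> galois_functions"
proof (induction f rule: galois_functions.induct)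
  case (add_term f x y)
  show ?case
    by (rule galois_functions.agree[OF galois_functions.add_term[OF add_term.IH, of x "y * q"]])
       (simp add: act_mult distrib_right mult.assoc)
next
  case (agree f f')
  show ?case by (rule galois_functions.agree[OF agree.IH]) (simp add: agree.hyps)
qed (simp add: galois_functions.zero_function)

lemma galois_functions_shift:
  assumes k: "k \<in> carrier G"
  shows "f \<in> galois_functions \<Longrightarrow> (\<lambda>g. f (g \<otimes> k)) \<in> galois_functions"
proof (induction f rule: galois_functions.induct)
  case (add_term f x y)
  show ?case
    by (rule galois_functions.agree[OF galois_functions.add_term[OF add_term.IH, of x "\<alpha> k y"]])
       (simp add: act_comp k)
next
  case (agree f f')
  show ?case by (rule galois_functions.agree[OF agree.IH]) (simp add: agree.hyps k)
qed (simp add: galois_functions.zero_function)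

lemma galois_functions_sum:
  assumes "f \<in> galois_functions"
  shows "\<exists>(n::nat) x y. \<forall>g\<in>carrier G. f g = (\<Sum>i<n. x i * \<alpha> g (y i))"
  using assms
proof (induction f rule: galois_functions.induct)
  case zero_function
  show ?case by (rule exI[of _ 0]) simp
next
  case (add_term f a b)
  then obtain n :: nat and x y where "\<forall>g\<in>carrier G. f g = (\<Sum>i<n. x i * \<alpha> g (y i))" by blast
  then have "\<forall>g\<in>carrier G. a * \<alpha> g b + f g = (\<Sum>i<Suc n. (x(n := a)) i * \<alpha> g ((y(n := b)) i))"
    by (auto simp: add.commute intro!: sum.cong)
  then show ?case by blast
next
  case (agree f f')
  then show ?case by metis
qed

text \<open>An element \<open>f\<close> of minimal support, normalised by simplicity to \<open>f(1) = 1\<close>, satisfies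
  \<open>q f(g) = f(g) \<alpha>\<^sub>g(q)\<close> for all \<open>q\<close>, so outerness kills \<open>f\<close> away from the unit.\<close>

lemma galois_delta: "(\<lambda>g. if g = \<one> then 1 else 0) \<in> galois_functions"
proof -
  define supp where "supp f = {g \<in> carrier G. f g \<noteq> (0::'q)}" for f :: "'g \<Rightarrow> 'q"
  have fins: "finite (supp f)" for f using fin by (simp add: supp_def)
  let ?N = "\<lambda>f. f \<in> galois_functions \<and> supp f \<noteq> {}"
  have "(\<lambda>g. 1 * \<alpha> g 1 + 0) \<in> galois_functions" by (rule galois_functions.add_term[OF galois_functions.zero_function])
  moreover have "\<one> \<in> supp (\<lambda>g. 1 * \<alpha> g 1 + 0)" by (simp add: supp_def)
  ultimately have "\<exists>f. ?N f" by blast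
  then obtain f0 where f0: "?N f0" and min0: "\<And>f. ?N f \<Longrightarrow> card (supp f0) \<le> card (supp f)"
    using ex_has_least_nat[of ?N _ "\<lambda>f. card (supp f)"] by blast
  obtain k where k: "k \<in> supp f0" using f0 by blast
  \<comment> \<open>Translation by k moves a point of the support to the unit and keeps the size of
    the support.\<close>
  define f where "f g = f0 (g \<otimes> k)" for g
  have kc: "k \<in> carrier G" using k by (simp add: supp_def)
  have f: "f \<in> galois_functions" unfolding f_def using galois_functions_shift[OF kc] f0 by blast
  have "supp f0 = (\<lambda>g. g \<otimes> k) ` supp f"
  proof
    show "supp f0 \<subseteq> (\<lambda>g. g \<otimes> k) ` supp f"
    proof
      fix g assume "g \<in> supp f0"
      then show "g \<in> (\<lambda>g. g \<otimes> k) ` supp f"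
        using kc by (intro image_eqI[of _ _ "g \<otimes> inv k"]) (auto simp: supp_def f_def m_assoc)
    qed
  qed (use kc in \<open>auto simp: supp_def f_def\<close>)
  then have "card (supp f0) = card (supp f)"
    by (simp add: card_image inj_on_def supp_def kc)
  with min0 have min: "\<And>f'. ?N f' \<Longrightarrow> card (supp f) \<le> card (supp f')" by simp
  \<comment> \<open>The values at the unit over all functions supported in \<open>supp f\<close>: a
    two-sided ideal containing the nonzero \<open>f \<one>\<close>.\<close>
  define J where "J = {f' \<one> | f'. f' \<in> galois_functions \<and> supp f' \<subseteq> supp f}"
  have JI: "f' \<one> \<in> J" if "f' \<in> galois_functions" "supp f' \<subseteq> supp f" for f'
    using that by (auto simp: J_def)
  have "1 \<in> J"
  proof (rule simple_cstar_ideal[OF simple])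
    show "f \<one> \<in> J" using JI[OF f] by blast
    show "f \<one> \<noteq> 0" using k kc by (simp add: f_def supp_def)
  next
    fix a x assume "x \<in> J"
    then obtain f' where f': "f' \<in> galois_functions" "supp f' \<subseteq> supp f" "x = f' \<one>"
      by (auto simp: J_def)
    have "supp (\<lambda>g. a * f' g) \<subseteq> supp f" "supp (\<lambda>g. f' g * \<alpha> g a) \<subseteq> supp f"
      using f'(2) by (auto simp: supp_def)
    then show "a * x \<in> J" "x * a \<in> J"
      using JI[OF galois_functions_lmult[OF f'(1), of a]] JI[OF galois_functions_rmult[OF f'(1), of a]]
      by (simp_all add: f'(3))
  next
    fix x y assume "x \<in> J" "y \<in> J"
    then obtain f1 f2 where f': "f1 \<in> galois_functions" "supp f1 \<subseteq> supp f" "x = f1 \<one>"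
      "f2 \<in> galois_functions" "supp f2 \<subseteq> supp f" "y = f2 \<one>"
      by (auto simp: J_def)
    have "supp (\<lambda>g. f1 g + f2 g) \<subseteq> supp f" using f'(2,5) by (fastforce simp: supp_def)
    with JI[OF galois_functions_add[OF f'(1,4)]] show "x + y \<in> J" by (simp add: f'(3,6))
  qed
  then obtain f1 where f1: "f1 \<in> galois_functions" "supp f1 \<subseteq> supp f" "f1 \<one> = 1"
    unfolding J_def by force
  have one_in: "\<one> \<in> supp f" using f1 by (auto simp: supp_def)
  have rel: "q * f1 g = f1 g * \<alpha> g q" if g: "g \<in> carrier G" for q g
  proof (rule ccontr)
    assume neq: "q * f1 g \<noteq> f1 g * \<alpha> g q"
    \<comment> \<open>It vanishes at the unit because \<open>f1 \<one> = 1\<close>, so its support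
      is smaller than the minimal one.\<close>
    define d where "d g = q * f1 g + (- 1) * (f1 g * \<alpha> g q)" for g
    have "d \<in> galois_functions"
      unfolding d_def by (intro galois_functions_add galois_functions_lmult galois_functions_rmult f1)
    moreover have "g \<in> supp d" using g neq by (simp add: supp_def d_def)
    ultimately have "card (supp f) \<le> card (supp d)" using min by blast
    moreover have "supp d \<subseteq> supp f - {\<one>}" using f1(2,3) by (auto simp: supp_def d_def)
    then have "card (supp d) < card (supp f)"
      using one_in fins by (meson card_Diff1_less card_mono finite_Diff le_less_trans)
    ultimately show False by simp
  qed
  have zero: "f1 g = 0" if g: "g \<in> carrier G" "g \<noteq> \<one>" for g
  \<comment> \<open>Solving the relation for right multiplication by x makes \<open>f1 g\<close> an
    intertwiner for the inverse of g.\<close>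
  proof (rule outer)
    show "inv g \<in> carrier G" "inv g \<noteq> \<one>" using g by (auto simp: inv_eq_1_iff)
    fix x
    show "f1 g * x = \<alpha> (inv g) x * f1 g"
      using rel[OF g(1), of "\<alpha> (inv g) x"] g by (simp add: act_comp)
  qed
  show ?thesis by (rule galois_functions.agree[OF f1(1)]) (simp add: f1(3) zero)
qed

text \<open>Traces over H move coordinates of Q into the fixed point algebra. Expanding both traces
  gives one delta for each pair h, h' in H, nonzero exactly when h = g h'; such pairs exist only for
  g in H, and then there are |H| of them.\<close>

lemma galois_coordinates:
  assumes H: "subgroup H G"
  obtains n :: nat and x y where "\<And>i. x i \<in> Fix H" "\<And>i. y i \<in> Fix H"
    "\<And>g. g \<in> carrier G \<Longrightarrow>
      (\<Sum>i<n. x i * \<alpha> g (y i)) = (if g \<in> H then (1 / real (card H)) *\<^sub>R 1 else 0)"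
proof -
  obtain n :: nat and x y where xy: "\<And>g. g \<in> carrier G \<Longrightarrow>
      (\<Sum>i<n. x i * \<alpha> g (y i)) = (if g = \<one> then 1 else 0)"
    using galois_functions_sum[OF galois_delta] by metis
  have Hc: "H \<subseteq> carrier G" and finH: "finite H"
    using H fin by (auto intro: finite_subset dest: subgroup.subset)
  \<comment> \<open>Turns the count |H| into 1/|H|, the weight with which summing an H-fixed element
    over H returns that element.\<close>
  define r where "r = (1 / real (card H))\<^sup>2"
  have cH: "card H \<noteq> 0" using finH subgroup.one_closed[OF H] by auto
  show thesis
  proof (rule that[of "\<lambda>i. r *\<^sub>R tr H (x i)" "\<lambda>i. tr H (y i)" n])
    show "r *\<^sub>R tr H (x i) \<in> Fix H" for i by (rule fix_closed(6)[OF Hc tr_fix[OF H]])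
    show "tr H (y i) \<in> Fix H" for i by (rule tr_fix[OF H])
    fix g assume g: "g \<in> carrier G"
    have "(\<Sum>i<n. tr H (x i) * \<alpha> g (tr H (y i)))
        = (\<Sum>i<n. \<Sum>h\<in>H. \<Sum>h'\<in>H. \<alpha> h (x i) * \<alpha> g (\<alpha> h' (y i)))"
      using g by (simp add: act_sum sum_product)
    also have "\<dots> = (\<Sum>h\<in>H. \<Sum>i<n. \<Sum>h'\<in>H. \<alpha> h (x i) * \<alpha> g (\<alpha> h' (y i)))"
      by (rule sum.swap)
    also have "\<dots> = (\<Sum>h\<in>H. \<Sum>h'\<in>H. \<Sum>i<n. \<alpha> h (x i) * \<alpha> g (\<alpha> h' (y i)))"
      by (intro sum.cong refl sum.swap)
    also have "\<dots> = (\<Sum>h\<in>H. \<Sum>h'\<in>H. if h = g \<otimes> h' then 1 else 0)"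
    proof (intro sum.cong refl)
      fix h h' assume hh: "h \<in> H" "h' \<in> H"
      then have c: "h \<in> carrier G" "h' \<in> carrier G" using Hc by auto
      have "(\<Sum>i<n. \<alpha> h (x i) * \<alpha> g (\<alpha> h' (y i))) = \<alpha> h (\<Sum>i<n. x i * \<alpha> (inv h \<otimes> g \<otimes> h') (y i))"
        using c g by (simp add: act_sum act_mult act_comp m_assoc[symmetric])
      also have "\<dots> = (if h = g \<otimes> h' then 1 else 0)"
      proof -
        have "inv h \<otimes> g \<otimes> h' = \<one> \<longleftrightarrow> h = g \<otimes> h'"
          using c g by (metis inv_closed inv_equality inv_inv m_assoc m_closed l_inv)
        then show ?thesis using c g by (simp add: xy)
      qed
      finally show "(\<Sum>i<n. \<alpha> h (x i) * \<alpha> g (\<alpha> h' (y i))) = (if h = g \<otimes> h' then 1 else 0)" .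
    qed
    also have "\<dots> = (\<Sum>h'\<in>H. \<Sum>h\<in>H. if h = g \<otimes> h' then 1 else 0)" by (rule sum.swap)
    also have "\<dots> = (\<Sum>h'\<in>H. if g \<in> H then 1 else 0)"
    proof (intro sum.cong refl)
      fix h' assume h': "h' \<in> H"
      have "g \<otimes> h' \<in> H \<longleftrightarrow> g \<in> H"
        using H h' g Hc by (metis subgroup.m_closed subgroup.m_inv_closed subsetD inv_solve_right' m_closed)
      then show "(\<Sum>h\<in>H. if h = g \<otimes> h' then 1 else 0) = (if g \<in> H then 1 else 0 :: 'q)"
        using finH by (simp add: sum.delta')
    qed
    finally have "(\<Sum>i<n. tr H (x i) * \<alpha> g (tr H (y i))) = (if g \<in> H then of_nat (card H) else 0)"
      by simp
    then have "(\<Sum>i<n. r *\<^sub>R tr H (x i) * \<alpha> g (tr H (y i))) = r *\<^sub>R (if g \<in> H then of_nat (card H) else 0)"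
      by (simp add: scaleR_sum_right[symmetric])
    also have "\<dots> = (if g \<in> H then (1 / real (card H)) *\<^sub>R 1 else 0)"
    proof -
      have "of_nat (card H) = real (card H) *\<^sub>R (1::'q)" by (simp add: scaleR_conv_of_real)
      moreover have "r * real (card H) = 1 / real (card H)"
        using cH by (simp add: r_def power2_eq_square)
      ultimately show ?thesis by (simp only: scaleR_scaleR scaleR_zero_right if_distrib[of "scaleR r"])
    qed
    finally show "(\<Sum>i<n. r *\<^sub>R tr H (x i) * \<alpha> g (tr H (y i))) =
      (if g \<in> H then (1 / real (card H)) *\<^sub>R 1 else 0)" .
  qed
qed

end

text \<open>Generic in the subgroup, since it serves three times: for H itself, for the trivial
  subgroup when the commutant of P in Q is computed, and for the subgroup of those g that act on A
  through some \<beta>_k.\<close>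

locale galois_basis = outer_action G \<alpha> for G :: "('g, 'm) monoid_scheme" (structure)
    and \<alpha> :: "'g \<Rightarrow> 'q::cstar_algebra \<Rightarrow> 'q" +
  fixes H :: "'g set" and n :: nat and x y :: "nat \<Rightarrow> 'q"
  assumes H: "subgroup H G"
    and x_fix: "\<And>i. x i \<in> Fix H" and y_fix: "\<And>i. y i \<in> Fix H"
    and xy: "\<And>g. g \<in> carrier G \<Longrightarrow>
      (\<Sum>i<n. x i * \<alpha> g (y i)) = (if g \<in> H then (1 / real (card H)) *\<^sub>R 1 else 0)"
begin

lemma H_sub: "H \<subseteq> carrier G"
  using H by (rule subgroup.subset)

lemma finite_H: "finite H"
  using H_sub fin by (rule finite_subset)

lemma card_H: "card H > 0"
  using finite_H subgroup.one_closed[OF H] by (auto simp: card_gt_0_iff)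

lemmas A_closed = fix_closed[OF H_sub]

lemma G_subgroup: "subgroup (carrier G) G"
  by (rule subgroup_self)

lemma tr_P: "tr (carrier G) a \<in> Fix (carrier G)"
  by (rule tr_fix[OF G_subgroup])

lemma P_sub: "Fix (carrier G) \<subseteq> Fix H"
  by (rule fix_mono[OF H_sub])

lemma sum_H_fix:
  assumes a: "a \<in> Fix H"
  shows "(\<Sum>k\<in>carrier G. \<alpha> k a * (if k \<in> H then (1 / real (card H)) *\<^sub>R 1 else 0)) = a"
    and "(\<Sum>k\<in>carrier G. (if k \<in> H then (1 / real (card H)) *\<^sub>R 1 else 0) * \<alpha> k a) = a"
proof -
  have "(\<Sum>k\<in>carrier G. if k \<in> H then (1 / real (card H)) *\<^sub>R \<alpha> k a else 0)
      = (\<Sum>k\<in>H. (1 / real (card H)) *\<^sub>R a)"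
    using H_sub fin fixD[OF a] by (simp add: sum.If_cases Int_absorb1)
  also have "\<dots> = a" using card_H by (simp only: sum_constant_scaleR) simp
  finally have *: "(\<Sum>k\<in>carrier G. if k \<in> H then (1 / real (card H)) *\<^sub>R \<alpha> k a else 0) = a" .
  show "(\<Sum>k\<in>carrier G. \<alpha> k a * (if k \<in> H then (1 / real (card H)) *\<^sub>R 1 else 0)) = a"
    by (rule trans[OF sum.cong *]) auto
  show "(\<Sum>k\<in>carrier G. (if k \<in> H then (1 / real (card H)) *\<^sub>R 1 else 0) * \<alpha> k a) = a"
    by (rule trans[OF sum.cong *]) auto
qed

lemma xy':
  assumes k: "k \<in> carrier G"
  shows "(\<Sum>i<n. \<alpha> k (x i) * y i) = (if k \<in> H then (1 / real (card H)) *\<^sub>R 1 else 0)"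
proof -
  have "(\<Sum>i<n. \<alpha> k (x i) * y i) = \<alpha> k (\<Sum>i<n. x i * \<alpha> (inv k) (y i))"
    using k by (simp add: act_sum act_mult act_comp)
  also have "\<dots> = (if inv k \<in> H then (1 / real (card H)) *\<^sub>R 1 else 0)"
    using k by (simp add: xy act_scaleR)
  also have "inv k \<in> H \<longleftrightarrow> k \<in> H"
    using k subgroup.m_inv_closed[OF H] inv_inv by metis
  finally show ?thesis .
qed

text \<open>Once the sum over G is taken outside, the coordinates become the weighted indicator of
  H. This is the quasi-basis identity for F without its factor 1/|G|.\<close>

lemma reconstruct_left:
  assumes a: "a \<in> Fix H"
  shows "(\<Sum>i<n. x i * tr (carrier G) (y i * a)) = a"
proof -
  have "(\<Sum>i<n. x i * tr (carrier G) (y i * a)) = (\<Sum>i<n. \<Sum>k\<in>carrier G. x i * \<alpha> k (y i) * \<alpha> k a)"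
    by (simp add: sum_distrib_left act_mult mult.assoc)
  also have "\<dots> = (\<Sum>k\<in>carrier G. (\<Sum>i<n. x i * \<alpha> k (y i)) * \<alpha> k a)"
    by (subst sum.swap) (simp add: sum_distrib_right)
  also have "\<dots> = a" using sum_H_fix(2)[OF a] by (simp add: xy)
  finally show ?thesis .
qed

lemma reconstruct_right:
  assumes a: "a \<in> Fix H"
  shows "(\<Sum>i<n. tr (carrier G) (a * x i) * y i) = a"
proof -
  have "(\<Sum>i<n. tr (carrier G) (a * x i) * y i) = (\<Sum>i<n. \<Sum>k\<in>carrier G. \<alpha> k a * (\<alpha> k (x i) * y i))"
    by (simp add: sum_distrib_right act_mult mult.assoc)
  also have "\<dots> = (\<Sum>k\<in>carrier G. \<alpha> k a * (\<Sum>i<n. \<alpha> k (x i) * y i))"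
    by (subst sum.swap) (simp add: sum_distrib_left)
  also have "\<dots> = a" using sum_H_fix(1)[OF a] by (simp add: xy')
  finally show ?thesis .
qed

text \<open>In \<open>A \<otimes>\<^sub>P A\<close> one has \<open>\<Sum>\<^sub>i x\<^sub>i \<otimes> y\<^sub>i a = \<Sum>\<^sub>i a x\<^sub>i \<otimes> y\<^sub>i\<close>; this is its image under the
  \<open>P\<close>-balanced map \<open>b \<otimes> c \<mapsto> \<phi>(b) \<psi>(c)\<close>.\<close>

lemma balanced_transfer:
  fixes \<phi> \<psi> :: "'q \<Rightarrow> 'q"
  assumes add1: "\<And>b c. \<lbrakk>b \<in> Fix H; c \<in> Fix H\<rbrakk> \<Longrightarrow> \<phi> (b + c) = \<phi> b + \<phi> c"
    and add2: "\<And>b c. \<lbrakk>b \<in> Fix H; c \<in> Fix H\<rbrakk> \<Longrightarrow> \<psi> (b + c) = \<psi> b + \<psi> c"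
    and bal: "\<And>b c p. \<lbrakk>b \<in> Fix H; c \<in> Fix H; p \<in> Fix (carrier G)\<rbrakk> \<Longrightarrow> \<phi> (b * p) * \<psi> c = \<phi> b * \<psi> (p * c)"
    and a: "a \<in> Fix H"
  shows "(\<Sum>i<n. \<phi> (x i) * \<psi> (y i * a)) = (\<Sum>i<n. \<phi> (a * x i) * \<psi> (y i))"
proof -
  have zero: "\<phi> 0 = 0" "\<psi> 0 = 0" using add1[of 0 0] add2[of 0 0] A_closed(1) by auto
  have sum1: "\<phi> (\<Sum>i\<in>I. f i) = (\<Sum>i\<in>I. \<phi> (f i))" if "\<And>i. f i \<in> Fix H" for I :: "nat set" and f
    using that by (induction I rule: infinite_finite_induct) (simp_all add: zero add1 fix_sum[OF H_sub])
  have sum2: "\<psi> (\<Sum>i\<in>I. f i) = (\<Sum>i\<in>I. \<psi> (f i))" if "\<And>i. f i \<in> Fix H" for I :: "nat set" and f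
    using that by (induction I rule: infinite_finite_induct) (simp_all add: zero add2 fix_sum[OF H_sub])
  \<comment> \<open>Matrix entries in P: y_i a is the sum of the t_ij y_j over j, and a x_j is the
    sum of the x_i t_ij over i. Balancedness moves them across.\<close>
  define t where "t i j = tr (carrier G) (y i * a * x j)" for i j
  have t: "t i j \<in> Fix (carrier G)" "t i j \<in> Fix H" for i j
    using tr_P P_sub by (auto simp: t_def)
  have "(\<Sum>i<n. \<phi> (x i) * \<psi> (y i * a)) = (\<Sum>i<n. \<phi> (x i) * \<psi> (\<Sum>j<n. t i j * y j))"
    unfolding t_def by (subst reconstruct_right) (simp_all add: A_closed y_fix a)
  also have "\<dots> = (\<Sum>i<n. \<Sum>j<n. \<phi> (x i * t i j) * \<psi> (y j))"
    by (subst sum2) (simp_all add: A_closed t y_fix x_fix sum_distrib_left bal)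
  also have "\<dots> = (\<Sum>j<n. \<Sum>i<n. \<phi> (x i * t i j) * \<psi> (y j))" by (rule sum.swap)
  also have "\<dots> = (\<Sum>j<n. \<phi> (\<Sum>i<n. x i * t i j) * \<psi> (y j))"
    by (subst sum1) (simp_all add: A_closed t x_fix sum_distrib_right)
  also have "\<dots> = (\<Sum>j<n. \<phi> (a * x j) * \<psi> (y j))"
    using reconstruct_left[of "a * x j" for j] by (simp add: t_def mult.assoc A_closed a x_fix)
  finally show ?thesis .
qed

text \<open>The coordinates separate H from its complement: on an element acting trivially on A,
  their sum has the same nonzero value as at the unit.\<close>

lemma fixing_mem:
  assumes k: "k \<in> carrier G" and fixed: "\<And>a. a \<in> Fix H \<Longrightarrow> \<alpha> k a = a"
  shows "k \<in> H"
proof (rule ccontr)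
  assume "k \<notin> H"
  then have "(\<Sum>i<n. x i * \<alpha> k (y i)) = 0" using k by (simp add: xy)
  moreover have "(\<Sum>i<n. x i * \<alpha> k (y i)) = (\<Sum>i<n. x i * \<alpha> \<one> (y i))" by (simp add: fixed y_fix)
  moreover have "\<dots> = (1 / real (card H)) *\<^sub>R 1" using xy[of \<one>] subgroup.one_closed[OF H] by simp
  ultimately show False using card_H by simp
qed

text \<open>If g^-1 preserves A, then g h g^-1 fixes A pointwise, and \<open>fixing_mem\<close>
  recognises it as a member of H.\<close>

lemma invariant_imp_normal:
  assumes inv: "\<And>g a. \<lbrakk>g \<in> carrier G; a \<in> Fix H\<rbrakk> \<Longrightarrow> \<alpha> g a \<in> Fix H"
  shows "H \<lhd> G"
proof (rule normal_invI[OF H])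
  fix g h assume g: "g \<in> carrier G" and h: "h \<in> H"
  have hc: "h \<in> carrier G" using h H_sub by blast
  show "g \<otimes> h \<otimes> inv g \<in> H"
  proof (rule fixing_mem)
    fix a assume "a \<in> Fix H"
    then have "\<alpha> (inv g) a \<in> Fix H" using inv g by simp
    then have "\<alpha> g (\<alpha> h (\<alpha> (inv g) a)) = \<alpha> g (\<alpha> (inv g) a)" using fixD h by metis
    then show "\<alpha> (g \<otimes> h \<otimes> inv g) a = a" using g hc by (simp add: act_comp m_assoc)
  qed (use g hc in simp)
qed

end

context outer_action
begin

text \<open>A Fourier decomposition: c is the sum of elements d_g with d_g a = \<alpha>_g(a) d_g for
  all a in Q. Outerness leaves only d_1, which is central. The transfer identity applies because c
  commutes with P, which makes (b, e) |-> \<alpha>_g(b) c e balanced.\<close>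

lemma commutant_scalar:
  assumes c: "\<And>p. p \<in> Fix (carrier G) \<Longrightarrow> c * p = p * c"
  obtains l where "c = scaleC l 1"
proof -
  have sub1: "subgroup {\<one>} G" by (rule triv_subgroup)
  have fix1: "a \<in> Fix {\<one>}" for a by (simp add: fixed_points_def)
  obtain n and x y :: "nat \<Rightarrow> 'q" where "\<And>i. x i \<in> Fix {\<one>}" "\<And>i. y i \<in> Fix {\<one>}"
    and xy: "\<And>g. g \<in> carrier G \<Longrightarrow>
      (\<Sum>i<n. x i * \<alpha> g (y i)) = (if g \<in> {\<one>} then (1 / real (card {\<one>})) *\<^sub>R 1 else 0)"
    by (rule galois_coordinates[OF sub1]) (rule that)
  then interpret B: galois_basis G \<alpha> "{\<one>}" n x y
    by unfold_locales (simp_all add: sub1)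
  define d where "d g = (\<Sum>i<n. \<alpha> g (x i) * (c * y i))" for g
  have d: "d g * a = \<alpha> g a * d g" if g: "g \<in> carrier G" for g a
  proof -
    have "d g * a = (\<Sum>i<n. \<alpha> g (x i) * (c * (y i * a)))"
      by (simp add: d_def sum_distrib_right mult.assoc)
    also have "\<dots> = (\<Sum>i<n. \<alpha> g (a * x i) * (c * y i))"
    proof (rule B.balanced_transfer)
      fix b e p assume p: "p \<in> Fix (carrier G)"
      show "\<alpha> g (b * p) * (c * e) = \<alpha> g b * (c * (p * e))"
        using g fixD[OF p g] by (simp add: act_mult mult.assoc) (simp add: mult.assoc[symmetric] c[OF p])
    qed (use g fix1 in \<open>simp_all add: act_add distrib_left\<close>)
    also have "\<dots> = \<alpha> g a * d g" using g by (simp add: d_def sum_distrib_left act_mult mult.assoc)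
    finally show ?thesis .
  qed
  have "d g = 0" if "g \<in> carrier G" "g \<noteq> \<one>" for g
    using outer[OF that] d[OF that(1)] by blast
  then have "(\<Sum>g\<in>carrier G. d g) = d \<one>"
    using fin by (subst sum.remove[of _ \<one>]) auto
  moreover have "(\<Sum>g\<in>carrier G. d g) = (\<Sum>i<n. tr (carrier G) (x i) * c * y i)"
    unfolding d_def by (subst sum.swap) (simp add: sum_distrib_right mult.assoc)
  moreover have "\<dots> = c * (\<Sum>i<n. tr (carrier G) (1 * x i) * y i)"
    using c[OF B.tr_P] by (simp add: sum_distrib_left mult.assoc[symmetric])
  moreover have "\<dots> = c" using B.reconstruct_right[OF fix1, of 1] by simp
  ultimately have "c = d \<one>" by simp
  then have "c * a = a * c" for a using d[OF one_closed, of a] by simp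
  then show thesis using simple_cstar_center[OF simple] that by metis
qed

end


section \<open>The algebraic basic construction\<close>

text \<open>The structure handed from one basic construction to the next:
  \<open>complex_semiring_B\<close> reproduces it, so the operator theory is developed once and
  applied to A and to A_1.\<close>

locale complex_semiring = semiring R for R :: "(complex, 'a) module" (structure) +
  assumes smult_closed [simp, intro]: "x \<in> carrier R \<Longrightarrow> c \<odot> x \<in> carrier R"
    and smult_r_distr: "\<lbrakk>x \<in> carrier R; y \<in> carrier R\<rbrakk> \<Longrightarrow> c \<odot> (x \<oplus> y) = c \<odot> x \<oplus> c \<odot> y"
    and smult_assoc_left: "\<lbrakk>x \<in> carrier R; y \<in> carrier R\<rbrakk> \<Longrightarrow> (c \<odot> x) \<otimes> y = c \<odot> (x \<otimes> y)"
    and smult_assoc_right: "\<lbrakk>x \<in> carrier R; y \<in> carrier R\<rbrakk> \<Longrightarrow> x \<otimes> (c \<odot> y) = c \<odot> (x \<otimes> y)"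
begin

lemma smult_zero [simp]: "c \<odot> \<zero> = \<zero>"
  using smult_assoc_left[of \<zero> \<zero> c] by simp

end

text \<open>Right P-linearity of F is what makes x e_P y a module operator. The instances are F from
  A to P and the dual expectation from A_1 to A.\<close>

locale module_expectation = complex_semiring R for R :: "(complex, 'a) module" (structure) +
  fixes P :: "'a set" and F :: "'a \<Rightarrow> 'a"
  assumes P_sub: "P \<subseteq> carrier R" and P_zero: "\<zero> \<in> P"
    and F_mem: "x \<in> carrier R \<Longrightarrow> F x \<in> P"
    and F_add: "\<lbrakk>x \<in> carrier R; y \<in> carrier R\<rbrakk> \<Longrightarrow> F (x \<oplus> y) = F x \<oplus> F y"
    and F_smult: "x \<in> carrier R \<Longrightarrow> F (c \<odot> x) = c \<odot> F x"
    and F_mod: "\<lbrakk>x \<in> carrier R; p \<in> P\<rbrakk> \<Longrightarrow> F (x \<otimes> p) = F x \<otimes> p"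
begin

abbreviation "M \<equiv> module_operators R P"
abbreviation "B \<equiv> basic_construction R P F"
abbreviation "jp \<equiv> jones_product R F"

lemma P_closed [simp]: "p \<in> P \<Longrightarrow> p \<in> carrier R"
  using P_sub by blast

lemma F_closed [simp]: "x \<in> carrier R \<Longrightarrow> F x \<in> carrier R"
  using F_mem P_sub by blast

lemma F_zero: "F \<zero> = \<zero>"
  using F_mod[OF zero_closed P_zero] by simp

lemma M_D:
  assumes "T \<in> carrier M"
  shows "T \<in> extensional (carrier R)" "x \<in> carrier R \<Longrightarrow> T x \<in> carrier R"
    "\<lbrakk>x \<in> carrier R; y \<in> carrier R\<rbrakk> \<Longrightarrow> T (x \<oplus> y) = T x \<oplus> T y"
    "x \<in> carrier R \<Longrightarrow> T (c \<odot> x) = c \<odot> T x"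
    "\<lbrakk>x \<in> carrier R; p \<in> P\<rbrakk> \<Longrightarrow> T (x \<otimes> p) = T x \<otimes> p"
  using assms by (auto simp: module_operators_def PiE_iff)

text \<open>In a semiring this cannot come from additivity by cancellation; it is linearity at the
  element 0 of P.\<close>

lemma M_maps_zero: "T \<in> carrier M \<Longrightarrow> T \<zero> = \<zero>"
  using M_D(5)[of T \<zero> \<zero>] M_D(2)[of T \<zero>] P_zero by simp

lemma M_I:
  assumes "T \<in> extensional (carrier R)" "\<And>x. x \<in> carrier R \<Longrightarrow> T x \<in> carrier R"
    "\<And>x y. \<lbrakk>x \<in> carrier R; y \<in> carrier R\<rbrakk> \<Longrightarrow> T (x \<oplus> y) = T x \<oplus> T y"
    "\<And>x c. x \<in> carrier R \<Longrightarrow> T (c \<odot> x) = c \<odot> T x"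
    "\<And>x p. \<lbrakk>x \<in> carrier R; p \<in> P\<rbrakk> \<Longrightarrow> T (x \<otimes> p) = T x \<otimes> p"
  shows "T \<in> carrier M"
  using assms by (simp add: module_operators_def PiE_iff)

lemma M_zero_apply: "\<zero>\<^bsub>M\<^esub> = (\<lambda>x\<in>carrier R. \<zero>)"
  by (simp add: module_operators_def)

lemma M_add_apply: "S \<oplus>\<^bsub>M\<^esub> T = (\<lambda>x\<in>carrier R. S x \<oplus> T x)"
  by (simp add: module_operators_def)

lemma M_smult_apply: "c \<odot>\<^bsub>M\<^esub> T = (\<lambda>x\<in>carrier R. c \<odot> T x)"
  by (simp add: module_operators_def)

lemma B_simps: "S \<oplus>\<^bsub>B\<^esub> T = S \<oplus>\<^bsub>M\<^esub> T" "\<zero>\<^bsub>B\<^esub> = \<zero>\<^bsub>M\<^esub>" "S \<otimes>\<^bsub>B\<^esub> T = compose (carrier R) S T"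
  "c \<odot>\<^bsub>B\<^esub> T = c \<odot>\<^bsub>M\<^esub> T" "\<one>\<^bsub>B\<^esub> = (\<lambda>x\<in>carrier R. x)"
  by (simp_all add: basic_construction_def module_operators_def)

lemma M_add_closed:
  assumes "S \<in> carrier M" "T \<in> carrier M"
  shows "S \<oplus>\<^bsub>M\<^esub> T \<in> carrier M"
  unfolding M_add_apply
proof (rule M_I)
  fix x p assume "x \<in> carrier R" "p \<in> P"
  then show "(\<lambda>x\<in>carrier R. S x \<oplus> T x) (x \<otimes> p) = (\<lambda>x\<in>carrier R. S x \<oplus> T x) x \<otimes> p"
    by (simp add: M_D[OF assms(1)] M_D[OF assms(2)] l_distr)
qed (simp_all add: M_D[OF assms(1)] M_D[OF assms(2)] a_ac smult_r_distr)

lemma M_zero_closed: "\<zero>\<^bsub>M\<^esub> \<in> carrier M"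
  unfolding M_zero_apply by (rule M_I) simp_all

lemma abelian_monoid_M: "abelian_monoid M"
proof (rule abelian_monoidI)
  fix S T U assume STU: "S \<in> carrier M" "T \<in> carrier M" "U \<in> carrier M"
  show "S \<oplus>\<^bsub>M\<^esub> T \<oplus>\<^bsub>M\<^esub> U = S \<oplus>\<^bsub>M\<^esub> (T \<oplus>\<^bsub>M\<^esub> U)"
    unfolding M_add_apply by (rule extensionalityI[of _ "carrier R"]) (simp_all add: M_D[OF STU(1)] M_D[OF STU(2)] M_D[OF STU(3)] a_assoc)
next
  fix S T assume ST: "S \<in> carrier M" "T \<in> carrier M"
  show "S \<oplus>\<^bsub>M\<^esub> T \<in> carrier M" using ST by (rule M_add_closed)
  show "S \<oplus>\<^bsub>M\<^esub> T = T \<oplus>\<^bsub>M\<^esub> S"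
    unfolding M_add_apply by (rule extensionalityI[of _ "carrier R"]) (simp_all add: M_D[OF ST(1)] M_D[OF ST(2)] a_comm)
next
  fix S assume S: "S \<in> carrier M"
  show "\<zero>\<^bsub>M\<^esub> \<oplus>\<^bsub>M\<^esub> S = S"
    unfolding M_add_apply M_zero_apply
    by (rule extensionalityI[of _ "carrier R"]) (simp_all add: M_D[OF S])
qed (rule M_zero_closed)

lemma M_at:
  assumes "z \<in> carrier R"
  shows M_add_at: "(S \<oplus>\<^bsub>M\<^esub> T) z = S z \<oplus> T z"
    and M_zero_at: "\<zero>\<^bsub>M\<^esub> z = \<zero>" and M_smult_at: "(c \<odot>\<^bsub>M\<^esub> T) z = c \<odot> T z"
  using assms by (simp_all add: M_add_apply M_zero_apply M_smult_apply)

text \<open>A \<open>finsum\<close> is a fold inside a carrier, so sums among all operators and sums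
  in the basic construction are different terms; N stands for either.\<close>

lemma finsum_operators_apply:
  assumes N: "abelian_monoid N" "add N = add M" "zero N = zero M" "carrier N \<subseteq> carrier M"
    and I: "finite I" and f: "\<And>i. i \<in> I \<Longrightarrow> f i \<in> carrier N" and z: "z \<in> carrier R"
  shows "(\<Oplus>\<^bsub>N\<^esub>i\<in>I. f i) z = (\<Oplus>i\<in>I. f i z)"
proof -
  interpret N: abelian_monoid N by (rule N)
  show ?thesis using I f
  proof (induction I rule: finite_induct)
    case empty
    then show ?case using z by (simp add: N M_zero_at)
  next
    case (insert i I)
    have "f j z \<in> carrier R" if "j \<in> insert i I" for j
      using insert.prems[OF that] N(4) M_D(2) z by blast
    then show ?case using insert z by (simp add: N(2) M_add_at)
  qed
qed

lemma jp_apply: "\<lbrakk>a \<in> carrier R; b \<in> carrier R; z \<in> carrier R\<rbrakk> \<Longrightarrow> jp a b z = a \<otimes> F (b \<otimes> z)"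
  by (simp add: jones_product_def compose_def left_mult_def jones_projection_def)

lemma jp_extensional: "jp a b \<in> extensional (carrier R)"
  by (simp add: jones_product_def compose_extensional)

lemma jp_M:
  assumes "a \<in> carrier R" "b \<in> carrier R"
  shows "jp a b \<in> carrier M"
proof (rule M_I)
  fix x p assume xp: "x \<in> carrier R" "p \<in> P"
  then have "b \<otimes> (x \<otimes> p) = (b \<otimes> x) \<otimes> p" "a \<otimes> (F (b \<otimes> x) \<otimes> p) = a \<otimes> F (b \<otimes> x) \<otimes> p"
    using assms by (simp_all add: m_assoc)
  then show "jp a b (x \<otimes> p) = jp a b x \<otimes> p"
    using assms xp by (simp add: jp_apply F_mod)
qed (use assms in \<open>simp_all add: jp_apply jp_extensional r_distr F_add F_smult
    smult_assoc_right\<close>)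

lemma jones_sum_apply:
  assumes "x \<in> {..<n} \<rightarrow> carrier R" "y \<in> {..<n} \<rightarrow> carrier R" "z \<in> carrier R"
  shows "jones_sum R P F n x y z = (\<Oplus>i\<in>{..<n}. x i \<otimes> F (y i \<otimes> z))"
proof -
  have "jones_sum R P F n x y z = (\<Oplus>i\<in>{..<n}. jp (x i) (y i) z)"
    unfolding jones_sum_def
    by (rule finsum_operators_apply) (use assms in \<open>auto simp: abelian_monoid_M intro!: jp_M\<close>)
  also have "\<dots> = (\<Oplus>i\<in>{..<n}. x i \<otimes> F (y i \<otimes> z))"
    by (rule finsum_cong') (use assms in \<open>auto simp: jp_apply Pi_iff\<close>)
  finally show ?thesis .
qed

lemma jones_sum_0: "jones_sum R P F 0 x y = \<zero>\<^bsub>M\<^esub>"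
proof -
  interpret abelian_monoid M by (rule abelian_monoid_M)
  show ?thesis by (simp add: jones_sum_def)
qed

lemma jones_sum_Suc:
  assumes "x \<in> {..<Suc n} \<rightarrow> carrier R" "y \<in> {..<Suc n} \<rightarrow> carrier R"
  shows "jones_sum R P F (Suc n) x y = jp (x n) (y n) \<oplus>\<^bsub>M\<^esub> jones_sum R P F n x y"
proof -
  interpret M: abelian_monoid M by (rule abelian_monoid_M)
  show ?thesis unfolding jones_sum_def lessThan_Suc
    by (rule M.finsum_insert) (use assms in \<open>auto simp: Pi_iff intro!: jp_M\<close>)
qed

lemma jones_sum_cong:
  assumes "\<And>i. i < n \<Longrightarrow> x i = x' i \<and> y i = y' i" "x \<in> {..<n} \<rightarrow> carrier R" "y \<in> {..<n} \<rightarrow> carrier R"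
  shows "jones_sum R P F n x y = jones_sum R P F n x' y'"
proof -
  interpret M: abelian_monoid M by (rule abelian_monoid_M)
  show ?thesis unfolding jones_sum_def
    by (rule M.finsum_cong') (use assms in \<open>auto simp: Pi_iff intro!: jp_M\<close>)
qed

lemma carrier_B: "carrier B = {jones_sum R P F n x y | n x y.
    x \<in> {..<n} \<rightarrow> carrier R \<and> y \<in> {..<n} \<rightarrow> carrier R}"
  by (simp add: basic_construction_def)

lemma B_zero_closed: "\<zero>\<^bsub>M\<^esub> \<in> carrier B"
  unfolding carrier_B using jones_sum_0 by (auto intro!: exI[of _ 0])

lemma B_jp_add:
  assumes "a \<in> carrier R" "b \<in> carrier R" "S \<in> carrier B"
  shows "jp a b \<oplus>\<^bsub>M\<^esub> S \<in> carrier B"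
proof -
  obtain n x y where S: "S = jones_sum R P F n x y"
    "x \<in> {..<n} \<rightarrow> carrier R" "y \<in> {..<n} \<rightarrow> carrier R"
    using assms(3) unfolding carrier_B by blast
  have m: "x(n := a) \<in> {..<Suc n} \<rightarrow> carrier R" "y(n := b) \<in> {..<Suc n} \<rightarrow> carrier R"
    using S assms by (auto simp: Pi_iff)
  have "jones_sum R P F n (x(n := a)) (y(n := b)) = S"
    unfolding S(1) by (rule jones_sum_cong) (use S assms in \<open>auto simp: Pi_iff\<close>)
  then have "jones_sum R P F (Suc n) (x(n := a)) (y(n := b)) = jp a b \<oplus>\<^bsub>M\<^esub> S"
    using jones_sum_Suc[OF m] by simp
  with m show ?thesis unfolding carrier_B by (metis (mono_tags, lifting) mem_Collect_eq)
qed

lemma B_induct [consumes 1, case_names zero add]: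
  assumes T: "T \<in> carrier B" and zero: "Q \<zero>\<^bsub>M\<^esub>"
    and add: "\<And>a b S. \<lbrakk>a \<in> carrier R; b \<in> carrier R; S \<in> carrier B; Q S\<rbrakk> \<Longrightarrow> Q (jp a b \<oplus>\<^bsub>M\<^esub> S)"
  shows "Q T"
proof -
  have "Q (jones_sum R P F n x y)"
    if "x \<in> {..<n} \<rightarrow> carrier R" "y \<in> {..<n} \<rightarrow> carrier R" for n x y
    using that
  proof (induction n)
    case 0
    show ?case using zero by (simp add: jones_sum_0)
  next
    case (Suc n)
    then have xy: "x \<in> {..<n} \<rightarrow> carrier R" "y \<in> {..<n} \<rightarrow> carrier R" by auto
    then have "jones_sum R P F n x y \<in> carrier B" unfolding carrier_B by blast
    then show ?case
      unfolding jones_sum_Suc[OF Suc.prems] using Suc.prems by (intro add Suc.IH xy) auto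
  qed
  with T show ?thesis unfolding carrier_B by blast
qed

lemma B_sub_M: "T \<in> carrier B \<Longrightarrow> T \<in> carrier M"
  by (induction T rule: B_induct) (auto intro: M_zero_closed M_add_closed jp_M)

lemmas B_D = M_D[OF B_sub_M]

lemma B_add_closed: "\<lbrakk>S \<in> carrier B; T \<in> carrier B\<rbrakk> \<Longrightarrow> S \<oplus>\<^bsub>M\<^esub> T \<in> carrier B"
proof (induction S rule: B_induct)
  interpret M: abelian_monoid M by (rule abelian_monoid_M)
  case zero
  then show ?case by (simp add: B_sub_M)
next
  interpret M: abelian_monoid M by (rule abelian_monoid_M)
  case (add a b S)
  then show ?case by (subst M.a_assoc) (auto intro: B_sub_M jp_M B_jp_add)
qed

lemma jp_B: "\<lbrakk>a \<in> carrier R; b \<in> carrier R\<rbrakk> \<Longrightarrow> jp a b \<in> carrier B"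
proof -
  interpret M: abelian_monoid M by (rule abelian_monoid_M)
  assume "a \<in> carrier R" "b \<in> carrier R"
  then show ?thesis using B_jp_add[OF _ _ B_zero_closed, of a b] by (simp add: jp_M)
qed

lemma abelian_monoid_B: "abelian_monoid B"
proof -
  interpret M: abelian_monoid M by (rule abelian_monoid_M)
  show ?thesis
    by (rule abelian_monoidI)
       (auto simp: B_simps B_zero_closed B_add_closed B_sub_M M.a_assoc intro: M.a_comm)
qed

lemma B_finsum_apply:
  assumes "finite I" "\<And>i. i \<in> I \<Longrightarrow> f i \<in> carrier B" "z \<in> carrier R"
  shows "(\<Oplus>\<^bsub>B\<^esub>i\<in>I. f i) z = (\<Oplus>i\<in>I. f i z)"
proof (rule finsum_operators_apply[OF abelian_monoid_B])
  show "carrier B \<subseteq> carrier M" using B_sub_M by blast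
qed (use assms in \<open>simp_all add: B_simps fun_eq_iff\<close>)

lemma M_ext:
  assumes "S \<in> carrier M" "T \<in> carrier M" "\<And>z. z \<in> carrier R \<Longrightarrow> S z = T z"
  shows "S = T"
  using assms by (intro extensionalityI[of _ "carrier R"]) (auto simp: M_D)

lemma M_compose_closed:
  assumes "S \<in> carrier M" "T \<in> carrier M"
  shows "compose (carrier R) S T \<in> carrier M"
  by (rule M_I) (simp_all add: compose_extensional compose_eq M_D[OF assms(1)] M_D[OF assms(2)])

lemma M_smult_closed:
  assumes "T \<in> carrier M"
  shows "c \<odot>\<^bsub>M\<^esub> T \<in> carrier M"
  unfolding M_smult_apply
proof (rule M_I)
  fix x d assume x: "x \<in> carrier R"
  \<comment> \<open>Scalars commute because c acts as left multiplication by c times the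
    unit.\<close>
  have "c \<odot> (d \<odot> T x) = d \<odot> (c \<odot> T x)"
  proof -
    have "c \<odot> (d \<odot> T x) = c \<odot> (\<one> \<otimes> (d \<odot> T x))" using x M_D[OF assms] by simp
    also have "\<dots> = (c \<odot> \<one>) \<otimes> (d \<odot> T x)" using x M_D[OF assms] by (simp add: smult_assoc_left)
    also have "\<dots> = d \<odot> ((c \<odot> \<one>) \<otimes> T x)" using x M_D[OF assms] by (simp add: smult_assoc_right)
    also have "\<dots> = d \<odot> (c \<odot> T x)" using x M_D[OF assms] by (simp add: smult_assoc_left)
    finally show ?thesis .
  qed
  then show "(\<lambda>x\<in>carrier R. c \<odot> T x) (d \<odot> x) = d \<odot> (\<lambda>x\<in>carrier R. c \<odot> T x) x"
    using x M_D[OF assms] by simp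
qed (simp_all add: M_D[OF assms] smult_r_distr smult_assoc_left)

lemma B_smult_closed: "T \<in> carrier B \<Longrightarrow> c \<odot>\<^bsub>M\<^esub> T \<in> carrier B"
proof (induction T rule: B_induct)
  case zero
  have "c \<odot>\<^bsub>M\<^esub> \<zero>\<^bsub>M\<^esub> = \<zero>\<^bsub>M\<^esub>"
  proof (rule M_ext)
    show "(c \<odot>\<^bsub>M\<^esub> \<zero>\<^bsub>M\<^esub>) z = \<zero>\<^bsub>M\<^esub> z" if "z \<in> carrier R" for z
      using that by (simp add: M_smult_at M_zero_at)
  qed (intro M_smult_closed M_zero_closed)+
  then show ?case using B_zero_closed by simp
next
  case (add a b S)
  have "c \<odot>\<^bsub>M\<^esub> (jp a b \<oplus>\<^bsub>M\<^esub> S) = jp (c \<odot> a) b \<oplus>\<^bsub>M\<^esub> c \<odot>\<^bsub>M\<^esub> S"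
  proof (rule M_ext)
    fix z assume "z \<in> carrier R"
    then show "(c \<odot>\<^bsub>M\<^esub> (jp a b \<oplus>\<^bsub>M\<^esub> S)) z = (jp (c \<odot> a) b \<oplus>\<^bsub>M\<^esub> c \<odot>\<^bsub>M\<^esub> S) z"
      using add by (simp add: M_smult_at M_add_at jp_apply B_D smult_r_distr smult_assoc_left)
  qed (use add in \<open>auto intro!: M_smult_closed M_add_closed jp_M intro: B_sub_M\<close>)
  then show ?case using add by (simp add: B_jp_add)
qed

text \<open>The relation e_P z e_P = F(z) e_P gives (a e_P b)(x e_P y) = a F(b x) e_P y.\<close>

lemma B_compose_closed:
  assumes "S \<in> carrier B" "T \<in> carrier B"
  shows "compose (carrier R) S T \<in> carrier B"
proof -
  have jp: "compose (carrier R) (jp a b) T \<in> carrier B" if ab: "a \<in> carrier R" "b \<in> carrier R" for a b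
    using assms(2)
  proof (induction T rule: B_induct)
    case zero
    have "compose (carrier R) (jp a b) \<zero>\<^bsub>M\<^esub> = \<zero>\<^bsub>M\<^esub>"
    proof (rule M_ext)
      fix z assume "z \<in> carrier R"
      then show "compose (carrier R) (jp a b) \<zero>\<^bsub>M\<^esub> z = \<zero>\<^bsub>M\<^esub> z"
        using ab by (simp add: compose_eq M_zero_at jp_apply F_zero)
    qed (use ab in \<open>auto intro!: M_compose_closed jp_M M_zero_closed\<close>)
    then show ?case using B_zero_closed by simp
  next
    case (add x y S)
    have "compose (carrier R) (jp a b) (jp x y \<oplus>\<^bsub>M\<^esub> S)
        = jp (a \<otimes> F (b \<otimes> x)) y \<oplus>\<^bsub>M\<^esub> compose (carrier R) (jp a b) S"
    proof (rule M_ext)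
      fix z assume z: "z \<in> carrier R"
      have "jp a b (x \<otimes> F (y \<otimes> z)) = a \<otimes> F (b \<otimes> (x \<otimes> F (y \<otimes> z)))"
        using ab add z by (simp add: jp_apply)
      also have "b \<otimes> (x \<otimes> F (y \<otimes> z)) = (b \<otimes> x) \<otimes> F (y \<otimes> z)"
        using ab add z by (simp add: m_assoc)
      also have "a \<otimes> F (b \<otimes> x \<otimes> F (y \<otimes> z)) = a \<otimes> (F (b \<otimes> x) \<otimes> F (y \<otimes> z))"
        using ab add z by (simp add: F_mod F_mem)
      also have "\<dots> = a \<otimes> F (b \<otimes> x) \<otimes> F (y \<otimes> z)"
        using ab add z by (simp add: m_assoc)
      finally have "jp a b (x \<otimes> F (y \<otimes> z)) = a \<otimes> F (b \<otimes> x) \<otimes> F (y \<otimes> z)" .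
      then show "compose (carrier R) (jp a b) (jp x y \<oplus>\<^bsub>M\<^esub> S) z
          = (jp (a \<otimes> F (b \<otimes> x)) y \<oplus>\<^bsub>M\<^esub> compose (carrier R) (jp a b) S) z"
        using ab add z by (simp add: compose_eq M_add_at jp_apply[of x y] jp_apply[of "a \<otimes> F (b \<otimes> x)" y]
            M_D(3)[OF jp_M[OF ab]] B_D)
    qed (use ab add in \<open>auto intro!: M_compose_closed M_add_closed jp_M intro: B_sub_M\<close>)
    then show ?case using ab add by (simp add: B_jp_add)
  qed
  show ?thesis using assms(1)
  proof (induction S rule: B_induct)
    case zero
    have "compose (carrier R) \<zero>\<^bsub>M\<^esub> T = \<zero>\<^bsub>M\<^esub>"
      by (rule M_ext) (use assms(2) in \<open>auto intro!: M_compose_closed M_zero_closed intro: B_sub_M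
          simp: compose_eq M_zero_at B_D\<close>)
    then show ?case using B_zero_closed by simp
  next
    case (add a b S)
    have "compose (carrier R) (jp a b \<oplus>\<^bsub>M\<^esub> S) T
        = compose (carrier R) (jp a b) T \<oplus>\<^bsub>M\<^esub> compose (carrier R) S T"
      by (rule M_ext) (use add assms(2) in \<open>auto intro!: M_compose_closed M_add_closed jp_M intro: B_sub_M
          simp: compose_eq M_add_at B_D\<close>)
    then show ?case using add jp by (simp add: B_add_closed)
  qed
qed

text \<open>The reconstruction formula of a quasi-basis presents the identity operator as a sum of
  the operators u_i e_P v_i.\<close>

lemma one_B:
  fixes n :: nat
  assumes "u \<in> {..<n} \<rightarrow> carrier R" "v \<in> {..<n} \<rightarrow> carrier R"
    and "\<And>a. a \<in> carrier R \<Longrightarrow> a = (\<Oplus>i\<in>{..<n}. u i \<otimes> F (v i \<otimes> a))"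
  shows "(\<lambda>x\<in>carrier R. x) \<in> carrier B"
proof -
  have B: "jones_sum R P F n u v \<in> carrier B" using assms unfolding carrier_B by blast
  have "jones_sum R P F n u v = (\<lambda>x\<in>carrier R. x)"
  proof (rule M_ext)
    show "(\<lambda>x\<in>carrier R. x) \<in> carrier M" by (rule M_I) simp_all
    show "jones_sum R P F n u v z = (\<lambda>x\<in>carrier R. x) z" if "z \<in> carrier R" for z
      using jones_sum_apply[OF assms(1,2) that] assms(3)[OF that] that by simp
  qed (rule B_sub_M[OF B])
  with B show ?thesis by simp
qed

lemma complex_semiring_B:
  assumes one: "(\<lambda>x\<in>carrier R. x) \<in> carrier B"
  shows "complex_semiring B"
proof -
  interpret AM: abelian_monoid B by (rule abelian_monoid_B)
  note D = B_D
  show ?thesis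
  proof (unfold_locales)
    fix S T U assume STU: "S \<in> carrier B" "T \<in> carrier B" "U \<in> carrier B"
    show "S \<otimes>\<^bsub>B\<^esub> T \<otimes>\<^bsub>B\<^esub> U = S \<otimes>\<^bsub>B\<^esub> (T \<otimes>\<^bsub>B\<^esub> U)"
      unfolding B_simps by (rule M_ext)
        (use STU in \<open>auto intro!: M_compose_closed intro: B_sub_M simp: compose_eq D\<close>)
    show "(S \<oplus>\<^bsub>B\<^esub> T) \<otimes>\<^bsub>B\<^esub> U = S \<otimes>\<^bsub>B\<^esub> U \<oplus>\<^bsub>B\<^esub> T \<otimes>\<^bsub>B\<^esub> U"
      unfolding B_simps by (rule M_ext)
        (use STU in \<open>auto intro!: M_compose_closed M_add_closed intro: B_sub_M simp: compose_eq D M_add_at\<close>)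
    show "U \<otimes>\<^bsub>B\<^esub> (S \<oplus>\<^bsub>B\<^esub> T) = U \<otimes>\<^bsub>B\<^esub> S \<oplus>\<^bsub>B\<^esub> U \<otimes>\<^bsub>B\<^esub> T"
      unfolding B_simps by (rule M_ext)
        (use STU in \<open>auto intro!: M_compose_closed M_add_closed intro: B_sub_M simp: compose_eq D M_add_at\<close>)
  next
    fix S T assume ST: "S \<in> carrier B" "T \<in> carrier B"
    show "S \<otimes>\<^bsub>B\<^esub> T \<in> carrier B" using ST by (simp add: B_simps B_compose_closed)
    fix c
    show "c \<odot>\<^bsub>B\<^esub> (S \<oplus>\<^bsub>B\<^esub> T) = c \<odot>\<^bsub>B\<^esub> S \<oplus>\<^bsub>B\<^esub> c \<odot>\<^bsub>B\<^esub> T"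
      unfolding B_simps by (rule M_ext)
        (use ST in \<open>auto intro!: M_smult_closed M_add_closed intro: B_sub_M simp: D M_add_at M_smult_at smult_r_distr\<close>)
    show "(c \<odot>\<^bsub>B\<^esub> S) \<otimes>\<^bsub>B\<^esub> T = c \<odot>\<^bsub>B\<^esub> (S \<otimes>\<^bsub>B\<^esub> T)"
      unfolding B_simps by (rule M_ext)
        (use ST in \<open>auto intro!: M_smult_closed M_compose_closed intro: B_sub_M simp: D compose_eq M_smult_at\<close>)
    show "S \<otimes>\<^bsub>B\<^esub> (c \<odot>\<^bsub>B\<^esub> T) = c \<odot>\<^bsub>B\<^esub> (S \<otimes>\<^bsub>B\<^esub> T)"
      unfolding B_simps by (rule M_ext)
        (use ST in \<open>auto intro!: M_smult_closed M_compose_closed intro: B_sub_M simp: D compose_eq M_smult_at\<close>)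
  next
    fix S assume S: "S \<in> carrier B"
    note one_M = B_sub_M[OF one]
    show "\<one>\<^bsub>B\<^esub> \<otimes>\<^bsub>B\<^esub> S = S" "S \<otimes>\<^bsub>B\<^esub> \<one>\<^bsub>B\<^esub> = S"
      unfolding B_simps using S one_M
      by (auto intro!: M_ext M_compose_closed intro: B_sub_M simp: compose_eq D)
    show "\<zero>\<^bsub>B\<^esub> \<otimes>\<^bsub>B\<^esub> S = \<zero>\<^bsub>B\<^esub>"
      unfolding B_simps by (rule M_ext)
        (use S in \<open>auto intro!: M_compose_closed M_zero_closed intro: B_sub_M simp: compose_eq D M_zero_at\<close>)
    have "S \<zero> = \<zero>" using S by (intro M_maps_zero B_sub_M)
    then show "S \<otimes>\<^bsub>B\<^esub> \<zero>\<^bsub>B\<^esub> = \<zero>\<^bsub>B\<^esub>"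
      unfolding B_simps by (intro M_ext)
        (use S in \<open>auto intro!: M_compose_closed M_zero_closed intro: B_sub_M simp: compose_eq D M_zero_at\<close>)
    show "c \<odot>\<^bsub>B\<^esub> S \<in> carrier B" for c using S by (simp add: B_simps B_smult_closed)
  qed (use one in \<open>simp add: B_simps\<close>)
qed

end


section \<open>Depth two and fixed point algebras\<close>

context galois_basis
begin

section \<open>The averaging expectation of A onto P and its index\<close>

abbreviation "A \<equiv> Fix H"
abbreviation "P \<equiv> Fix (carrier G)"
abbreviation "R \<equiv> algebra_of A"
abbreviation "F \<equiv> group_average G \<alpha>"
abbreviation "N \<equiv> real (card (carrier G))"

lemma R_simps [simp]:
  "carrier R = A" "a \<otimes>\<^bsub>R\<^esub> b = a * b" "\<one>\<^bsub>R\<^esub> = 1" "\<zero>\<^bsub>R\<^esub> = 0" "a \<oplus>\<^bsub>R\<^esub> b = a + b"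
  "c \<odot>\<^bsub>R\<^esub> a = scaleC c a"
  by (simp_all add: algebra_of_def)

lemma N_pos: "N > 0"
  using fin one_closed by (auto simp: card_gt_0_iff)

lemma F_eq: "F a = (1 / N) *\<^sub>R tr (carrier G) a"
  using scaleC_of_real[of "1 / N"] by (simp add: group_average_def)

lemma F_P: "F a \<in> P"
  unfolding F_eq by (rule fix_closed(6)[OF order_refl tr_P])

lemma F_A: "F a \<in> A"
  using F_P P_sub by blast

lemma F_linear: "F (a + b) = F a + F b" "F (scaleC c a) = scaleC c (F a)" "F (r *\<^sub>R a) = r *\<^sub>R F a"
  by (simp_all add: group_average_def act_add act_scaleC act_scaleR sum.distrib scaleC_add_right
      scaleC_scaleC scaleR_scaleC mult.commute flip: scaleC_sum_right)

lemma F_sum: "F (\<Sum>i\<in>I. f i) = (\<Sum>i\<in>I. F (f i))"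
proof (induction I rule: infinite_finite_induct)
  case (insert i I)
  then show ?case by (simp add: F_linear)
qed (simp_all add: group_average_def)

lemma F_bimodule: "p \<in> P \<Longrightarrow> F (a * p) = F a * p" "p \<in> P \<Longrightarrow> F (p * a) = p * F a"
  by (simp_all add: F_eq act_mult fixD sum_distrib_right sum_distrib_left)

lemma F_reconstruct:
  assumes "a \<in> A"
  shows "(\<Sum>i<n. x i * F (y i * a)) = (1 / N) *\<^sub>R a" "(\<Sum>i<n. F (a * x i) * y i) = (1 / N) *\<^sub>R a"
  using reconstruct_left[OF assms] reconstruct_right[OF assms]
  by (simp_all add: F_eq flip: scaleR_sum_right)

lemma ring_algebra: "ring R"
proof (rule ringI)
  show "abelian_group R"
  proof (rule abelian_groupI)
    fix a assume "a \<in> carrier R"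
    then show "\<exists>b\<in>carrier R. b \<oplus>\<^bsub>R\<^esub> a = \<zero>\<^bsub>R\<^esub>"
      using A_closed(6)[of a "- 1"] by (intro bexI[of _ "- a"]) simp_all
  qed (simp_all add: A_closed add_ac)
  show "monoid R" by (rule monoidI) (simp_all add: A_closed mult.assoc)
qed (simp_all add: A_closed algebra_simps)

lemma finsum_algebra:
  assumes "finite I" "\<And>i. i \<in> I \<Longrightarrow> f i \<in> A"
  shows "(\<Oplus>\<^bsub>R\<^esub>i\<in>I. f i) = (\<Sum>i\<in>I. f i)"
proof -
  interpret R: ring R by (rule ring_algebra)
  show ?thesis using assms
    by (induction I rule: finite_induct) (simp_all add: R.finsum_empty R.finsum_insert)
qed

lemma finsum_algebra_ball:
  "\<lbrakk>finite I; \<forall>i\<in>I. f i \<in> A\<rbrakk> \<Longrightarrow> (\<Oplus>\<^bsub>R\<^esub>i\<in>I. f i) = (\<Sum>i\<in>I. f i)"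
  by (rule finsum_algebra) auto

lemma complex_semiring_algebra: "complex_semiring R"
proof -
  interpret R: ring R by (rule ring_algebra)
  show ?thesis
    by unfold_locales
       (simp_all add: A_closed scaleC_add_right mult_scaleC_left mult_scaleC_right)
qed

lemma module_expectation_F: "module_expectation R P F"
  by (intro module_expectation.intro complex_semiring_algebra module_expectation_axioms.intro)
     (use P_sub in \<open>auto simp: F_P F_linear F_bimodule fix_closed\<close>)

sublocale E1: module_expectation R P F
  by (rule module_expectation_F)

lemma quasi_basis_F: "quasi_basis R F n (\<lambda>i. N *\<^sub>R x i) y"
  using N_pos unfolding quasi_basis_def
  by (simp add: Pi_iff A_closed x_fix y_fix finsum_algebra_ball F_A F_linear F_reconstruct
      flip: scaleR_sum_right)

text \<open>For uniqueness, v_k in the sum of the u_k v_k is expanded in the Galois quasi-basis, and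
  the sum over k is then contracted by the reconstruction formula of (u, v). The value is the group
  index [G:H].\<close>

lemma expectation_index_F: "expectation_index R F = (N / real (card H)) *\<^sub>R 1"
  unfolding expectation_index_def
proof (rule the_equality)
  have sum: "(\<Oplus>\<^bsub>R\<^esub>i\<in>{..<n}. (N *\<^sub>R x i) \<otimes>\<^bsub>R\<^esub> y i) = (N / real (card H)) *\<^sub>R 1"
    using xy'[OF one_closed] subgroup.one_closed[OF H]
    by (simp add: finsum_algebra_ball A_closed x_fix y_fix flip: scaleR_sum_right)
  then show "\<exists>m u v. quasi_basis R F m u v \<and>
      (N / real (card H)) *\<^sub>R 1 = (\<Oplus>\<^bsub>R\<^esub>i\<in>{..<m}. u i \<otimes>\<^bsub>R\<^esub> v i)"
    using quasi_basis_F by metis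
  fix z assume "\<exists>m u v. quasi_basis R F m u v \<and> z = (\<Oplus>\<^bsub>R\<^esub>i\<in>{..<m}. u i \<otimes>\<^bsub>R\<^esub> v i)"
  then obtain m u v where q: "quasi_basis R F m u v"
    and z: "z = (\<Oplus>\<^bsub>R\<^esub>i\<in>{..<m}. u i \<otimes>\<^bsub>R\<^esub> v i)" by blast
  have uv: "u i \<in> A" "v i \<in> A" if "i < m" for i
    using q that by (auto simp: quasi_basis_def)
  have "z = (\<Sum>k<m. u k * v k)" using z uv by (simp add: finsum_algebra_ball A_closed)
  also have "\<dots> = (\<Sum>k<m. u k * (\<Sum>i<n. F (v k * (N *\<^sub>R x i)) * y i))"
    using uv N_pos by (simp add: F_linear F_reconstruct flip: scaleR_sum_right)
  also have "\<dots> = (\<Sum>i<n. (\<Sum>k<m. u k * F (v k * (N *\<^sub>R x i))) * y i)"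
    by (subst sum_distrib_right, subst sum.swap) (simp add: sum_distrib_left mult.assoc)
  also have "\<dots> = (\<Sum>i<n. (N *\<^sub>R x i) * y i)"
  proof (rule sum.cong)
    fix i assume "i \<in> {..<n}"
    have "N *\<^sub>R x i = (\<Oplus>\<^bsub>R\<^esub>k\<in>{..<m}. u k \<otimes>\<^bsub>R\<^esub> F (v k \<otimes>\<^bsub>R\<^esub> (N *\<^sub>R x i)))"
      using q A_closed(6)[OF x_fix, of N i] unfolding quasi_basis_def by fastforce
    also have "\<dots> = (\<Sum>k<m. u k * F (v k * (N *\<^sub>R x i)))"
      using uv by (simp add: finsum_algebra_ball A_closed F_A)
    finally have "N *\<^sub>R x i = \<dots>" .
    then show "(\<Sum>k<m. u k * F (v k * (N *\<^sub>R x i))) * y i = (N *\<^sub>R x i) * y i"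
      by (rule arg_cong[OF sym])
  qed simp
  also have "\<dots> = (N / real (card H)) *\<^sub>R 1"
    using sum by (simp add: finsum_algebra_ball A_closed x_fix y_fix)
  finally show "z = (N / real (card H)) *\<^sub>R 1" .
qed

lemma inv_index: "inv\<^bsub>R\<^esub> (expectation_index R F) = (real (card H) / N) *\<^sub>R 1"
proof -
  show ?thesis unfolding expectation_index_F
    by (rule E1.inv_unique'[symmetric]) (use N_pos card_H in \<open>simp_all add: A_closed\<close>)
qed

section \<open>The first basic construction and its dual expectation\<close>

abbreviation "A1 \<equiv> basic_construction R P F"
abbreviation "dual \<equiv> dual_expectation R P F"

lemmas A1_D = E1.B_D[simplified]
  and A1_compose = E1.B_compose_closed[simplified]

lemma A1_sum:
  assumes T: "T \<in> carrier A1" and f: "\<And>i. f i \<in> A"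
  shows "T (\<Sum>i\<in>I. f i) = (\<Sum>i\<in>I. T (f i))"
proof (induction I rule: infinite_finite_induct)
  case (insert i I)
  then show ?case using A1_D(3)[OF T] f by (simp add: fix_sum[OF H_sub])
qed (use E1.M_maps_zero[OF E1.B_sub_M[OF T]] in simp_all)

lemma A1_scaleR: "\<lbrakk>T \<in> carrier A1; a \<in> A\<rbrakk> \<Longrightarrow> T (r *\<^sub>R a) = r *\<^sub>R T a"
  using A1_D(4)[of T a "of_real r"] by (simp add: scaleC_of_real)

lemma jp_apply: "\<lbrakk>a \<in> A; b \<in> A; z \<in> A\<rbrakk> \<Longrightarrow> E1.jp a b z = a * F (b * z)"
  using E1.jp_apply by simp

text \<open>The right-hand side depends on the operator alone, so it settles independence of the
  presentation. For T = a e_P b the sum of the T(x_j) y_j is ab/|G|; the factor |H| turns this into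
  ab divided by the index.\<close>

lemma dual_eq:
  assumes T: "T \<in> carrier A1"
  shows "dual T = real (card H) *\<^sub>R (\<Sum>j<n. T (x j) * y j)"
proof -
  have eq: "inv\<^bsub>R\<^esub> (expectation_index R F) \<otimes>\<^bsub>R\<^esub> (\<Oplus>\<^bsub>R\<^esub>i\<in>{..<m}. a i \<otimes>\<^bsub>R\<^esub> b i)
      = real (card H) *\<^sub>R (\<Sum>j<n. T (x j) * y j)"
    if ab: "a \<in> {..<m} \<rightarrow> carrier R" "b \<in> {..<m} \<rightarrow> carrier R" and T: "T = jones_sum R P F m a b" for m :: nat and a b
  proof -
    have m: "a i \<in> A" "b i \<in> A" if "i < m" for i using ab that by auto
    have "(\<Sum>j<n. T (x j) * y j) = (\<Sum>j<n. (\<Sum>i<m. a i * F (b i * x j)) * y j)"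
      using E1.jones_sum_apply[OF ab] m by (simp add: T x_fix finsum_algebra_ball A_closed F_A)
    also have "\<dots> = (\<Sum>i<m. a i * (\<Sum>j<n. F (b i * x j) * y j))"
      by (subst sum_distrib_right, subst sum.swap) (simp add: sum_distrib_left mult.assoc)
    also have "\<dots> = (1 / N) *\<^sub>R (\<Sum>i<m. a i * b i)"
      using m by (simp add: F_reconstruct scaleR_sum_right)
    finally show ?thesis
      using m by (simp add: inv_index finsum_algebra_ball A_closed)
  qed
  from T obtain m a b where mab: "T = jones_sum R P F m a b" "a \<in> {..<m} \<rightarrow> carrier R" "b \<in> {..<m} \<rightarrow> carrier R"
    unfolding E1.carrier_B by blast
  show ?thesis unfolding dual_expectation_def
  proof (rule the_equality)
    show "\<exists>m a b. a \<in> {..<m} \<rightarrow> carrier R \<and> b \<in> {..<m} \<rightarrow> carrier R \<and> T = jones_sum R P F m a b \<and>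
        real (card H) *\<^sub>R (\<Sum>j<n. T (x j) * y j) =
          inv\<^bsub>R\<^esub> (expectation_index R F) \<otimes>\<^bsub>R\<^esub> (\<Oplus>\<^bsub>R\<^esub>i\<in>{..<m}. a i \<otimes>\<^bsub>R\<^esub> b i)"
      by (intro exI[of _ m] exI[of _ a] exI[of _ b] conjI mab eq[OF mab(2,3,1), symmetric])
  qed (elim exE conjE, simp only: eq)
qed

lemma dual_closed: "T \<in> carrier A1 \<Longrightarrow> dual T \<in> A"
  by (simp add: dual_eq A_closed fix_sum[OF H_sub] y_fix x_fix A1_D(2))

lemma left_mult_apply: "z \<in> A \<Longrightarrow> left_mult R a z = a * z"
  by (simp add: left_mult_def)

text \<open>Left multiplication by a is a times the presentation of the identity by the quasi-basis;
  a = 1 gives the unit of A_1.\<close>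

lemma left_mult_A1:
  assumes a: "a \<in> A"
  shows "left_mult R a \<in> carrier A1"
proof -
  have m: "(\<lambda>i. a * (N *\<^sub>R x i)) \<in> {..<n} \<rightarrow> carrier R" "y \<in> {..<n} \<rightarrow> carrier R"
    using a by (simp_all add: A_closed x_fix y_fix)
  have "left_mult R a = jones_sum R P F n (\<lambda>i. a * (N *\<^sub>R x i)) y"
  proof (rule extensionalityI[of _ "carrier R"])
    show "jones_sum R P F n (\<lambda>i. a * (N *\<^sub>R x i)) y \<in> extensional (carrier R)"
      using m by (intro E1.B_D(1)) (auto simp: E1.carrier_B)
    fix z assume z: "z \<in> carrier R"
    have "(\<Sum>i<n. (a * (N *\<^sub>R x i)) * F (y i * z)) = N *\<^sub>R (a * (\<Sum>i<n. x i * F (y i * z)))"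
      by (simp add: sum_distrib_left scaleR_sum_right mult.assoc)
    then show "left_mult R a z = jones_sum R P F n (\<lambda>i. a * (N *\<^sub>R x i)) y z"
      using z N_pos a E1.jones_sum_apply[OF m z]
      by (simp add: left_mult_apply F_reconstruct finsum_algebra_ball A_closed x_fix y_fix F_A)
  qed (simp add: left_mult_def)
  with m show ?thesis by (auto simp: E1.carrier_B)
qed

lemma one_A1: "(\<lambda>z\<in>carrier R. z) \<in> carrier A1"
proof -
  have "(\<lambda>z\<in>carrier R. z) = left_mult R 1" by (auto simp: left_mult_def)
  then show ?thesis using left_mult_A1 A_closed(2) by simp
qed

abbreviation "E \<equiv> (\<lambda>T. left_mult R (dual T))"

text \<open>Right A-linearity of the dual expectation is the transfer identity for the pair T and
  identity, balanced because T is P-linear.\<close>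

lemma dual_right_mult:
  assumes T: "T \<in> carrier A1" and a: "a \<in> A"
  shows "dual (compose (carrier R) T (left_mult R a)) = dual T * a"
proof -
  have Ta: "compose (carrier R) T (left_mult R a) \<in> carrier A1"
    by (intro E1.B_compose_closed T left_mult_A1 a)
  have "(\<Sum>j<n. T (x j) * (y j * a)) = (\<Sum>j<n. T (a * x j) * y j)"
  proof (rule balanced_transfer)
    fix b c p assume "b \<in> A" "c \<in> A" "p \<in> P"
    then show "T (b * p) * c = T b * (p * c)" using A1_D(5)[OF T] by (simp add: mult.assoc)
  qed (use A1_D(3)[OF T] a in simp_all)
  then have "(\<Sum>j<n. compose (carrier R) T (left_mult R a) (x j) * y j) = (\<Sum>j<n. T (x j) * y j) * a"
    by (simp add: compose_eq x_fix left_mult_apply sum_distrib_right mult.assoc)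
  then show ?thesis unfolding dual_eq[OF T] dual_eq[OF Ta] by simp
qed

lemma module_expectation_E: "module_expectation A1 (left_mult R ` carrier R) E"
proof (intro module_expectation.intro module_expectation_axioms.intro)
  show "complex_semiring A1" by (rule E1.complex_semiring_B[OF one_A1])
  show "left_mult R ` carrier R \<subseteq> carrier A1" using left_mult_A1 by auto
  have "\<zero>\<^bsub>A1\<^esub> = left_mult R 0"
    by (rule ext) (simp add: E1.B_simps E1.M_zero_apply left_mult_def)
  then show "\<zero>\<^bsub>A1\<^esub> \<in> left_mult R ` carrier R" using A_closed(1) by simp
next
  fix T assume T: "T \<in> carrier A1"
  show "E T \<in> left_mult R ` carrier R" using dual_closed[OF T] by simp
  fix c
  have "dual (c \<odot>\<^bsub>A1\<^esub> T) = scaleC c (dual T)"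
  proof -
    have "c \<odot>\<^bsub>A1\<^esub> T \<in> carrier A1" using T by (simp add: E1.B_simps E1.B_smult_closed)
    then show ?thesis
      using T by (simp add: dual_eq E1.B_simps E1.M_smult_at x_fix scaleR_scaleC scaleC_scaleC
          scaleC_sum_right mult_scaleC_left mult.commute)
  qed
  then show "E (c \<odot>\<^bsub>A1\<^esub> T) = c \<odot>\<^bsub>A1\<^esub> E T"
    by (auto simp: left_mult_def E1.B_simps E1.M_smult_apply mult_scaleC_left)
  fix S assume S: "S \<in> carrier A1"
  have "dual (T \<oplus>\<^bsub>A1\<^esub> S) = dual T + dual S"
  proof -
    have "T \<oplus>\<^bsub>A1\<^esub> S \<in> carrier A1" using T S by (simp add: E1.B_simps E1.B_add_closed)
    then show ?thesis
      using T S by (simp add: dual_eq E1.B_simps E1.M_add_at x_fix distrib_right sum.distrib scaleR_add_right)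
  qed
  then show "E (T \<oplus>\<^bsub>A1\<^esub> S) = E T \<oplus>\<^bsub>A1\<^esub> E S"
    by (auto simp: left_mult_def E1.B_simps E1.M_add_apply distrib_right)
next
  fix T L assume T: "T \<in> carrier A1" and "L \<in> left_mult R ` carrier R"
  then obtain a where a: "a \<in> A" "L = left_mult R a" by auto
  show "E (T \<otimes>\<^bsub>A1\<^esub> L) = E T \<otimes>\<^bsub>A1\<^esub> L"
    using a dual_right_mult[OF T a(1)]
    by (auto simp: E1.B_simps left_mult_def compose_def mult.assoc A_closed)
qed

sublocale E2: module_expectation A1 "left_mult R ` carrier R" E
  by (rule module_expectation_E)

section \<open>The second basic construction and its unit\<close>

abbreviation "A2 \<equiv> basic_construction A1 (left_mult R ` carrier R) E"

lemma dual_jp_compose: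
  assumes T: "T \<in> carrier A1" and b: "b \<in> A"
  shows "dual (compose (carrier R) (E1.jp 1 b) T) = real (card H) *\<^sub>R (\<Sum>j<n. F (b * T (x j)) * y j)"
proof -
  have "compose (carrier R) (E1.jp 1 b) T \<in> carrier A1"
    by (intro E1.B_compose_closed E1.jp_B T) (use b in \<open>simp_all add: A_closed\<close>)
  then show ?thesis
    using T b by (simp add: dual_eq compose_eq x_fix jp_apply A_closed A1_D(2))
qed

text \<open>By P-linearity T absorbs the left factor: T a e_P w = T(a) e_P w.\<close>

lemma dual_compose_jp:
  assumes T: "T \<in> carrier A1" and a: "a \<in> A" and w: "w \<in> A"
  shows "dual (compose (carrier R) T (E1.jp a w)) = (real (card H) / N) *\<^sub>R (T a * w)"
proof -
  have "compose (carrier R) T (E1.jp a w) \<in> carrier A1"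
    by (intro E1.B_compose_closed E1.jp_B T) (use a w in simp_all)
  then have "dual (compose (carrier R) T (E1.jp a w)) = real (card H) *\<^sub>R (\<Sum>j<n. T a * (F (w * x j) * y j))"
    using a w A1_D(5)[OF T a F_P] by (simp add: dual_eq compose_eq x_fix jp_apply mult.assoc)
  also have "\<dots> = (real (card H) / N) *\<^sub>R (T a * w)"
    using w by (simp add: F_reconstruct flip: sum_distrib_left)
  finally show ?thesis .
qed

lemma one_A2: "(\<lambda>T\<in>carrier A1. T) \<in> carrier A2"
proof (rule E2.one_B)
  \<comment> \<open>The dual expectation contributes |H| and each of the two reconstructions, over i
    and over j, contributes 1/|G|; s makes the product 1. The pairs X_i = s x_i e_P and Y_i = e_P
    y_i are then half of a quasi-basis for E.\<close>
  define s where "s = N\<^sup>2 / real (card H)"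
  define X where "X i = E1.jp (s *\<^sub>R x i) 1" for i
  define Y where "Y i = E1.jp 1 (y i)" for i
  have X: "X i \<in> carrier A1" and Y: "Y i \<in> carrier A1" for i
    unfolding X_def Y_def by (intro E1.jp_B; simp add: A_closed x_fix y_fix)+
  show "X \<in> {..<n} \<rightarrow> carrier A1" "Y \<in> {..<n} \<rightarrow> carrier A1" using X Y by auto
  fix T assume T: "T \<in> carrier A1"
  have YT: "Y i \<otimes>\<^bsub>A1\<^esub> T \<in> carrier A1" for i
    using Y T by (simp add: E1.B_simps A1_compose)
  have summand: "X i \<otimes>\<^bsub>A1\<^esub> E (Y i \<otimes>\<^bsub>A1\<^esub> T) \<in> carrier A1" for i
    using X left_mult_A1[OF dual_closed[OF YT]] by (simp add: E1.B_simps A1_compose)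
  show "T = (\<Oplus>\<^bsub>A1\<^esub>i\<in>{..<n}. X i \<otimes>\<^bsub>A1\<^esub> E (Y i \<otimes>\<^bsub>A1\<^esub> T))"
  proof (rule E1.M_ext)
    show "T \<in> carrier E1.M" by (rule E1.B_sub_M[OF T])
    show "(\<Oplus>\<^bsub>A1\<^esub>i\<in>{..<n}. X i \<otimes>\<^bsub>A1\<^esub> E (Y i \<otimes>\<^bsub>A1\<^esub> T)) \<in> carrier E1.M"
      by (rule E1.B_sub_M, rule E2.finsum_closed) (use summand in auto)
    fix z assume "z \<in> carrier R"
    then have z: "z \<in> A" by simp
    have TA: "T b \<in> A" if "b \<in> A" for b using A1_D(2)[OF T that] .
    have val: "(X i \<otimes>\<^bsub>A1\<^esub> E (Y i \<otimes>\<^bsub>A1\<^esub> T)) z = N\<^sup>2 *\<^sub>R (\<Sum>j<n. x i * F (y i * T (x j)) * F (y j * z))" for i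
    proof -
      have dual_YT: "dual (Y i \<otimes>\<^bsub>A1\<^esub> T) = real (card H) *\<^sub>R (\<Sum>j<n. F (y i * T (x j)) * y j)"
        unfolding Y_def E1.B_simps by (rule dual_jp_compose[OF T y_fix])
      have "(X i \<otimes>\<^bsub>A1\<^esub> E (Y i \<otimes>\<^bsub>A1\<^esub> T)) z = X i (dual (Y i \<otimes>\<^bsub>A1\<^esub> T) * z)"
        using z by (simp add: E1.B_simps compose_eq left_mult_apply)
      also have "\<dots> = (s *\<^sub>R x i) * F (dual (Y i \<otimes>\<^bsub>A1\<^esub> T) * z)"
        using z dual_closed[OF YT] by (simp add: X_def jp_apply A_closed x_fix)
      also have "F (dual (Y i \<otimes>\<^bsub>A1\<^esub> T) * z) = real (card H) *\<^sub>R (\<Sum>j<n. F (y i * T (x j)) * F (y j * z))"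
        unfolding dual_YT by (simp add: sum_distrib_right F_linear F_sum mult.assoc F_bimodule F_P)
      also have "(s *\<^sub>R x i) * \<dots> = N\<^sup>2 *\<^sub>R (\<Sum>j<n. x i * F (y i * T (x j)) * F (y j * z))"
        using card_H by (simp add: s_def mult.assoc flip: sum_distrib_left)
      finally show ?thesis .
    qed
    have "(\<Oplus>\<^bsub>A1\<^esub>i\<in>{..<n}. X i \<otimes>\<^bsub>A1\<^esub> E (Y i \<otimes>\<^bsub>A1\<^esub> T)) z
        = (\<Oplus>\<^bsub>R\<^esub>i\<in>{..<n}. (X i \<otimes>\<^bsub>A1\<^esub> E (Y i \<otimes>\<^bsub>A1\<^esub> T)) z)"
      by (rule E1.B_finsum_apply) (use summand z in simp_all)
    also have "\<dots> = (\<Sum>i<n. N\<^sup>2 *\<^sub>R (\<Sum>j<n. x i * F (y i * T (x j)) * F (y j * z)))"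
      unfolding val
      by (rule finsum_algebra) (simp_all add: A_closed fix_sum[OF H_sub] x_fix F_A)
    also have "\<dots> = N\<^sup>2 *\<^sub>R (\<Sum>j<n. (\<Sum>i<n. x i * F (y i * T (x j))) * F (y j * z))"
      unfolding sum_distrib_right scaleR_sum_right by (rule sum.swap)
    also have "\<dots> = N *\<^sub>R (\<Sum>j<n. T (x j) * F (y j * z))"
      using N_pos by (simp add: F_reconstruct TA x_fix power2_eq_square flip: scaleR_sum_right)
    also have "(\<Sum>j<n. T (x j) * F (y j * z)) = T (\<Sum>j<n. x j * F (y j * z))"
      using A1_sum[OF T, of "\<lambda>j. x j * F (y j * z)" "{..<n}"] A1_D(5)[OF T x_fix F_P]
      by (simp add: A_closed x_fix F_A)
    also have "N *\<^sub>R \<dots> = T z" using N_pos z A1_scaleR[OF T] by (simp add: F_reconstruct)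
    finally show "T z = (\<Oplus>\<^bsub>A1\<^esub>i\<in>{..<n}. X i \<otimes>\<^bsub>A1\<^esub> E (Y i \<otimes>\<^bsub>A1\<^esub> T)) z" by simp
  qed
qed

text \<open>The sum extracts from X the part carried by the coset gH, up to the factor 1/|H|. Its
  coefficient e lies in Q; it commutes with P because X does and \<alpha>_g fixes P, so it is
  scalar.\<close>

lemma commutant_coefficient:
  assumes X: "X \<in> relative_commutant A1 (left_mult R ` P)" and g: "g \<in> carrier G"
  obtains l where "\<And>a. a \<in> A \<Longrightarrow> (\<Sum>i<n. X (a * x i) * \<alpha> g (y i)) = scaleC l (\<alpha> g a)"
proof -
  have XA: "X \<in> carrier A1" using X by (simp add: relative_commutant_def)
  have PA: "p \<in> A" if "p \<in> P" for p using that P_sub by blast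
  define e where "e = (\<Sum>i<n. X (x i) * \<alpha> g (y i))"
  have tr: "(\<Sum>i<n. X (a * x i) * \<alpha> g (y i)) = e * \<alpha> g a" if a: "a \<in> A" for a
  proof -
    have "(\<Sum>i<n. X (x i) * \<alpha> g (y i * a)) = (\<Sum>i<n. X (a * x i) * \<alpha> g (y i))"
    proof (rule balanced_transfer)
      fix b c p assume "b \<in> A" "c \<in> A" "p \<in> P"
      then show "X (b * p) * \<alpha> g c = X b * \<alpha> g (p * c)"
        using A1_D(5)[OF XA] g by (simp add: act_mult mult.assoc fixD)
    qed (use A1_D(3)[OF XA] a g in \<open>simp_all add: act_add\<close>)
    then show ?thesis using g by (simp add: e_def act_mult sum_distrib_right mult.assoc)
  qed
  have left: "X (p * b) = p * X b" if p: "p \<in> P" and b: "b \<in> A" for p b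
  proof -
    have "compose (carrier R) (left_mult R p) X b = compose (carrier R) X (left_mult R p) b"
      using X p by (simp add: relative_commutant_def E1.B_simps)
    then show ?thesis using b A1_D(2)[OF XA b] by (simp add: compose_eq left_mult_apply)
  qed
  have "e * p = p * e" if p: "p \<in> P" for p
  proof -
    have "p * e = (\<Sum>i<n. X (p * x i) * \<alpha> g (y i))"
      using p by (simp add: e_def left x_fix sum_distrib_left mult.assoc)
    then show ?thesis using tr[OF PA[OF p]] fixD[OF p g] by simp
  qed
  then obtain l where "e = scaleC l 1" using commutant_scalar by blast
  then show thesis using tr that by (simp add: mult_scaleC_left)
qed

text \<open>Depth two puts the unit of \<open>A\<^sub>2\<close> into the span of \<open>X e\<^sub>A Y\<close> with \<open>X\<close>, \<open>Y\<close> in \<open>P' \<inter> A\<^sub>1\<close>. Since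
  \<open>P' \<inter> Q\<close> is scalar, comparing the \<open>\<alpha>\<^sub>g\<close>-coefficients of the resulting identity on \<open>a e\<^sub>P w\<close> yields
  \<open>a = \<alpha>\<^sub>g(b)\<close> with \<open>b\<close> a linear combination of values \<open>Y(a) \<in> A\<close>, so every \<open>\<alpha>\<^sub>g\<close> preserves \<open>A\<close>.\<close>

lemma depth_two_imp_normal:
  assumes "depth_two R P F"
  shows "H \<lhd> G"
proof -
  let ?C1 = "relative_commutant A1 (left_mult R ` P)"
  let ?S = "{jones_product A1 E X Y | X Y. X \<in> ?C1 \<and> Y \<in> ?C1}"
  have eq: "relative_commutant A2 (left_mult A1 ` left_mult R ` P) = linear_span A2 ?S"
    using assms unfolding depth_two_def by (simp add: Let_def)
  \<comment> \<open>The unit commutes with everything; it is the one element of P' \<inter> A_2 to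
    which the depth two hypothesis is applied.\<close>
  have "(\<lambda>T\<in>carrier A1. T) \<in> relative_commutant A2 (left_mult A1 ` left_mult R ` P)"
    unfolding relative_commutant_def
  proof (intro CollectI conjI one_A2 ballI)
    fix s assume "s \<in> left_mult A1 ` left_mult R ` P"
    then obtain p where p: "p \<in> P" "s = left_mult A1 (left_mult R p)" by blast
    then have L: "left_mult R p \<in> carrier A1" using left_mult_A1 P_sub by blast
    have "s T \<in> carrier A1" if "T \<in> carrier A1" for T
      using p L that by (simp add: left_mult_def)
    then show "s \<otimes>\<^bsub>A2\<^esub> (\<lambda>T\<in>carrier A1. T) = (\<lambda>T\<in>carrier A1. T) \<otimes>\<^bsub>A2\<^esub> s"
      unfolding E2.B_simps by (auto simp: compose_def)
  qed
  then obtain m :: nat and c S where S: "S \<in> {..<m} \<rightarrow> ?S"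
    and id: "(\<lambda>T\<in>carrier A1. T) = (\<Oplus>\<^bsub>A2\<^esub>i\<in>{..<m}. c i \<odot>\<^bsub>A2\<^esub> S i)"
    unfolding eq linear_span_def by blast
  have "\<forall>i\<in>{..<m}. \<exists>X Y. S i = jones_product A1 E X Y \<and> X \<in> ?C1 \<and> Y \<in> ?C1"
    using S by fastforce
  then obtain X Y where XY: "\<And>i. i < m \<Longrightarrow> S i = jones_product A1 E (X i) (Y i)"
      "\<And>i. i < m \<Longrightarrow> X i \<in> ?C1" "\<And>i. i < m \<Longrightarrow> Y i \<in> ?C1"
    by (metis lessThan_iff)
  have XA: "X i \<in> carrier A1" and YA: "Y i \<in> carrier A1" if "i < m" for i
    using XY(2,3)[OF that] by (simp_all add: relative_commutant_def)
  have key: "a * F w = (\<Sum>i<m. scaleC (c i) ((real (card H) / N) *\<^sub>R X i (Y i a * w)))"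
    if a: "a \<in> A" and w: "w \<in> A" for a w
  proof -
    \<comment> \<open>Applied to a e_P w, the presentation of the unit turns each E(Y_i T) into left
      multiplication by (|H|/|G|) Y_i(a) w; evaluating the operators at 1 leaves an identity in
      A.\<close>
    define T where "T = E1.jp a w"
    have T: "T \<in> carrier A1" unfolding T_def by (rule E1.jp_B) (simp_all add: a w)
    have one: "1 \<in> carrier R" by (simp add: A_closed)
    have YT: "Y i \<otimes>\<^bsub>A1\<^esub> T \<in> carrier A1" if "i < m" for i
      using YA[OF that] T by (simp add: E1.B_simps A1_compose)
    have ET: "E (Y i \<otimes>\<^bsub>A1\<^esub> T) \<in> carrier A1" if "i < m" for i
      using left_mult_A1[OF dual_closed[OF YT[OF that]]] .
    have SA2: "S i \<in> carrier A2" if "i < m" for i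
      unfolding XY(1)[OF that] by (rule E2.jp_B[OF XA[OF that] YA[OF that]])
    have ST: "S i T = X i \<otimes>\<^bsub>A1\<^esub> E (Y i \<otimes>\<^bsub>A1\<^esub> T)" if "i < m" for i
      unfolding XY(1)[OF that] by (rule E2.jp_apply[OF XA[OF that] YA[OF that] T])
    have "T = (\<Oplus>\<^bsub>A2\<^esub>i\<in>{..<m}. c i \<odot>\<^bsub>A2\<^esub> S i) T" using fun_cong[OF id, of T] T by (simp only: restrict_apply')
    also have "\<dots> = (\<Oplus>\<^bsub>A1\<^esub>i\<in>{..<m}. (c i \<odot>\<^bsub>A2\<^esub> S i) T)"
    proof (rule E2.B_finsum_apply)
      show "c i \<odot>\<^bsub>A2\<^esub> S i \<in> carrier A2" if "i \<in> {..<m}" for i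
        unfolding E2.B_simps by (rule E2.B_smult_closed[OF SA2]) (use that in simp)
    qed (simp_all only: finite_lessThan T)
    also have "\<dots> = (\<Oplus>\<^bsub>A1\<^esub>i\<in>{..<m}. c i \<odot>\<^bsub>A1\<^esub> (X i \<otimes>\<^bsub>A1\<^esub> E (Y i \<otimes>\<^bsub>A1\<^esub> T)))"
    proof (rule E2.finsum_cong')
      show "(\<lambda>i. c i \<odot>\<^bsub>A1\<^esub> (X i \<otimes>\<^bsub>A1\<^esub> E (Y i \<otimes>\<^bsub>A1\<^esub> T))) \<in> {..<m} \<rightarrow> carrier A1"
        using XA ET by auto
      show "(c i \<odot>\<^bsub>A2\<^esub> S i) T = c i \<odot>\<^bsub>A1\<^esub> (X i \<otimes>\<^bsub>A1\<^esub> E (Y i \<otimes>\<^bsub>A1\<^esub> T))"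
        if "i \<in> {..<m}" for i
      proof -
        have "i < m" using that by simp
        from ST[OF this, symmetric] show ?thesis
          by (simp only: E2.B_simps(4) E2.M_smult_at[OF T])
      qed
    qed (rule refl)
    finally have "T 1 = (\<Oplus>\<^bsub>A1\<^esub>i\<in>{..<m}. c i \<odot>\<^bsub>A1\<^esub> (X i \<otimes>\<^bsub>A1\<^esub> E (Y i \<otimes>\<^bsub>A1\<^esub> T))) 1"
      by simp
    also have "\<dots> = (\<Oplus>\<^bsub>R\<^esub>i\<in>{..<m}. (c i \<odot>\<^bsub>A1\<^esub> (X i \<otimes>\<^bsub>A1\<^esub> E (Y i \<otimes>\<^bsub>A1\<^esub> T))) 1)"
      by (rule E1.B_finsum_apply) (use XA ET one in auto)
    also have "\<dots> = (\<Sum>i<m. (c i \<odot>\<^bsub>A1\<^esub> (X i \<otimes>\<^bsub>A1\<^esub> E (Y i \<otimes>\<^bsub>A1\<^esub> T))) 1)"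
    proof (rule finsum_algebra)
      fix i assume "i \<in> {..<m}"
      then have "c i \<odot>\<^bsub>A1\<^esub> (X i \<otimes>\<^bsub>A1\<^esub> E (Y i \<otimes>\<^bsub>A1\<^esub> T)) \<in> carrier A1"
        using XA ET by auto
      then show "(c i \<odot>\<^bsub>A1\<^esub> (X i \<otimes>\<^bsub>A1\<^esub> E (Y i \<otimes>\<^bsub>A1\<^esub> T))) 1 \<in> A"
        using A1_D(2) A_closed(2) by blast
    qed simp
    also have "\<dots> = (\<Sum>i<m. scaleC (c i) ((real (card H) / N) *\<^sub>R X i (Y i a * w)))"
    proof (rule sum.cong)
      fix i assume "i \<in> {..<m}"
      then have i: "i < m" by simp
      have Ya: "Y i a \<in> A" using A1_D(2)[OF YA[OF i] a] .
      have "(c i \<odot>\<^bsub>A1\<^esub> (X i \<otimes>\<^bsub>A1\<^esub> E (Y i \<otimes>\<^bsub>A1\<^esub> T))) 1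
          = scaleC (c i) (X i (dual (compose (carrier R) (Y i) T)))"
        using one by (simp add: E1.B_simps E1.M_smult_at compose_eq left_mult_apply)
      also have "dual (compose (carrier R) (Y i) T) = (real (card H) / N) *\<^sub>R (Y i a * w)"
        unfolding T_def by (rule dual_compose_jp[OF YA[OF i] a w])
      also have "X i \<dots> = (real (card H) / N) *\<^sub>R X i (Y i a * w)"
        by (rule A1_scaleR[OF XA[OF i]]) (use Ya w in \<open>simp add: A_closed\<close>)
      finally show "(c i \<odot>\<^bsub>A1\<^esub> (X i \<otimes>\<^bsub>A1\<^esub> E (Y i \<otimes>\<^bsub>A1\<^esub> T))) 1
          = scaleC (c i) ((real (card H) / N) *\<^sub>R X i (Y i a * w))" .
    qed simp
    finally show ?thesis using a w by (simp add: T_def jp_apply A_closed)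
  qed
  have descend: "\<alpha> (inv g) a \<in> A" if g: "g \<in> carrier G" and a: "a \<in> A" for g a
  proof -
    have "\<forall>i\<in>{..<m}. \<exists>l. \<forall>b\<in>A. (\<Sum>j<n. X i (b * x j) * \<alpha> g (y j)) = scaleC l (\<alpha> g b)"
      using commutant_coefficient[OF XY(2) g] by (metis lessThan_iff)
    then obtain l where l: "\<And>i b. \<lbrakk>i < m; b \<in> A\<rbrakk> \<Longrightarrow>
        (\<Sum>j<n. X i (b * x j) * \<alpha> g (y j)) = scaleC (l i) (\<alpha> g b)"
      by (metis lessThan_iff)
    \<comment> \<open>Chosen so that \<alpha>_g(b) is |G| times the sum reached at the end of the
      calculation; the scalars come out of \<alpha>_g, and b stays in A.\<close>
    define b where "b = N *\<^sub>R (\<Sum>i<m. scaleC (c i) ((real (card H) / N) *\<^sub>R scaleC (l i) (Y i a)))"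
    have YaA: "Y i a \<in> A" if "i < m" for i using A1_D(2)[OF YA[OF that] a] .
    have b: "b \<in> A" unfolding b_def by (intro A_closed(5,6) fix_sum[OF H_sub] YaA) simp
    \<comment> \<open>The identity \<open>key\<close> at w = x_j is multiplied by \<alpha>_g(y_j)
      and summed. On the left \<alpha>_g fixes F(x_j), so the coordinates collapse to 1/|G|; on the
      right they extract the \<alpha>_g-coefficient of each X_i.\<close>
    have "(\<Sum>j<n. F (x j) * \<alpha> g (y j)) = \<alpha> g (\<Sum>j<n. F (1 * x j) * y j)"
      using fixD[OF F_P g] g by (simp add: act_sum act_mult)
    also have "\<dots> = (1 / N) *\<^sub>R 1"
      using g by (simp only: F_reconstruct(2)[OF A_closed(2)] act_scaleR act_one)
    finally have "(1 / N) *\<^sub>R a = (\<Sum>j<n. (a * F (x j)) * \<alpha> g (y j))"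
      by (simp add: mult.assoc flip: sum_distrib_left)
    also have "\<dots> = (\<Sum>j<n. \<Sum>i<m. scaleC (c i) ((real (card H) / N) *\<^sub>R (X i (Y i a * x j) * \<alpha> g (y j))))"
      by (simp add: key[OF a x_fix] sum_distrib_right mult_scaleC_left)
    also have "\<dots> = (\<Sum>i<m. scaleC (c i) ((real (card H) / N) *\<^sub>R (\<Sum>j<n. X i (Y i a * x j) * \<alpha> g (y j))))"
      by (subst sum.swap) (simp add: scaleC_sum_right scaleR_sum_right)
    also have "\<dots> = (\<Sum>i<m. scaleC (c i) ((real (card H) / N) *\<^sub>R scaleC (l i) (\<alpha> g (Y i a))))"
      by (intro sum.cong refl) (simp add: l YaA)
    also have "N *\<^sub>R \<dots> = \<alpha> g b" using g by (simp add: b_def act_sum act_scaleR act_scaleC)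
    finally have "N *\<^sub>R (1 / N) *\<^sub>R a = \<alpha> g b" by simp
    then have "a = \<alpha> g b" using N_pos by simp
    then show ?thesis using g b by (simp add: act_comp)
  qed
  show ?thesis
  proof (rule invariant_imp_normal)
    show "\<alpha> g a \<in> A" if "g \<in> carrier G" "a \<in> A" for g a
      using descend[of "inv g" a] that by simp
  qed
qed

text \<open>The elements d_g satisfy d_g \<theta>(a) = \<alpha>_g(a) d_g and add up to \<theta>(1) =
  1, so some d_g is nonzero. It commutes with P, hence is a nonzero scalar and can be
  cancelled.\<close>

lemma homomorphism_over_P:
  assumes add: "\<And>a b. \<lbrakk>a \<in> A; b \<in> A\<rbrakk> \<Longrightarrow> \<theta> (a + b) = \<theta> a + \<theta> b"
    and mult: "\<And>a b. \<lbrakk>a \<in> A; b \<in> A\<rbrakk> \<Longrightarrow> \<theta> (a * b) = \<theta> a * \<theta> b"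
    and P: "\<And>p. p \<in> P \<Longrightarrow> \<theta> p = p"
  obtains g where "g \<in> carrier G" "\<And>a. a \<in> A \<Longrightarrow> \<theta> a = \<alpha> g a"
proof -
  have PA: "p \<in> A" if "p \<in> P" for p using that P_sub by blast
  define d where "d g = (\<Sum>i<n. \<alpha> g (x i) * \<theta> (y i))" for g
  have d: "d g * \<theta> a = \<alpha> g a * d g" if g: "g \<in> carrier G" and a: "a \<in> A" for g a
  proof -
    have "d g * \<theta> a = (\<Sum>i<n. \<alpha> g (x i) * \<theta> (y i * a))"
      using a by (simp add: d_def sum_distrib_right mult.assoc mult y_fix)
    also have "\<dots> = (\<Sum>i<n. \<alpha> g (a * x i) * \<theta> (y i))"
    proof (rule balanced_transfer)
      fix b e p assume "b \<in> A" "e \<in> A" and p: "p \<in> P"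
      then show "\<alpha> g (b * p) * \<theta> e = \<alpha> g b * \<theta> (p * e)"
        using g by (simp add: act_mult mult.assoc mult PA P fixD)
    qed (use g a add in \<open>simp_all add: act_add\<close>)
    also have "\<dots> = \<alpha> g a * d g" using g by (simp add: d_def sum_distrib_left act_mult mult.assoc)
    finally show ?thesis .
  qed
  have zero: "\<theta> 0 = 0" using add[of 0 0] A_closed(1) by simp
  have sum: "\<theta> (\<Sum>i\<in>I. f i) = (\<Sum>i\<in>I. \<theta> (f i))" if "\<And>i. f i \<in> A" for I :: "nat set" and f
    using that by (induction I rule: infinite_finite_induct) (simp_all add: zero add fix_sum[OF H_sub])
  have "(\<Sum>g\<in>carrier G. d g) = (\<Sum>i<n. tr (carrier G) (x i) * \<theta> (y i))"
    unfolding d_def by (subst sum.swap) (simp add: sum_distrib_right)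
  also have "\<dots> = (\<Sum>i<n. \<theta> (tr (carrier G) (1 * x i) * y i))"
    by (simp add: mult PA tr_P y_fix P)
  also have "\<dots> = \<theta> 1"
    by (subst sum[symmetric]) (simp_all only: reconstruct_right A_closed PA tr_P y_fix)
  also have "\<theta> 1 = 1" using P fix_closed(2)[OF order_refl] by blast
  finally have "(\<Sum>g\<in>carrier G. d g) \<noteq> 0" by simp
  then obtain g where g: "g \<in> carrier G" "d g \<noteq> 0" by (meson sum.not_neutral_contains_not_neutral)
  have "d g * p = p * d g" if "p \<in> P" for p
    using d[OF g(1) PA[OF that]] P[OF that] fixD[OF that g(1)] by simp
  then obtain l where l: "d g = scaleC l 1" using commutant_scalar by blast
  then have l0: "l \<noteq> 0" using g(2) by auto
  have "\<theta> a = \<alpha> g a" if a: "a \<in> A" for a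
  proof -
    have "scaleC l (\<theta> a) = scaleC l (\<alpha> g a)"
      using d[OF g(1) a] by (simp add: l mult_scaleC_left mult_scaleC_right)
    then have "scaleC (inverse l) (scaleC l (\<theta> a)) = scaleC (inverse l) (scaleC l (\<alpha> g a))" by simp
    then show ?thesis using l0 by (simp add: scaleC_scaleC)
  qed
  with g(1) show thesis by (rule that)
qed

text \<open>A Galois correspondence argument: the g acting on A as some \<beta>_k form a subgroup D
  containing H, and D has the same fixed points as G. The coordinates for D then force D = G, and
  members of D preserve A.\<close>

lemma fixed_point_algebra_imp_normal:
  fixes K :: "('k, 'l) monoid_scheme" and \<beta> :: "'k \<Rightarrow> 'q \<Rightarrow> 'q"
  assumes K: "group K" and act_K: "cstar_action A K \<beta>" and eq: "P = fixed_points A (carrier K) \<beta>"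
  shows "H \<lhd> G"
proof -
  interpret K: group K by (rule K)
  have \<beta>: "\<beta> k a \<in> A" "b \<in> A \<Longrightarrow> \<beta> k (a + b) = \<beta> k a + \<beta> k b" "b \<in> A \<Longrightarrow> \<beta> k (a * b) = \<beta> k a * \<beta> k b"
    "\<beta> \<one>\<^bsub>K\<^esub> a = a" "k' \<in> carrier K \<Longrightarrow> \<beta> (k \<otimes>\<^bsub>K\<^esub> k') a = \<beta> k (\<beta> k' a)"
    if "k \<in> carrier K" "a \<in> A" for k k' a b
  proof -
    have "bij_betw (\<beta> k) A A"
      using act_K that unfolding cstar_action_def star_automorphism_def by blast
    then show "\<beta> k a \<in> A" using that(2) by (rule bij_betw_apply)
  qed (use act_K that in \<open>auto simp: cstar_action_def star_automorphism_def\<close>)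
  define D where "D = {g \<in> carrier G. \<exists>k\<in>carrier K. \<forall>a\<in>A. \<alpha> g a = \<beta> k a}"
  have restr: "\<exists>g\<in>D. \<forall>a\<in>A. \<beta> k a = \<alpha> g a" if k: "k \<in> carrier K" for k
  proof -
    obtain g where "g \<in> carrier G" "\<And>a. a \<in> A \<Longrightarrow> \<beta> k a = \<alpha> g a"
    proof (rule homomorphism_over_P[of "\<beta> k"])
      show "\<beta> k p = p" if "p \<in> P" for p using that k unfolding eq by (simp add: fixed_points_def)
    qed (use \<beta> k in auto)
    then show ?thesis using k by (intro bexI[of _ g]) (auto simp: D_def intro!: bexI[of _ k])
  qed
  have D_A: "\<alpha> g a \<in> A" if "g \<in> D" "a \<in> A" for g a
    using that \<beta>(1) unfolding D_def by auto
  have D: "subgroup D G"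
  proof (rule subgroupI)
    show "D \<subseteq> carrier G" by (auto simp: D_def)
    have "\<one> \<in> D" using \<beta>(4)[OF K.one_closed] by (auto simp: D_def intro!: bexI[of _ "\<one>\<^bsub>K\<^esub>"])
    then show "D \<noteq> {}" by blast
  next
    fix g assume "g \<in> D"
    then obtain k where k: "g \<in> carrier G" "k \<in> carrier K" "\<And>a. a \<in> A \<Longrightarrow> \<alpha> g a = \<beta> k a"
      by (auto simp: D_def)
    have "\<alpha> (inv g) a = \<beta> (inv\<^bsub>K\<^esub> k) a" if a: "a \<in> A" for a
    proof -
      have "\<beta> (inv\<^bsub>K\<^esub> k) a \<in> A" using \<beta>(1) k a by simp
      then have "\<alpha> g (\<beta> (inv\<^bsub>K\<^esub> k) a) = \<beta> (k \<otimes>\<^bsub>K\<^esub> inv\<^bsub>K\<^esub> k) a"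
        using k a \<beta>(5)[OF k(2) a, of "inv\<^bsub>K\<^esub> k"] by simp
      also have "\<dots> = a" using k a \<beta>(4) by simp
      finally have "\<alpha> (inv g) (\<alpha> g (\<beta> (inv\<^bsub>K\<^esub> k) a)) = \<alpha> (inv g) a" by simp
      then show ?thesis using k(1) by (simp add: act_comp)
    qed
    then show "inv g \<in> D" using k by (auto simp: D_def intro!: bexI[of _ "inv\<^bsub>K\<^esub> k"])
  next
    fix g h assume "g \<in> D" "h \<in> D"
    then obtain k k' where k: "g \<in> carrier G" "k \<in> carrier K" "\<And>a. a \<in> A \<Longrightarrow> \<alpha> g a = \<beta> k a"
      "h \<in> carrier G" "k' \<in> carrier K" "\<And>a. a \<in> A \<Longrightarrow> \<alpha> h a = \<beta> k' a"
      by (auto simp: D_def)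
    have "\<alpha> (g \<otimes> h) a = \<beta> (k \<otimes>\<^bsub>K\<^esub> k') a" if a: "a \<in> A" for a
      using k a \<beta>(1)[OF k(5) a] \<beta>(5)[OF k(2) a k(5)] by (simp flip: act_comp)
    then show "g \<otimes> h \<in> D" using k by (auto simp: D_def intro!: bexI[of _ "k \<otimes>\<^bsub>K\<^esub> k'"])
  qed
  have HD: "H \<subseteq> D"
    using H_sub \<beta>(4)[OF K.one_closed] by (auto simp: D_def fixD intro!: bexI[of _ "\<one>\<^bsub>K\<^esub>"])
  \<comment> \<open>Every \<beta>_k is realised on A by a member of D, so D-fixed elements are
    \<beta>-fixed.\<close>
  have fixD_P: "a \<in> P" if a: "a \<in> Fix D" for a
  proof -
    have aA: "a \<in> A" using a fix_mono[OF HD] by blast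
    have "\<beta> k a = a" if "k \<in> carrier K" for k
      using restr[OF that] aA fixD[OF a] by metis
    with aA show ?thesis unfolding eq by (simp add: fixed_points_def)
  qed
  have "carrier G \<subseteq> D"
  proof
    fix g assume g: "g \<in> carrier G"
    \<comment> \<open>An arbitrary g fixes P and hence \<open>Fix D\<close> pointwise, so
      \<open>fixing_mem\<close> for D places it in D.\<close>
    obtain m and u v :: "nat \<Rightarrow> 'q" where "\<And>i. u i \<in> Fix D" "\<And>i. v i \<in> Fix D"
      "\<And>g. g \<in> carrier G \<Longrightarrow>
        (\<Sum>i<m. u i * \<alpha> g (v i)) = (if g \<in> D then (1 / real (card D)) *\<^sub>R 1 else 0)"
      by (rule galois_coordinates[OF D]) (rule that)
    then interpret D: galois_basis G \<alpha> D m u v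
      by (intro galois_basis.intro galois_basis_axioms.intro outer_action_axioms D)
    show "g \<in> D" by (rule D.fixing_mem[OF g]) (use fixD_P fixD g in blast)
  qed
  then show ?thesis using D_A by (intro invariant_imp_normal) auto
qed

end

theorem mainTheorem3:
  fixes G :: "('g, 'm) monoid_scheme"
    and H :: "'g set"
    and \<alpha> :: "'g \<Rightarrow> 'q::cstar_algebra \<Rightarrow> 'q"
    and A P :: "'q set"
  assumes "simple_cstar (UNIV :: 'q set)"
    and "group G" and "finite (carrier G)"
    and "cstar_action UNIV G \<alpha>" and "rohlin_property UNIV G \<alpha>"
    and "subgroup H G" and "\<not> H \<lhd> G"
    and "P = fixed_points UNIV (carrier G) \<alpha>"
    and "A = fixed_points UNIV H \<alpha>"
  shows "\<not> depth_two (algebra_of A) P (group_average G \<alpha>) \<and>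
    (\<forall>(K :: 'k monoid) \<beta>.
       group K \<and> finite (carrier K) \<and> cstar_action A K \<beta> \<and> rohlin_property A K \<beta>
       \<longrightarrow> P \<noteq> fixed_points A (carrier K) \<beta>)"
proof -
  interpret group G by (rule assms(2))
  interpret O: outer_action G \<alpha>
    by unfold_locales (use assms rohlin_outer[OF assms(1-5)] in blast)+
  obtain n and x y :: "nat \<Rightarrow> 'q" where "\<And>i. x i \<in> O.Fix H" "\<And>i. y i \<in> O.Fix H"
    "\<And>g. g \<in> carrier G \<Longrightarrow>
      (\<Sum>i<n. x i * \<alpha> g (y i)) = (if g \<in> H then (1 / real (card H)) *\<^sub>R 1 else 0)"
    by (rule O.galois_coordinates[OF assms(6)]) (rule that)
  then interpret galois_basis G \<alpha> H n x y
    by (intro galois_basis.intro galois_basis_axioms.intro O.outer_action_axioms assms(6))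
  show ?thesis
    using depth_two_imp_normal fixed_point_algebra_imp_normal assms(7) unfolding assms(8,9) by blast
qed

end
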